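(* Let $(X,\sigma)$ be a symplectic space of arbitrary (finite or infinite) dimension, with resolvent algebra $\mathcal{R}=\mathcal{R}(X,\sigma)$. Let $\lambda\in\mathbb{R}\setminus\{0\}$, $f\in X\setminus\{0\}$, $\rho\in\mathrm{spec}(R(\lambda,f))$, and let $\mathcal{I}(\lambda,f;\rho)$ be the ideal generated by $R(\lambda,f)-\rho\,\mathbf{1}$, i.e. $\mathcal{I}(\lambda,f;\rho)=[\mathcal{R}\,(R(\lambda,f)-\rho\,\mathbf{1})\,\mathcal{R}]$. Then: (i) $\mathcal{I}(\lambda,f;\rho)$ is proper. (ii) $\mathcal{I}(\lambda,f;\rho)=[\mathcal{R}\,(R(\lambda,f)-\rho\,\mathbf{1})]=[(R(\lambda,f)-\rho\,\mathbf{1})\,\mathcal{R}]$. (iii) $R(\mu,f)-\dfrac{\rho}{1+i(\mu-\lambda)\rho}\,\mathbf{1}\in\mathcal{I}(\lambda,f;\rho)$ for all $\mu\in\mathbb{R}\setminus\{0\}$. (iv) If $\rho\neq0$, then $R(\mu,g)\in\mathcal{I}(\lambda,f;\rho)$ for all $\mu\in\mathbb{R}\setminus\{0\}$ and all $g\in X$ such that $\sigma(g,f)\neq0$.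
   Context: A symplectic space $(X,\sigma)$ is a real vector space $X$ with a nondegenerate symplectic (bilinear, antisymmetric) form $\sigma : X\times X\to\mathbb{R}$. Standing assumption: $(X,\sigma)$ admits a complex structure, i.e. a real linear map $J:X\to X$ with $J^2=-1$, $\sigma(Jf,Jg)=\sigma(f,g)$ and $\sigma(f,Jf)>0$ for $f\neq 0$ (automatic if $\dim X<\infty$). Resolvent algebra: let $\mathcal{R}_0$ be the universal unital *-algebra (over $\mathbb{C}$) generated by symbols $R(\lambda,f)$, $\lambda\in\mathbb{R}\setminus\{0\}$, $f\in X$, subject to the relations, for all $\lambda,\mu,\nu\in\mathbb{R}\setminus\{0\}$ and $f,g\in X$: (1) $R(\lambda,f)-R(\mu,f)=i(\mu-\lambda)R(\lambda,f)R(\mu,f)$; (2) $R(\lambda,f)^*=R(-\lambda,f)$; (3) $[R(\lambda,f),R(\mu,g)]=i\sigma(f,g)R(\lambda,f)R(\mu,g)^2R(\lambda,f)$ (here the bracket is the commutator); (4) $\nu R(\nu\lambda,\nu f)=R(\lambda,f)$; (5) $R(\lambda,f)R(\mu,g)=R(\lambda+\mu,f+g)\big(R(\lambda,f)+R(\mu,g)+i\sigma(f,g)R(\lambda,f)^2R(\mu,g)\big)$ if $\lambda+\mu\neq0$; (6) $R(\lambda,0)=-\frac{i}{\lambda}\mathbf{1}$. Let $\mathfrak{S}$ be the set of positive normalized functionals $\omega$ on $\mathcal{R}_0$, with GNS-representations $(\pi_\omega,\mathcal{H}_\omega)$ (these are uniformly bounded over $\mathfrak{S}$). Then $\|A\|=\sup_{\omega\in\mathfrak{S}}\|\pi_\omega(A)\|$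 is a C*-seminorm on $\mathcal{R}_0$, and $\mathcal{R}(X,\sigma)$ is the C*-completion of $\mathcal{R}_0/\ker\|\cdot\|$. "Ideal" always means closed two-sided ideal; proper means different from $\mathcal{R}(X,\sigma)$. In the claim, $[\,\cdot\,]$ denotes the closed linear span of its argument (e.g. $[\mathcal{R}A\mathcal{R}]$ is the closed linear span of $\{BAC:B,C\in\mathcal{R}\}$). $\mathrm{spec}(R(\lambda,f))$ is the spectrum of $R(\lambda,f)$ in $\mathcal{R}(X,\sigma)$. *)

theory Defs
  imports "HOL-Analysis.Analysis"
begin

section \<open>Symplectic spaces\<close>

class symplectic_space = real_vector +
  fixes symp_form :: "'a \<Rightarrow> 'a \<Rightarrow> real" (\<open>\<sigma>\<close>)
  assumes symp_add_left: "\<sigma> (f + g) h = \<sigma> f h + \<sigma> g h"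
    and symp_scaleR_left: "\<sigma> (r *\<^sub>R f) g = r * \<sigma> f g"
    and symp_antisym: "\<sigma> f g = - \<sigma> g f"
    and symp_nondegenerate: "(\<forall>g. \<sigma> f g = 0) \<Longrightarrow> f = 0"
    and symp_complex_structure:
      "\<exists>J. (\<forall>f g. J (f + g) = J f + J g) \<and> (\<forall>r f. J (r *\<^sub>R f) = r *\<^sub>R J f) \<and>
           (\<forall>f. J (J f) = - f) \<and> (\<forall>f g. \<sigma> (J f) (J g) = \<sigma> f g) \<and>
           (\<forall>f. f \<noteq> 0 \<longrightarrow> \<sigma> f (J f) > 0)"


section \<open>Complex unital *-algebras\<close>

class scaleC =
  fixes scaleC :: "complex \<Rightarrow> 'a \<Rightarrow> 'a" (infixr \<open>*\<^sub>C\<close> 75)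

class complex_algebra_1 = real_algebra_1 + scaleC +
  assumes scaleC_add_right: "c *\<^sub>C (x + y) = c *\<^sub>C x + c *\<^sub>C y"
    and scaleC_add_left: "(c + d) *\<^sub>C x = c *\<^sub>C x + d *\<^sub>C x"
    and scaleC_scaleC: "c *\<^sub>C d *\<^sub>C x = (c * d) *\<^sub>C x"
    and scaleC_one: "1 *\<^sub>C x = x"
    and scaleR_scaleC: "r *\<^sub>R x = complex_of_real r *\<^sub>C x"
    and mult_scaleC_left: "(c *\<^sub>C x) * y = c *\<^sub>C (x * y)"
    and mult_scaleC_right: "x * (c *\<^sub>C y) = c *\<^sub>C (x * y)"

global_interpretation complex_vector: vector_space "scaleC :: complex \<Rightarrow> 'a \<Rightarrow> 'a :: complex_algebra_1"
  by unfold_locales (simp_all add: scaleC_add_right scaleC_add_left scaleC_scaleC scaleC_one)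

class complex_star_algebra_1 = complex_algebra_1 +
  fixes star :: "'a \<Rightarrow> 'a"
  assumes star_add: "star (x + y) = star x + star y"
    and star_scaleC: "star (c *\<^sub>C x) = cnj c *\<^sub>C star x"
    and star_mult: "star (x * y) = star y * star x"
    and star_star [simp]: "star (star x) = x"

class cstar_algebra_1 = complex_star_algebra_1 + real_normed_algebra_1 + banach +
  assumes norm_scaleC: "norm (c *\<^sub>C x) = cmod c * norm x"
    and norm_star_mult: "norm (star x * x) = (norm x)\<^sup>2"

lemma uminus_scaleC: "- (x :: 'a :: complex_algebra_1) = (- 1) *\<^sub>C x"
  by (simp add: complex_vector.scale_minus_left)

lemma star_zero [simp]: "star (0 :: 'a :: complex_star_algebra_1) = 0"
  using star_add[of "0 :: 'a" 0] by simp

lemma star_minus: "star (- x :: 'a :: complex_star_algebra_1) = - star x"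
  by (simp only: uminus_scaleC star_scaleC) simp

lemma star_diff: "star (x - y :: 'a :: complex_star_algebra_1) = star x - star y"
  using star_add[of x "- y"] by (simp add: star_minus)

lemma star_one [simp]: "star (1 :: 'a :: complex_star_algebra_1) = 1"
  by (metis mult.right_neutral star_mult star_star mult.left_neutral)

instantiation complex :: complex_star_algebra_1
begin
definition "c *\<^sub>C (z :: complex) = c * z"
definition "star (z :: complex) = cnj z"
instance
  by standard (auto simp: scaleC_complex_def star_complex_def algebra_simps scaleR_conv_of_real)
end


section \<open>The universal *-algebra \<open>\<R>\<^sub>0\<close>\<close>

definition resolvent_relations ::
  "(real \<Rightarrow> 'x :: symplectic_space \<Rightarrow> 'a :: complex_star_algebra_1) \<Rightarrow> bool" where
  "resolvent_relations R \<longleftrightarrow>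
     (\<forall>l m f. l \<noteq> 0 \<longrightarrow> m \<noteq> 0 \<longrightarrow>
        R l f - R m f = (\<i> * complex_of_real (m - l)) *\<^sub>C (R l f * R m f)) \<and>
     (\<forall>l f. l \<noteq> 0 \<longrightarrow> star (R l f) = R (- l) f) \<and>
     (\<forall>l m f g. l \<noteq> 0 \<longrightarrow> m \<noteq> 0 \<longrightarrow>
        R l f * R m g - R m g * R l f = (\<i> * complex_of_real (\<sigma> f g)) *\<^sub>C (R l f * (R m g)\<^sup>2 * R l f)) \<and>
     (\<forall>n l f. n \<noteq> 0 \<longrightarrow> l \<noteq> 0 \<longrightarrow> complex_of_real n *\<^sub>C R (n * l) (n *\<^sub>R f) = R l f) \<and>
     (\<forall>l m f g. l \<noteq> 0 \<longrightarrow> m \<noteq> 0 \<longrightarrow> l + m \<noteq> 0 \<longrightarrow>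
        R l f * R m g = R (l + m) (f + g) *
          (R l f + R m g + (\<i> * complex_of_real (\<sigma> f g)) *\<^sub>C ((R l f)\<^sup>2 * R m g))) \<and>
     (\<forall>l. l \<noteq> 0 \<longrightarrow> R l 0 = (- \<i> / complex_of_real l) *\<^sub>C 1)"

text \<open>
  \<open>\<R>\<^sub>0\<close> is the set of *-algebra terms in the symbols \<open>R(l, f)\<close>, modulo the smallest
  congruence that contains the axioms of unital *-algebras and the relations. There are no
  symbols \<open>R(0, f)\<close> in the mathematics; here they are present in the term language and are
  identified with \<open>0\<close>, which gives the same algebra.
\<close>

datatype 'x rterm =
    Sym real 'x
  | RtZero (\<open>\<^bold>0\<close>)
  | RtOne (\<open>\<^bold>1\<close>)
  | RtPlus "'x rterm" "'x rterm" (infixl \<open>\<^bold>+\<close> 65)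
  | RtTimes "'x rterm" "'x rterm" (infixl \<open>\<^bold>*\<close> 70)
  | RtScale complex "'x rterm" (infixr \<open>\<^bold>\<cdot>\<close> 75)
  | Star "'x rterm"

abbreviation Minus :: "'x rterm \<Rightarrow> 'x rterm \<Rightarrow> 'x rterm" (infixl \<open>\<^bold>-\<close> 65) where
  "a \<^bold>- b \<equiv> a \<^bold>+ (- 1) \<^bold>\<cdot> b"

inductive rterm_eq :: "'x :: symplectic_space rterm \<Rightarrow> 'x rterm \<Rightarrow> bool" (infix \<open>\<^bold>\<approx>\<close> 50) where
  rt_refl: "a \<^bold>\<approx> a"
| rt_sym: "a \<^bold>\<approx> b \<Longrightarrow> b \<^bold>\<approx> a"
| rt_trans: "a \<^bold>\<approx> b \<Longrightarrow> b \<^bold>\<approx> c \<Longrightarrow> a \<^bold>\<approx> c"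
| rt_cong_plus: "a \<^bold>\<approx> a' \<Longrightarrow> b \<^bold>\<approx> b' \<Longrightarrow> a \<^bold>+ b \<^bold>\<approx> a' \<^bold>+ b'"
| rt_cong_times: "a \<^bold>\<approx> a' \<Longrightarrow> b \<^bold>\<approx> b' \<Longrightarrow> a \<^bold>* b \<^bold>\<approx> a' \<^bold>* b'"
| rt_cong_scale: "a \<^bold>\<approx> a' \<Longrightarrow> c \<^bold>\<cdot> a \<^bold>\<approx> c \<^bold>\<cdot> a'"
| rt_cong_star: "a \<^bold>\<approx> a' \<Longrightarrow> Star a \<^bold>\<approx> Star a'"
| rt_plus_assoc: "(a \<^bold>+ b) \<^bold>+ c \<^bold>\<approx> a \<^bold>+ (b \<^bold>+ c)"
| rt_plus_commute: "a \<^bold>+ b \<^bold>\<approx> b \<^bold>+ a"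
| rt_plus_zero: "\<^bold>0 \<^bold>+ a \<^bold>\<approx> a"
| rt_plus_inverse: "a \<^bold>- a \<^bold>\<approx> \<^bold>0"
| rt_times_assoc: "(a \<^bold>* b) \<^bold>* c \<^bold>\<approx> a \<^bold>* (b \<^bold>* c)"
| rt_times_one_left: "\<^bold>1 \<^bold>* a \<^bold>\<approx> a"
| rt_times_one_right: "a \<^bold>* \<^bold>1 \<^bold>\<approx> a"
| rt_distrib_right: "(a \<^bold>+ b) \<^bold>* c \<^bold>\<approx> a \<^bold>* c \<^bold>+ b \<^bold>* c"
| rt_distrib_left: "a \<^bold>* (b \<^bold>+ c) \<^bold>\<approx> a \<^bold>* b \<^bold>+ a \<^bold>* c"
| rt_scale_plus_right: "z \<^bold>\<cdot> (a \<^bold>+ b) \<^bold>\<approx> z \<^bold>\<cdot> a \<^bold>+ z \<^bold>\<cdot> b"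
| rt_scale_plus_left: "(z + w) \<^bold>\<cdot> a \<^bold>\<approx> z \<^bold>\<cdot> a \<^bold>+ w \<^bold>\<cdot> a"
| rt_scale_scale: "z \<^bold>\<cdot> w \<^bold>\<cdot> a \<^bold>\<approx> (z * w) \<^bold>\<cdot> a"
| rt_scale_one: "1 \<^bold>\<cdot> a \<^bold>\<approx> a"
| rt_scale_times_left: "(z \<^bold>\<cdot> a) \<^bold>* b \<^bold>\<approx> z \<^bold>\<cdot> (a \<^bold>* b)"
| rt_scale_times_right: "a \<^bold>* (z \<^bold>\<cdot> b) \<^bold>\<approx> z \<^bold>\<cdot> (a \<^bold>* b)"
| rt_star_plus: "Star (a \<^bold>+ b) \<^bold>\<approx> Star a \<^bold>+ Star b"
| rt_star_scale: "Star (z \<^bold>\<cdot> a) \<^bold>\<approx> cnj z \<^bold>\<cdot> Star a"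
| rt_star_times: "Star (a \<^bold>* b) \<^bold>\<approx> Star b \<^bold>* Star a"
| rt_star_star: "Star (Star a) \<^bold>\<approx> a"
| rt_no_symbol: "Sym 0 f \<^bold>\<approx> \<^bold>0"
| rt_rel1: "l \<noteq> 0 \<Longrightarrow> m \<noteq> 0 \<Longrightarrow>
    Sym l f \<^bold>- Sym m f \<^bold>\<approx> (\<i> * complex_of_real (m - l)) \<^bold>\<cdot> (Sym l f \<^bold>* Sym m f)"
| rt_rel2: "l \<noteq> 0 \<Longrightarrow> Star (Sym l f) \<^bold>\<approx> Sym (- l) f"
| rt_rel3: "l \<noteq> 0 \<Longrightarrow> m \<noteq> 0 \<Longrightarrow>
    Sym l f \<^bold>* Sym m g \<^bold>- Sym m g \<^bold>* Sym l f \<^bold>\<approx>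
    (\<i> * complex_of_real (\<sigma> f g)) \<^bold>\<cdot> (Sym l f \<^bold>* (Sym m g \<^bold>* Sym m g) \<^bold>* Sym l f)"
| rt_rel4: "n \<noteq> 0 \<Longrightarrow> l \<noteq> 0 \<Longrightarrow> complex_of_real n \<^bold>\<cdot> Sym (n * l) (n *\<^sub>R f) \<^bold>\<approx> Sym l f"
| rt_rel5: "l \<noteq> 0 \<Longrightarrow> m \<noteq> 0 \<Longrightarrow> l + m \<noteq> 0 \<Longrightarrow>
    Sym l f \<^bold>* Sym m g \<^bold>\<approx> Sym (l + m) (f + g) \<^bold>*
      (Sym l f \<^bold>+ Sym m g \<^bold>+ (\<i> * complex_of_real (\<sigma> f g)) \<^bold>\<cdot> (Sym l f \<^bold>* Sym l f \<^bold>* Sym m g))"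
| rt_rel6: "l \<noteq> 0 \<Longrightarrow> Sym l 0 \<^bold>\<approx> (- \<i> / complex_of_real l) \<^bold>\<cdot> \<^bold>1"

quotient_type (overloaded) 'x pre_resolvent_algebra = "'x :: symplectic_space rterm" / rterm_eq
  by (rule equivpI; rule reflpI sympI transpI)
    (blast intro: rt_refl rt_sym rt_trans)+

fun eval_rterm :: "(real \<Rightarrow> 'x \<Rightarrow> 'a :: complex_star_algebra_1) \<Rightarrow> 'x rterm \<Rightarrow> 'a" where
  "eval_rterm R (Sym l f) = (if l = 0 then 0 else R l f)"
| "eval_rterm R \<^bold>0 = 0"
| "eval_rterm R \<^bold>1 = 1"
| "eval_rterm R (a \<^bold>+ b) = eval_rterm R a + eval_rterm R b"
| "eval_rterm R (a \<^bold>* b) = eval_rterm R a * eval_rterm R b"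
| "eval_rterm R (z \<^bold>\<cdot> a) = z *\<^sub>C eval_rterm R a"
| "eval_rterm R (Star a) = star (eval_rterm R a)"

lemma eval_rterm_eq:
  assumes R: "resolvent_relations R" and "a \<^bold>\<approx> b"
  shows "eval_rterm R a = eval_rterm R b"
  using assms(2)
proof induction
  case (rt_rel1 l m f) 
  then show ?case using R
    by (simp add: resolvent_relations_def power2_eq_square mult.assoc complex_vector.scale_minus_left)
next
  case (rt_rel3 l m f g)
  then show ?case using R
    by (simp add: resolvent_relations_def power2_eq_square mult.assoc complex_vector.scale_minus_left)
next
  case (rt_rel4 n l f)
  then show ?case using R
    by (simp add: resolvent_relations_def)
next
  case (rt_rel5 l m f g)
  then show ?case using R
    by (simp add: resolvent_relations_def power2_eq_square mult.assoc)
next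
  case (rt_rel6 l)
  then show ?case using R by (simp add: resolvent_relations_def)
next
  case (rt_rel2 l)
  then show ?case using R by (simp add: resolvent_relations_def)
qed (simp_all add: algebra_simps star_add star_scaleC star_mult scaleC_add_right scaleC_add_left
        scaleC_scaleC scaleC_one mult_scaleC_left mult_scaleC_right complex_vector.scale_minus_left)

text \<open>
  A character that respects the relations. It shows that \<open>\<R>\<^sub>0\<close> is nontrivial and has a state.
\<close>

definition res_character :: "real \<Rightarrow> 'x :: symplectic_space \<Rightarrow> complex" where
  "res_character l f = (if f = 0 then - \<i> / l else 0)"

lemma symp_zero_left [simp]: "\<sigma> 0 (g :: 'x :: symplectic_space) = 0"
  using symp_scaleR_left[of 0 0 g] by simp

lemma symp_zero_right [simp]: "\<sigma> (g :: 'x :: symplectic_space) 0 = 0"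
  using symp_antisym[of g 0] by simp

lemma resolvent_relations_character:
  "resolvent_relations (res_character :: real \<Rightarrow> 'x :: symplectic_space \<Rightarrow> complex)"
proof -
  have r1: "- \<i> / complex_of_real l - (- \<i> / complex_of_real m) =
      \<i> * (complex_of_real m - complex_of_real l) * ((- \<i> / complex_of_real l) * (- \<i> / complex_of_real m))"
    if "l \<noteq> 0" "m \<noteq> 0" for l m
    using that by (simp add: field_simps)
  have r5: "(- \<i> / complex_of_real l) * (- \<i> / complex_of_real m) =
      - \<i> / complex_of_real (l + m) * (- \<i> / complex_of_real l + - \<i> / complex_of_real m)"
    if "l \<noteq> 0" "m \<noteq> 0" "l + m \<noteq> 0" for l m
  proof -
    have "complex_of_real (l + m) \<noteq> 0" using that by (simp del: of_real_add)
    moreover have "- \<i> / complex_of_real l + - \<i> / complex_of_real m =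
      - \<i> * complex_of_real (l + m) / (complex_of_real l * complex_of_real m)"
      using that by (simp add: field_simps)
    ultimately show ?thesis by (simp del: of_real_add)
  qed
  show ?thesis
    unfolding resolvent_relations_def scaleC_complex_def star_complex_def res_character_def
  proof (intro conjI allI impI, goal_cases)
    case (1 l m f)
    show ?case using r1[OF 1] by simp
  next
    case (2 l f)
    then show ?case by simp
  next
    case (3 l m f g)
    then show ?case by simp
  next
    case (4 n l f)
    then show ?case by simp
  next
    case (5 l m f g)
    show ?case using r5[OF 5] 5 by auto
  next
    case (6 l)
    then show ?case by simp
  qed
qed

instantiation pre_resolvent_algebra :: (symplectic_space) complex_star_algebra_1
begin

lift_definition zero_pre_resolvent_algebra :: "'a pre_resolvent_algebra" is "\<^bold>0" .
lift_definition one_pre_resolvent_algebra :: "'a pre_resolvent_algebra" is "\<^bold>1" .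
lift_definition plus_pre_resolvent_algebra ::
  "'a pre_resolvent_algebra \<Rightarrow> 'a pre_resolvent_algebra \<Rightarrow> 'a pre_resolvent_algebra" is "(\<^bold>+)"
  by (rule rt_cong_plus)
lift_definition minus_pre_resolvent_algebra ::
  "'a pre_resolvent_algebra \<Rightarrow> 'a pre_resolvent_algebra \<Rightarrow> 'a pre_resolvent_algebra" is "(\<^bold>-)"
  by (intro rt_cong_plus rt_cong_scale)
lift_definition uminus_pre_resolvent_algebra ::
  "'a pre_resolvent_algebra \<Rightarrow> 'a pre_resolvent_algebra" is "(\<^bold>\<cdot>) (- 1)"
  by (rule rt_cong_scale)
lift_definition times_pre_resolvent_algebra ::
  "'a pre_resolvent_algebra \<Rightarrow> 'a pre_resolvent_algebra \<Rightarrow> 'a pre_resolvent_algebra" is "(\<^bold>*)"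
  by (rule rt_cong_times)
lift_definition scaleC_pre_resolvent_algebra ::
  "complex \<Rightarrow> 'a pre_resolvent_algebra \<Rightarrow> 'a pre_resolvent_algebra" is "(\<^bold>\<cdot>)"
  by (rule rt_cong_scale)
lift_definition scaleR_pre_resolvent_algebra ::
  "real \<Rightarrow> 'a pre_resolvent_algebra \<Rightarrow> 'a pre_resolvent_algebra" is "\<lambda>r. (\<^bold>\<cdot>) (complex_of_real r)"
  by (rule rt_cong_scale)
lift_definition star_pre_resolvent_algebra ::
  "'a pre_resolvent_algebra \<Rightarrow> 'a pre_resolvent_algebra" is Star
  by (rule rt_cong_star)

instance
proof
  fix a b c :: "'a pre_resolvent_algebra" and r s :: real and z w :: complex
  show "(0 :: 'a pre_resolvent_algebra) \<noteq> 1"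
  proof (transfer, rule notI)
    assume "\<^bold>0 \<^bold>\<approx> (\<^bold>1 :: 'a rterm)"
    from eval_rterm_eq[OF resolvent_relations_character this] show False by simp
  qed
  show "a + b + c = a + (b + c)" by transfer (rule rt_plus_assoc)
  show "a + b = b + a" by transfer (rule rt_plus_commute)
  show "0 + a = a" by transfer (rule rt_plus_zero)
  show "- a + a = 0"
    by transfer (blast intro: rt_plus_inverse rt_plus_commute rt_trans)
  show "a - b = a + - b" by transfer (rule rt_refl)
  show "a * b * c = a * (b * c)" by transfer (rule rt_times_assoc)
  show "1 * a = a" by transfer (rule rt_times_one_left)
  show "a * 1 = a" by transfer (rule rt_times_one_right)
  show "(a + b) * c = a * c + b * c" by transfer (rule rt_distrib_right)
  show "a * (b + c) = a * b + a * c" by transfer (rule rt_distrib_left)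
  show "r *\<^sub>R (a + b) = r *\<^sub>R a + r *\<^sub>R b" by transfer (rule rt_scale_plus_right)
  show "(r + s) *\<^sub>R a = r *\<^sub>R a + s *\<^sub>R a"
    by transfer (simp add: rt_scale_plus_left)
  show "r *\<^sub>R s *\<^sub>R a = (r * s) *\<^sub>R a" by transfer (simp add: rt_scale_scale)
  show "1 *\<^sub>R a = a" by transfer (simp add: rt_scale_one)
  show "r *\<^sub>R a * b = r *\<^sub>R (a * b)" by transfer (rule rt_scale_times_left)
  show "a * r *\<^sub>R b = r *\<^sub>R (a * b)" by transfer (rule rt_scale_times_right)
  show "z *\<^sub>C (a + b) = z *\<^sub>C a + z *\<^sub>C b" by transfer (rule rt_scale_plus_right)
  show "(z + w) *\<^sub>C a = z *\<^sub>C a + w *\<^sub>C a" by transfer (rule rt_scale_plus_left)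
  show "z *\<^sub>C w *\<^sub>C a = (z * w) *\<^sub>C a" by transfer (rule rt_scale_scale)
  show "1 *\<^sub>C a = a" by transfer (rule rt_scale_one)
  show "r *\<^sub>R a = complex_of_real r *\<^sub>C a" by transfer (rule rt_refl)
  show "(z *\<^sub>C a) * b = z *\<^sub>C (a * b)" by transfer (rule rt_scale_times_left)
  show "a * (z *\<^sub>C b) = z *\<^sub>C (a * b)" by transfer (rule rt_scale_times_right)
  show "star (a + b) = star a + star b" by transfer (rule rt_star_plus)
  show "star (z *\<^sub>C a) = cnj z *\<^sub>C star a" by transfer (rule rt_star_scale)
  show "star (a * b) = star b * star a" by transfer (rule rt_star_times)
  show "star (star a) = a" by transfer (rule rt_star_star)
qed

end

lift_definition pre_res :: "real \<Rightarrow> 'x :: symplectic_space \<Rightarrow> 'x pre_resolvent_algebra" is Sym .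

lemma resolvent_relations_pre_res:
  "resolvent_relations (pre_res :: real \<Rightarrow> 'x :: symplectic_space \<Rightarrow> 'x pre_resolvent_algebra)"
  unfolding resolvent_relations_def power2_eq_square
proof (intro conjI allI impI, goal_cases)
  case (1 l m f)
  then show ?case by transfer (rule rt_rel1)
next
  case (2 l f)
  then show ?case by transfer (rule rt_rel2)
next
  case (3 l m f g)
  then show ?case by transfer (rule rt_rel3)
next
  case (4 n l f)
  then show ?case by transfer (rule rt_rel4)
next
  case (5 l m f g)
  then show ?case by transfer (rule rt_rel5)
next
  case (6 l)
  then show ?case by transfer (rule rt_rel6)
qed

lemma pre_res_zero: "pre_res 0 f = 0"
  by transfer (rule rt_no_symbol)

definition star_hom ::
  "('a :: complex_star_algebra_1 \<Rightarrow> 'b :: complex_star_algebra_1) \<Rightarrow> bool" where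
  "star_hom \<phi> \<longleftrightarrow> (\<forall>a b. \<phi> (a + b) = \<phi> a + \<phi> b) \<and> (\<forall>c a. \<phi> (c *\<^sub>C a) = c *\<^sub>C \<phi> a) \<and>
     (\<forall>a b. \<phi> (a * b) = \<phi> a * \<phi> b) \<and> \<phi> 1 = 1 \<and> (\<forall>a. \<phi> (star a) = star (\<phi> a))"

lemma pre_resolvent_algebra_induct [case_names res zero one add mult scaleC star]:
  fixes a :: "'x :: symplectic_space pre_resolvent_algebra"
  assumes "\<And>l f. P (pre_res l f)" "P 0" "P 1" "\<And>a b. P a \<Longrightarrow> P b \<Longrightarrow> P (a + b)"
    "\<And>a b. P a \<Longrightarrow> P b \<Longrightarrow> P (a * b)" "\<And>c a. P a \<Longrightarrow> P (c *\<^sub>C a)" "\<And>a. P a \<Longrightarrow> P (star a)"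
  shows "P a"
proof (induction a rule: pre_resolvent_algebra.abs_induct)
  case (1 t)
  show ?case
    by (induction t)
      (use assms in \<open>auto simp flip: pre_res.abs_eq zero_pre_resolvent_algebra.abs_eq
        one_pre_resolvent_algebra.abs_eq plus_pre_resolvent_algebra.abs_eq
        times_pre_resolvent_algebra.abs_eq scaleC_pre_resolvent_algebra.abs_eq
        star_pre_resolvent_algebra.abs_eq\<close>)
qed

lemma pre_resolvent_algebra_universal:
  fixes R :: "real \<Rightarrow> 'x :: symplectic_space \<Rightarrow> 'a :: complex_star_algebra_1"
  assumes R: "resolvent_relations R"
  shows "\<exists>!\<phi>. star_hom \<phi> \<and> (\<forall>l f. l \<noteq> 0 \<longrightarrow> \<phi> (pre_res l f) = R l f)"
proof (rule ex_ex1I)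
  define \<phi> where "\<phi> a = eval_rterm R (rep_pre_resolvent_algebra a)" for a
  have \<phi>: "\<phi> (abs_pre_resolvent_algebra t) = eval_rterm R t" for t
    unfolding \<phi>_def
    by (metis R Quotient3_pre_resolvent_algebra eval_rterm_eq rep_abs_rsp_left rt_refl)
  have "\<phi> (a + b) = \<phi> a + \<phi> b" for a b
    by (induction a rule: pre_resolvent_algebra.abs_induct,
        induction b rule: pre_resolvent_algebra.abs_induct)
      (simp add: \<phi> plus_pre_resolvent_algebra.abs_eq)
  moreover have "\<phi> (a * b) = \<phi> a * \<phi> b" for a b
    by (induction a rule: pre_resolvent_algebra.abs_induct,
        induction b rule: pre_resolvent_algebra.abs_induct)
      (simp add: \<phi> times_pre_resolvent_algebra.abs_eq)
  moreover have "\<phi> (c *\<^sub>C a) = c *\<^sub>C \<phi> a" for c a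
    by (induction a rule: pre_resolvent_algebra.abs_induct)
      (simp add: \<phi> scaleC_pre_resolvent_algebra.abs_eq)
  moreover have "\<phi> (star a) = star (\<phi> a)" for a
    by (induction a rule: pre_resolvent_algebra.abs_induct)
      (simp add: \<phi> star_pre_resolvent_algebra.abs_eq)
  moreover have "\<phi> 1 = 1"
    by (simp add: \<phi> one_pre_resolvent_algebra.abs_eq)
  moreover have "\<phi> (pre_res l f) = R l f" if "l \<noteq> 0" for l f
    using that by (simp add: \<phi> pre_res.abs_eq)
  ultimately show "\<exists>\<phi>. star_hom \<phi> \<and> (\<forall>l f. l \<noteq> 0 \<longrightarrow> \<phi> (pre_res l f) = R l f)"
    unfolding star_hom_def by blast
next
  fix \<phi> \<psi> :: "'x pre_resolvent_algebra \<Rightarrow> 'a"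
  assume A: "star_hom \<phi> \<and> (\<forall>l f. l \<noteq> 0 \<longrightarrow> \<phi> (pre_res l f) = R l f)"
    and B: "star_hom \<psi> \<and> (\<forall>l f. l \<noteq> 0 \<longrightarrow> \<psi> (pre_res l f) = R l f)"
  have zero: "\<phi> 0 = 0" "\<psi> 0 = 0"
    using A B unfolding star_hom_def by (metis complex_vector.scale_zero_left)+
  have "\<phi> a = \<psi> a" for a
  proof (induction a rule: pre_resolvent_algebra_induct)
    case (res l f)
    then show ?case using A B zero by (cases "l = 0") (auto simp: pre_res_zero)
  qed (use A B zero in \<open>auto simp: star_hom_def\<close>)
  then show "\<phi> = \<psi>" by auto
qed


section \<open>States and their GNS representations\<close>

definition states :: "('a :: complex_star_algebra_1 \<Rightarrow> complex) set" where
  "states = {\<omega>. (\<forall>a b. \<omega> (a + b) = \<omega> a + \<omega> b) \<and> (\<forall>c a. \<omega> (c *\<^sub>C a) = c * \<omega> a) \<and>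
     (\<forall>a. Im (\<omega> (star a * a)) = 0 \<and> 0 \<le> Re (\<omega> (star a * a))) \<and> \<omega> 1 = 1}"

text \<open>
  The Hilbert space of \<open>\<omega>\<close> is the completion of the algebra, modulo null vectors, with respect to
  \<open>\<langle>a, b\<rangle> = \<omega>(a\<^sup>* b)\<close>. It is constructed here in one step, as the set of Cauchy sequences
  modulo null sequences; \<open>gns_prenorm \<omega> a\<close> is the length of the vector given by \<open>a\<close>.
\<close>

definition gns_prenorm :: "('a :: complex_star_algebra_1 \<Rightarrow> complex) \<Rightarrow> 'a \<Rightarrow> real" where
  "gns_prenorm \<omega> a = sqrt (Re (\<omega> (star a * a)))"

definition gns_Cauchy :: "('a :: complex_star_algebra_1 \<Rightarrow> complex) \<Rightarrow> (nat \<Rightarrow> 'a) set" where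
  "gns_Cauchy \<omega> = {s. \<forall>e>0. \<exists>N. \<forall>m\<ge>N. \<forall>n\<ge>N. gns_prenorm \<omega> (s m - s n) < e}"

definition gns_equiv ::
  "('a :: complex_star_algebra_1 \<Rightarrow> complex) \<Rightarrow> ((nat \<Rightarrow> 'a) \<times> (nat \<Rightarrow> 'a)) set" where
  "gns_equiv \<omega> = {(s, t). s \<in> gns_Cauchy \<omega> \<and> t \<in> gns_Cauchy \<omega> \<and>
     (\<lambda>n. gns_prenorm \<omega> (s n - t n)) \<longlonglongrightarrow> 0}"

definition gns_space :: "('a :: complex_star_algebra_1 \<Rightarrow> complex) \<Rightarrow> (nat \<Rightarrow> 'a) set set" where
  "gns_space \<omega> = gns_Cauchy \<omega> // gns_equiv \<omega>"

definition gns_inner ::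
  "('a :: complex_star_algebra_1 \<Rightarrow> complex) \<Rightarrow> (nat \<Rightarrow> 'a) set \<Rightarrow> (nat \<Rightarrow> 'a) set \<Rightarrow> complex" where
  "gns_inner \<omega> \<xi> \<eta> = (THE z. \<forall>s\<in>\<xi>. \<forall>t\<in>\<eta>. (\<lambda>n. \<omega> (star (s n) * t n)) \<longlonglongrightarrow> z)"

definition gns_norm :: "('a :: complex_star_algebra_1 \<Rightarrow> complex) \<Rightarrow> (nat \<Rightarrow> 'a) set \<Rightarrow> real" where
  "gns_norm \<omega> \<xi> = sqrt (Re (gns_inner \<omega> \<xi> \<xi>))"

text \<open>
  The next two definitions are meaningful if left multiplication by \<open>a\<close> is bounded for
  \<open>gns_prenorm \<omega>\<close>; on \<open>\<R>\<^sub>0\<close> this is always the case, with bounds that do not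
  depend on the state (\<open>gns_uniformly_bounded\<close> below).
\<close>

definition gns_rep ::
  "('a :: complex_star_algebra_1 \<Rightarrow> complex) \<Rightarrow> 'a \<Rightarrow> (nat \<Rightarrow> 'a) set \<Rightarrow> (nat \<Rightarrow> 'a) set" where
  "gns_rep \<omega> a \<xi> = gns_equiv \<omega> `` ((\<lambda>s n. a * s n) ` \<xi>)"

definition gns_opnorm :: "('a :: complex_star_algebra_1 \<Rightarrow> complex) \<Rightarrow> 'a \<Rightarrow> real" where
  "gns_opnorm \<omega> a = (SUP \<xi>\<in>{\<xi> \<in> gns_space \<omega>. gns_norm \<omega> \<xi> \<le> 1}. gns_norm \<omega> (gns_rep \<omega> a \<xi>))"

context
  fixes \<omega> :: "'a :: complex_star_algebra_1 \<Rightarrow> complex"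
  assumes \<omega>: "\<omega> \<in> states"
begin

lemma state_add: "\<omega> (a + b) = \<omega> a + \<omega> b"
  and state_scaleC: "\<omega> (c *\<^sub>C a) = c * \<omega> a"
  and state_one: "\<omega> 1 = 1"
  and state_Im: "Im (\<omega> (star a * a)) = 0"
  and state_Re: "0 \<le> Re (\<omega> (star a * a))"
  using \<omega> by (auto simp: states_def)

lemma state_minus: "\<omega> (- a) = - \<omega> a"
  using state_scaleC[of "- 1" a] by (simp add: scaleC_one)

lemma state_diff: "\<omega> (a - b) = \<omega> a - \<omega> b"
  using state_add[of a "- b"] by (simp add: state_minus)

lemma state_hermitian: "\<omega> (star a * b) = cnj (\<omega> (star b * a))"
proof (rule complex_eqI)
  have "Im (\<omega> (star (a + b) * (a + b))) = 0" by (rule state_Im)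
  then have "Im (\<omega> (star a * b)) + Im (\<omega> (star b * a)) = 0"
    by (simp add: star_add algebra_simps state_add state_Im)
  then show "Im (\<omega> (star a * b)) = Im (cnj (\<omega> (star b * a)))" by simp
  have "Im (\<omega> (star (a + \<i> *\<^sub>C b) * (a + \<i> *\<^sub>C b))) = 0" by (rule state_Im)
  then have "Re (\<omega> (star a * b)) - Re (\<omega> (star b * a)) = 0"
    by (simp add: star_add star_scaleC algebra_simps state_add state_scaleC state_Im
        mult_scaleC_left mult_scaleC_right scaleC_scaleC scaleC_one state_minus state_diff)
  then show "Re (\<omega> (star a * b)) = Re (cnj (\<omega> (star b * a)))" by simp
qed

lemma prenorm_nonneg [simp]: "0 \<le> gns_prenorm \<omega> a"
  by (simp add: gns_prenorm_def state_Re)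

lemma prenorm_power2: "(gns_prenorm \<omega> a)\<^sup>2 = Re (\<omega> (star a * a))"
  by (simp add: gns_prenorm_def state_Re)

lemma prenorm_power2': "complex_of_real ((gns_prenorm \<omega> a)\<^sup>2) = \<omega> (star a * a)"
  by (simp add: prenorm_power2 complex_eq_iff state_Im)

lemma state_CS: "cmod (\<omega> (star a * b)) \<le> gns_prenorm \<omega> a * gns_prenorm \<omega> b"
proof -
  define z where "z = \<omega> (star a * b)"
  have key: "0 \<le> t\<^sup>2 * (cmod z)\<^sup>2 * (gns_prenorm \<omega> a)\<^sup>2 - 2 * t * (cmod z)\<^sup>2 + (gns_prenorm \<omega> b)\<^sup>2" for t :: real
  proof -
    let ?c = "complex_of_real t * z"
    have ba: "\<omega> (star b * a) = cnj z" unfolding z_def by (rule state_hermitian)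
    have "\<omega> (star (?c *\<^sub>C a - b) * (?c *\<^sub>C a - b)) =
        cnj ?c * ?c * \<omega> (star a * a) - cnj ?c * z - ?c * cnj z + \<omega> (star b * b)"
      by (simp add: star_diff star_scaleC algebra_simps state_add state_diff state_scaleC
          mult_scaleC_left mult_scaleC_right scaleC_scaleC ba z_def[symmetric])
    also have "\<dots> = of_real (t\<^sup>2 * (cmod z)\<^sup>2 * (gns_prenorm \<omega> a)\<^sup>2 - 2 * t * (cmod z)\<^sup>2 + (gns_prenorm \<omega> b)\<^sup>2)"
    proof -
      have "cnj z * z = of_real ((cmod z)\<^sup>2)"
        by (metis complex_norm_square mult.commute of_real_power)
      then show ?thesis
        unfolding prenorm_power2'[symmetric]
        by (simp add: algebra_simps power2_eq_square) (simp flip: mult.assoc)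
    qed
    finally show ?thesis
      using state_Re[of "?c *\<^sub>C a - b"] by simp
  qed
  show ?thesis
  proof (cases "gns_prenorm \<omega> a = 0")
    case True
    have "cmod z = 0"
    proof (rule ccontr)
      assume "cmod z \<noteq> 0"
      then show False
        using key[of "((gns_prenorm \<omega> b)\<^sup>2 + 1) / (2 * (cmod z)\<^sup>2)"] True by (simp add: field_simps)
    qed
    then show ?thesis using True by (simp add: z_def)
  next
    case False
    then have pa: "(gns_prenorm \<omega> a)\<^sup>2 > 0" by simp
    have "0 \<le> (1 / (gns_prenorm \<omega> a)\<^sup>2)\<^sup>2 * (cmod z)\<^sup>2 * (gns_prenorm \<omega> a)\<^sup>2 - 2 * (1 / (gns_prenorm \<omega> a)\<^sup>2) * (cmod z)\<^sup>2 + (gns_prenorm \<omega> b)\<^sup>2"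
      by (rule key)
    also have "\<dots> = (gns_prenorm \<omega> b)\<^sup>2 - (cmod z)\<^sup>2 / (gns_prenorm \<omega> a)\<^sup>2"
      using False by (simp add: field_simps power2_eq_square)
    finally have "(cmod z)\<^sup>2 \<le> (gns_prenorm \<omega> a)\<^sup>2 * (gns_prenorm \<omega> b)\<^sup>2"
      using pa by (simp add: field_simps)
    then have "(cmod z)\<^sup>2 \<le> (gns_prenorm \<omega> a * gns_prenorm \<omega> b)\<^sup>2" by (simp add: power_mult_distrib)
    then show ?thesis
      unfolding z_def by (rule power2_le_imp_le) simp
  qed
qed

lemma prenorm_triangle: "gns_prenorm \<omega> (a + b) \<le> gns_prenorm \<omega> a + gns_prenorm \<omega> b"
proof (rule power2_le_imp_le)
  have "Re (\<omega> (star a * b)) \<le> gns_prenorm \<omega> a * gns_prenorm \<omega> b" "Re (\<omega> (star b * a)) \<le> gns_prenorm \<omega> a * gns_prenorm \<omega> b"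
    using complex_Re_le_cmod state_CS[of a b] state_CS[of b a]
    by (smt (verit) mult.commute)+
  then show "(gns_prenorm \<omega> (a + b))\<^sup>2 \<le> (gns_prenorm \<omega> a + gns_prenorm \<omega> b)\<^sup>2"
    by (simp add: prenorm_power2 star_add algebra_simps state_add power2_sum)
qed simp

lemma prenorm_scaleC: "gns_prenorm \<omega> (c *\<^sub>C a) = cmod c * gns_prenorm \<omega> a"
proof -
  have "star (c *\<^sub>C a) * (c *\<^sub>C a) = complex_of_real ((cmod c)\<^sup>2) *\<^sub>C (star a * a)"
    by (simp add: star_scaleC mult_scaleC_left mult_scaleC_right scaleC_scaleC
        complex_norm_square mult.commute del: of_real_power)
  then show ?thesis
    by (simp add: gns_prenorm_def state_scaleC real_sqrt_mult del: of_real_power)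
qed

lemma prenorm_minus: "gns_prenorm \<omega> (- a) = gns_prenorm \<omega> a"
  using prenorm_scaleC[of "- 1" a] by (simp add: scaleC_one)

lemma prenorm_diff_commute: "gns_prenorm \<omega> (a - b) = gns_prenorm \<omega> (b - a)"
  using prenorm_minus[of "a - b"] by simp

lemma prenorm_zero [simp]: "gns_prenorm \<omega> 0 = 0"
  using prenorm_scaleC[of 0 0] by simp

lemma prenorm_triangle_diff: "\<bar>gns_prenorm \<omega> a - gns_prenorm \<omega> b\<bar> \<le> gns_prenorm \<omega> (a - b)"
  using prenorm_triangle[of "a - b" b] prenorm_triangle[of "b - a" a] prenorm_diff_commute[of a b]
  by simp

lemma prenorm_one: "gns_prenorm \<omega> 1 = 1"
  by (simp add: gns_prenorm_def state_one)

lemma equiv_gns: "equiv (gns_Cauchy \<omega>) (gns_equiv \<omega>)"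
proof (rule equivI)
  show "gns_equiv \<omega> \<subseteq> gns_Cauchy \<omega> \<times> gns_Cauchy \<omega>" by (auto simp: gns_equiv_def)
  show "refl_on (gns_Cauchy \<omega>) (gns_equiv \<omega>)" by (auto simp: gns_equiv_def refl_on_def)
  show "sym (gns_equiv \<omega>)"
  proof (rule symI)
    fix s t assume "(s, t) \<in> gns_equiv \<omega>"
    moreover have "(\<lambda>n. gns_prenorm \<omega> (t n - s n)) = (\<lambda>n. gns_prenorm \<omega> (s n - t n))"
      by (intro ext prenorm_diff_commute)
    ultimately show "(t, s) \<in> gns_equiv \<omega>" by (simp add: gns_equiv_def)
  qed
  show "trans (gns_equiv \<omega>)"
  proof (rule transI)
    fix s t u assume st: "(s, t) \<in> gns_equiv \<omega>" and tu: "(t, u) \<in> gns_equiv \<omega>"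
    have "(\<lambda>n. gns_prenorm \<omega> (s n - t n) + gns_prenorm \<omega> (t n - u n)) \<longlonglongrightarrow> 0 + 0"
      using st tu unfolding gns_equiv_def by (intro tendsto_add) auto
    then have lim: "(\<lambda>n. gns_prenorm \<omega> (s n - t n) + gns_prenorm \<omega> (t n - u n)) \<longlonglongrightarrow> 0"
      by simp
    have "gns_prenorm \<omega> (s n - u n) \<le> gns_prenorm \<omega> (s n - t n) + gns_prenorm \<omega> (t n - u n)" for n
      using prenorm_triangle[of "s n - t n" "t n - u n"] by simp
    then have "(\<lambda>n. gns_prenorm \<omega> (s n - u n)) \<longlonglongrightarrow> 0"
      by (intro Lim_null_comparison[OF _ lim] always_eventually allI) simp
    then show "(s, u) \<in> gns_equiv \<omega>" using st tu by (auto simp: gns_equiv_def)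
  qed
qed

lemma gns_Cauchy_prenorm:
  assumes "s \<in> gns_Cauchy \<omega>"
  shows "convergent (\<lambda>n. gns_prenorm \<omega> (s n))"
proof (rule Cauchy_convergent, rule metric_CauchyI)
  fix e :: real assume "e > 0"
  then obtain N where N: "\<And>m n. m \<ge> N \<Longrightarrow> n \<ge> N \<Longrightarrow> gns_prenorm \<omega> (s m - s n) < e"
    using assms unfolding gns_Cauchy_def by blast
  show "\<exists>M. \<forall>m\<ge>M. \<forall>n\<ge>M. dist (gns_prenorm \<omega> (s m)) (gns_prenorm \<omega> (s n)) < e"
    using N prenorm_triangle_diff by (intro exI[of _ N]) (smt (verit) dist_real_def)
qed

lemma gns_norm_eq:
  assumes "\<xi> \<in> gns_space \<omega>" "s \<in> \<xi>"
  shows "(\<lambda>n. gns_prenorm \<omega> (s n)) \<longlonglongrightarrow> gns_norm \<omega> \<xi>"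
proof -
  have sC: "t \<in> gns_Cauchy \<omega> \<and> (s, t) \<in> gns_equiv \<omega>" if "t \<in> \<xi>" for t
  proof -
    have "(s, t) \<in> gns_equiv \<omega>"
      using equiv_gns assms that unfolding gns_space_def
      by (meson quotient_eq_iff)
    then show ?thesis by (auto simp: gns_equiv_def)
  qed
  obtain L where L: "(\<lambda>n. gns_prenorm \<omega> (s n)) \<longlonglongrightarrow> L"
    using gns_Cauchy_prenorm[of s] sC[OF assms(2)] by (auto simp: convergent_def)
  have Lt: "(\<lambda>n. gns_prenorm \<omega> (t n)) \<longlonglongrightarrow> L" if "t \<in> \<xi>" for t
  proof -
    have "(\<lambda>n. gns_prenorm \<omega> (s n - t n)) \<longlonglongrightarrow> 0" using sC[OF that] by (auto simp: gns_equiv_def)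
    then have "(\<lambda>n. gns_prenorm \<omega> (s n) - gns_prenorm \<omega> (t n)) \<longlonglongrightarrow> 0"
      by (rule Lim_null_comparison[rotated]) (simp add: prenorm_triangle_diff)
    from tendsto_diff[OF L this] show ?thesis by simp
  qed
  have inner: "(\<lambda>n. \<omega> (star (t n) * u n)) \<longlonglongrightarrow> complex_of_real (L\<^sup>2)" if t: "t \<in> \<xi>" and u: "u \<in> \<xi>" for t u
  proof -
    have "(u, t) \<in> gns_equiv \<omega>"
      using equiv_gns assms t u unfolding gns_space_def by (meson quotient_eq_iff)
    then have tu: "(\<lambda>n. gns_prenorm \<omega> (u n - t n)) \<longlonglongrightarrow> 0"
      by (simp add: gns_equiv_def)
    have "(\<lambda>n. gns_prenorm \<omega> (t n) * gns_prenorm \<omega> (u n - t n)) \<longlonglongrightarrow> L * 0"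
      by (intro tendsto_mult Lt t tu)
    then have lim: "(\<lambda>n. gns_prenorm \<omega> (t n) * gns_prenorm \<omega> (u n - t n)) \<longlonglongrightarrow> 0"
      by simp
    have "(\<lambda>n. \<omega> (star (t n) * (u n - t n))) \<longlonglongrightarrow> 0"
      by (rule Lim_null_comparison[OF _ lim]) (simp add: state_CS)
    moreover have "(\<lambda>n. complex_of_real ((gns_prenorm \<omega> (t n))\<^sup>2)) \<longlonglongrightarrow> complex_of_real (L\<^sup>2)"
      by (intro tendsto_intros Lt t)
    ultimately have "(\<lambda>n. \<omega> (star (t n) * (u n - t n)) + complex_of_real ((gns_prenorm \<omega> (t n))\<^sup>2)) \<longlonglongrightarrow> 0 + complex_of_real (L\<^sup>2)"
      by (rule tendsto_add)
    then show ?thesis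
      unfolding prenorm_power2' by (simp add: right_diff_distrib state_diff)
  qed
  have "gns_inner \<omega> \<xi> \<xi> = complex_of_real (L\<^sup>2)"
    unfolding gns_inner_def
  proof (rule the_equality)
    show "\<forall>s\<in>\<xi>. \<forall>t\<in>\<xi>. (\<lambda>n. \<omega> (star (s n) * t n)) \<longlonglongrightarrow> complex_of_real (L\<^sup>2)"
      using inner by blast
    fix z assume "\<forall>s\<in>\<xi>. \<forall>t\<in>\<xi>. (\<lambda>n. \<omega> (star (s n) * t n)) \<longlonglongrightarrow> z"
    then show "z = complex_of_real (L\<^sup>2)"
      using inner assms(2) LIMSEQ_unique by blast
  qed
  moreover have "L \<ge> 0" by (rule LIMSEQ_le_const[OF L]) auto
  ultimately have "gns_norm \<omega> \<xi> = L" by (simp add: gns_norm_def del: of_real_power)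
  then show ?thesis using L by simp
qed

lemma gns_rep_mem:
  assumes \<xi>: "\<xi> \<in> gns_space \<omega>" and s: "s \<in> \<xi>" and C: "\<And>b. gns_prenorm \<omega> (a * b) \<le> C * gns_prenorm \<omega> b"
  shows "gns_rep \<omega> a \<xi> \<in> gns_space \<omega>" "(\<lambda>n. a * s n) \<in> gns_rep \<omega> a \<xi>"
proof -
  have C': "gns_prenorm \<omega> (a * b) \<le> (\<bar>C\<bar> + 1) * gns_prenorm \<omega> b" for b
    by (rule order_trans[OF C mult_right_mono]) auto
  have Cauchy: "(\<lambda>n. a * t n) \<in> gns_Cauchy \<omega>" if t: "t \<in> gns_Cauchy \<omega>" for t
    unfolding gns_Cauchy_def
  proof safe
    fix e :: real assume "e > 0"
    then have "e / (\<bar>C\<bar> + 1) > 0" by (intro divide_pos_pos) auto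
    then obtain N where N: "\<And>m n. m \<ge> N \<Longrightarrow> n \<ge> N \<Longrightarrow> gns_prenorm \<omega> (t m - t n) < e / (\<bar>C\<bar> + 1)"
      using t unfolding gns_Cauchy_def by blast
    have "gns_prenorm \<omega> (a * t m - a * t n) < e" if "m \<ge> N" "n \<ge> N" for m n
    proof -
      have "gns_prenorm \<omega> (a * t m - a * t n) \<le> (\<bar>C\<bar> + 1) * gns_prenorm \<omega> (t m - t n)"
        using C'[of "t m - t n"] by (simp add: right_diff_distrib)
      also have "\<dots> < e" using N[OF that] by (simp add: pos_less_divide_eq mult.commute)
      finally show ?thesis .
    qed
    then show "\<exists>N. \<forall>m\<ge>N. \<forall>n\<ge>N. gns_prenorm \<omega> (a * t m - a * t n) < e" by blast
  qed
  have rel: "((\<lambda>n. a * s n), (\<lambda>n. a * t n)) \<in> gns_equiv \<omega>" if t: "t \<in> \<xi>" for t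
  proof -
    have st: "(s, t) \<in> gns_equiv \<omega>"
      using equiv_gns \<xi> s t unfolding gns_space_def by (meson quotient_eq_iff)
    have "(\<lambda>n. (\<bar>C\<bar> + 1) * gns_prenorm \<omega> (s n - t n)) \<longlonglongrightarrow> (\<bar>C\<bar> + 1) * 0"
      using st unfolding gns_equiv_def by (intro tendsto_mult tendsto_const) auto
    then have lim: "(\<lambda>n. (\<bar>C\<bar> + 1) * gns_prenorm \<omega> (s n - t n)) \<longlonglongrightarrow> 0"
      by simp
    have "gns_prenorm \<omega> (a * s n - a * t n) \<le> (\<bar>C\<bar> + 1) * gns_prenorm \<omega> (s n - t n)" for n
      using C'[of "s n - t n"] by (simp add: right_diff_distrib)
    then have "(\<lambda>n. gns_prenorm \<omega> (a * s n - a * t n)) \<longlonglongrightarrow> 0"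
      by (intro Lim_null_comparison[OF _ lim] always_eventually allI) simp
    then show ?thesis using st Cauchy by (auto simp: gns_equiv_def)
  qed
  have "gns_rep \<omega> a \<xi> = gns_equiv \<omega> `` {\<lambda>n. a * s n}"
  proof (intro equalityI subsetI)
    fix t assume "t \<in> gns_rep \<omega> a \<xi>"
    then obtain u where "u \<in> \<xi>" "((\<lambda>n. a * u n), t) \<in> gns_equiv \<omega>"
      by (auto simp: gns_rep_def)
    then show "t \<in> gns_equiv \<omega> `` {\<lambda>n. a * s n}"
      using rel equiv_gns by (meson Image_singleton_iff equivE transE)
  qed (use s in \<open>auto simp: gns_rep_def\<close>)
  moreover have "s \<in> gns_Cauchy \<omega>"
    using \<xi> s equiv_gns unfolding gns_space_def by (meson in_quotient_imp_subset subsetD)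
  ultimately show "gns_rep \<omega> a \<xi> \<in> gns_space \<omega>" "(\<lambda>n. a * s n) \<in> gns_rep \<omega> a \<xi>"
    using Cauchy rel[OF s] by (auto simp: gns_space_def quotientI)
qed

lemma gns_rep_norm:
  assumes \<xi>: "\<xi> \<in> gns_space \<omega>" and C: "\<And>b. gns_prenorm \<omega> (a * b) \<le> C * gns_prenorm \<omega> b"
  shows "gns_norm \<omega> (gns_rep \<omega> a \<xi>) \<le> C * gns_norm \<omega> \<xi>"
proof -
  have "\<xi> \<noteq> {}"
    using in_quotient_imp_non_empty[OF equiv_gns] \<xi> unfolding gns_space_def by blast
  then obtain s where s: "s \<in> \<xi>" by blast
  show ?thesis
  proof (rule LIMSEQ_le)
    show "(\<lambda>n. gns_prenorm \<omega> (a * s n)) \<longlonglongrightarrow> gns_norm \<omega> (gns_rep \<omega> a \<xi>)"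
      by (rule gns_norm_eq) (rule gns_rep_mem[OF \<xi> s C])+
    show "(\<lambda>n. C * gns_prenorm \<omega> (s n)) \<longlonglongrightarrow> C * gns_norm \<omega> \<xi>"
      by (intro tendsto_mult tendsto_const gns_norm_eq \<xi> s)
  qed (use C in auto)
qed

lemma gns_const:
  obtains \<xi> where "\<xi> \<in> gns_space \<omega>" "(\<lambda>_. b) \<in> \<xi>" "gns_norm \<omega> \<xi> = gns_prenorm \<omega> b"
proof
  have b: "(\<lambda>_. b) \<in> gns_Cauchy \<omega>" by (auto simp: gns_Cauchy_def)
  let ?\<xi> = "gns_equiv \<omega> `` {\<lambda>_. b}"
  show 1: "?\<xi> \<in> gns_space \<omega>" using b by (auto simp: gns_space_def quotientI)
  show 2: "(\<lambda>_. b) \<in> ?\<xi>" using b equiv_gns by (meson equiv_class_self)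
  show "gns_norm \<omega> ?\<xi> = gns_prenorm \<omega> b"
    using gns_norm_eq[OF 1 2] LIMSEQ_unique tendsto_const by blast
qed

lemma gns_opnorm_bounds:
  assumes C: "\<And>b. gns_prenorm \<omega> (a * b) \<le> C * gns_prenorm \<omega> b"
  shows "gns_opnorm \<omega> a \<le> C" and "0 \<le> gns_opnorm \<omega> a" and "gns_prenorm \<omega> (a * b) \<le> gns_opnorm \<omega> a * gns_prenorm \<omega> b"
proof -
  let ?S = "{\<xi> \<in> gns_space \<omega>. gns_norm \<omega> \<xi> \<le> 1}"
  let ?f = "\<lambda>\<xi>. gns_norm \<omega> (gns_rep \<omega> a \<xi>)"
  have C0: "C \<ge> 0" using C[of 1] by (simp add: prenorm_one order_trans[OF prenorm_nonneg])
  have le: "?f \<xi> \<le> C" if "\<xi> \<in> ?S" for \<xi>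
    using gns_rep_norm[of \<xi> a C] C that C0 mult_left_mono[of "gns_norm \<omega> \<xi>" 1 C] by fastforce
  have const: "gns_prenorm \<omega> (a * b) \<le> gns_opnorm \<omega> a" if "gns_prenorm \<omega> b \<le> 1" for b
  proof -
    obtain \<xi> where \<xi>: "\<xi> \<in> gns_space \<omega>" "(\<lambda>_. b) \<in> \<xi>" "gns_norm \<omega> \<xi> = gns_prenorm \<omega> b"
      by (rule gns_const)
    have "(\<lambda>n::nat. gns_prenorm \<omega> (a * b)) \<longlonglongrightarrow> ?f \<xi>"
      by (rule gns_norm_eq) (rule gns_rep_mem[OF \<xi>(1,2) C])+
    then have "?f \<xi> = gns_prenorm \<omega> (a * b)" using LIMSEQ_unique tendsto_const by blast
    moreover have "?f \<xi> \<le> gns_opnorm \<omega> a"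
      unfolding gns_opnorm_def
      by (rule cSUP_upper) (use \<xi> that le in \<open>auto simp: bdd_above_def\<close>)
    ultimately show ?thesis by simp
  qed
  show ge0: "0 \<le> gns_opnorm \<omega> a" using const[of 0] by simp
  obtain \<xi>0 where "\<xi>0 \<in> gns_space \<omega>" "gns_norm \<omega> \<xi>0 = gns_prenorm \<omega> 0"
    by (rule gns_const)
  then have "\<xi>0 \<in> ?S" by simp
  then show "gns_opnorm \<omega> a \<le> C"
    unfolding gns_opnorm_def by (intro cSUP_least) (use le in auto)
  show "gns_prenorm \<omega> (a * b) \<le> gns_opnorm \<omega> a * gns_prenorm \<omega> b"
  proof (cases "gns_prenorm \<omega> b = 0")
    case True
    then show ?thesis using C[of b] by simp
  next
    case False
    then have pb: "gns_prenorm \<omega> b > 0" using prenorm_nonneg[of b] by linarith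
    let ?c = "complex_of_real (1 / gns_prenorm \<omega> b)"
    have "gns_prenorm \<omega> (a * (?c *\<^sub>C b)) \<le> gns_opnorm \<omega> a"
      using pb by (intro const) (simp add: prenorm_scaleC norm_divide)
    moreover have "gns_prenorm \<omega> (a * (?c *\<^sub>C b)) = gns_prenorm \<omega> (a * b) / gns_prenorm \<omega> b"
      using pb by (simp add: mult_scaleC_right prenorm_scaleC norm_divide)
    ultimately show ?thesis using pb by (simp add: divide_le_eq)
  qed
qed

end


section \<open>The C*-seminorm on \<open>\<R>\<^sub>0\<close>\<close>

definition resolvent_seminorm :: "'x :: symplectic_space pre_resolvent_algebra \<Rightarrow> real" where
  "resolvent_seminorm a = (SUP \<omega>\<in>states. gns_opnorm \<omega> a)"

lemma states_nonempty: "(states :: ('x :: symplectic_space pre_resolvent_algebra \<Rightarrow> complex) set) \<noteq> {}"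
proof -
  obtain \<phi> :: "'x pre_resolvent_algebra \<Rightarrow> complex" where "star_hom \<phi>"
    using pre_resolvent_algebra_universal[OF resolvent_relations_character] by blast
  then have "\<phi> \<in> states"
    by (simp add: star_hom_def states_def scaleC_complex_def star_complex_def)
  then show ?thesis by blast
qed

lemma gns_prenorm_pre_res:
  assumes "\<omega> \<in> states" "l \<noteq> 0"
  shows "gns_prenorm \<omega> (pre_res l f * b) \<le> gns_prenorm \<omega> b / \<bar>l\<bar>"
proof -
  note R = resolvent_relations_pre_res[unfolded resolvent_relations_def]
  note st = state_scaleC[OF assms(1)] state_diff[OF assms(1)] state_CS[OF assms(1)]
  let ?R = "pre_res l f" and ?S = "pre_res (- l) f"
  let ?q = "gns_prenorm \<omega> (?R * b)" and ?p = "gns_prenorm \<omega> b"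
  have S: "star ?R = ?S" using R assms by blast
  have "?S - ?R = (\<i> * complex_of_real (l - - l)) *\<^sub>C (?S * ?R)"
    using R assms by (metis neg_equal_0_iff_equal)
  then have eq: "star b * (?S - ?R) * b = (\<i> * complex_of_real (2 * l)) *\<^sub>C (star (?R * b) * (?R * b))"
    by (simp add: star_mult S mult_scaleC_left mult_scaleC_right mult.assoc)
  have "\<omega> (star b * (?S - ?R) * b) = \<omega> (star (?R * b) * b) - \<omega> (star b * (?R * b))"
    by (simp add: star_mult S mult.assoc left_diff_distrib right_diff_distrib st)
  then have "cmod (\<omega> (star b * (?S - ?R) * b)) \<le> ?q * ?p + ?p * ?q"
    using norm_triangle_ineq4 st(3)[of "?R * b" b] st(3)[of b "?R * b"] by (smt (verit))
  moreover have "cmod (\<omega> (star b * (?S - ?R) * b)) = 2 * \<bar>l\<bar> * ?q\<^sup>2"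
    unfolding eq st prenorm_power2'[OF assms(1), symmetric] by (simp add: norm_mult norm_power del: of_real_power) 
  ultimately have *: "?q * (\<bar>l\<bar> * ?q) \<le> ?q * ?p" by (simp add: power2_eq_square algebra_simps)
  have "0 \<le> ?q" "0 \<le> ?p" using assms(1) by simp_all
  show ?thesis
  proof (cases "?q = 0")
    case True
    then show ?thesis using \<open>0 \<le> ?p\<close> by simp
  next
    case False
    then have "\<bar>l\<bar> * ?q \<le> ?p" using * \<open>0 \<le> ?q\<close> by simp
    then show ?thesis using assms(2) by (simp add: pos_le_divide_eq mult.commute)
  qed
qed

lemma gns_uniformly_bounded:
  fixes a :: "'x :: symplectic_space pre_resolvent_algebra"
  shows "\<exists>C\<ge>0. \<forall>\<omega>\<in>states. \<forall>b. gns_prenorm \<omega> (a * b) \<le> C * gns_prenorm \<omega> b"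
proof (induction a rule: pre_resolvent_algebra_induct)
  case (res l f)
  show ?case
  proof (cases "l = 0")
    case True
    then show ?thesis by (intro exI[of _ 0]) (simp add: pre_res_zero)
  next
    case False
    then show ?thesis
      by (intro exI[of _ "1 / \<bar>l\<bar>"]) (simp add: gns_prenorm_pre_res)
  qed
next
  case zero
  then show ?case by (intro exI[of _ 0]) simp
next
  case one
  then show ?case by (intro exI[of _ 1]) simp
next
  case (add a a')
  then obtain C D where CD: "C \<ge> 0" "D \<ge> 0"
    "\<And>\<omega> b. \<omega> \<in> states \<Longrightarrow> gns_prenorm \<omega> (a * b) \<le> C * gns_prenorm \<omega> b"
    "\<And>\<omega> b. \<omega> \<in> states \<Longrightarrow> gns_prenorm \<omega> (a' * b) \<le> D * gns_prenorm \<omega> b" by metis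
  have "gns_prenorm \<omega> ((a + a') * b) \<le> (C + D) * gns_prenorm \<omega> b" if "\<omega> \<in> states" for \<omega> b
    unfolding distrib_right
    using prenorm_triangle[OF that, of "a * b" "a' * b"] CD(3)[OF that, of b] CD(4)[OF that, of b]
    by linarith
  then show ?case using CD(1,2) by (intro exI[of _ "C + D"]) simp
next
  case (mult a a')
  then obtain C D where CD: "C \<ge> 0" "D \<ge> 0"
    "\<And>\<omega> b. \<omega> \<in> states \<Longrightarrow> gns_prenorm \<omega> (a * b) \<le> C * gns_prenorm \<omega> b"
    "\<And>\<omega> b. \<omega> \<in> states \<Longrightarrow> gns_prenorm \<omega> (a' * b) \<le> D * gns_prenorm \<omega> b" by metis
  have "gns_prenorm \<omega> ((a * a') * b) \<le> (C * D) * gns_prenorm \<omega> b" if "\<omega> \<in> states" for \<omega> b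
    unfolding mult.assoc
    by (rule order_trans[OF CD(3)[OF that] mult_left_mono[OF CD(4)[OF that] CD(1)]])
  then show ?case using CD(1,2) by (intro exI[of _ "C * D"]) simp
next
  case (scaleC c a)
  then obtain C where C: "C \<ge> 0"
    "\<And>\<omega> b. \<omega> \<in> states \<Longrightarrow> gns_prenorm \<omega> (a * b) \<le> C * gns_prenorm \<omega> b" by metis
  have "gns_prenorm \<omega> ((c *\<^sub>C a) * b) \<le> (cmod c * C) * gns_prenorm \<omega> b" if "\<omega> \<in> states" for \<omega> b
    unfolding mult_scaleC_left prenorm_scaleC[OF that] mult.assoc[of "cmod c"]
    by (rule mult_left_mono[OF C(2)[OF that]]) simp
  then show ?case using C(1) by (intro exI[of _ "cmod c * C"]) simp
next
  case (star a)
  then obtain C where C: "C \<ge> 0"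
    "\<And>\<omega> b. \<omega> \<in> states \<Longrightarrow> gns_prenorm \<omega> (a * b) \<le> C * gns_prenorm \<omega> b" by metis
  have "gns_prenorm \<omega> (star a * b) \<le> C * gns_prenorm \<omega> b" if \<omega>: "\<omega> \<in> states" for \<omega> b
  proof -
    let ?q = "gns_prenorm \<omega> (star a * b)" and ?p = "gns_prenorm \<omega> b"
    have "?q\<^sup>2 = Re (\<omega> (star b * (a * (star a * b))))"
      by (simp add: prenorm_power2[OF \<omega>] star_mult mult.assoc)
    also have "\<dots> \<le> ?p * gns_prenorm \<omega> (a * (star a * b))"
      using complex_Re_le_cmod state_CS[OF \<omega>] order_trans by blast
    also have "\<dots> \<le> ?p * (C * ?q)"
      by (rule mult_left_mono[OF C(2)[OF \<omega>]]) (simp add: \<omega>)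
    finally have *: "?q * ?q \<le> ?q * (C * ?p)" by (simp add: power2_eq_square mult_ac)
    have "0 \<le> ?q" "0 \<le> ?p" using \<omega> by simp_all
    then show ?thesis using * C(1) by (cases "?q = 0") simp_all
  qed
  then show ?case using C(1) by (intro exI[of _ C]) simp
qed

lemma resolvent_seminorm_bounds:
  fixes a :: "'x :: symplectic_space pre_resolvent_algebra"
  shows "0 \<le> resolvent_seminorm a"
    and "\<omega> \<in> states \<Longrightarrow> gns_prenorm \<omega> (a * b) \<le> resolvent_seminorm a * gns_prenorm \<omega> b"
    and "(\<And>\<omega> b. \<omega> \<in> states \<Longrightarrow> gns_prenorm \<omega> (a * b) \<le> D * gns_prenorm \<omega> b) \<Longrightarrow> resolvent_seminorm a \<le> D"
proof -
  obtain C where C: "\<And>\<omega> b. \<omega> \<in> states \<Longrightarrow> gns_prenorm \<omega> (a * b) \<le> C * gns_prenorm \<omega> b"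
    using gns_uniformly_bounded[of a] by metis
  have le: "gns_opnorm \<omega> a \<le> resolvent_seminorm a" if "\<omega> \<in> states" for \<omega>
    unfolding resolvent_seminorm_def
    by (rule cSUP_upper[OF that]) (use gns_opnorm_bounds(1)[OF _ C] in \<open>auto intro!: bdd_aboveI2\<close>)
  obtain \<omega>0 where \<omega>0: "\<omega>0 \<in> (states :: ('x pre_resolvent_algebra \<Rightarrow> complex) set)"
    using states_nonempty by blast
  show "0 \<le> resolvent_seminorm a"
    using le[OF \<omega>0] gns_opnorm_bounds(2)[OF \<omega>0 C[OF \<omega>0]] by linarith
  show "gns_prenorm \<omega> (a * b) \<le> resolvent_seminorm a * gns_prenorm \<omega> b" if \<omega>: "\<omega> \<in> states"
    using gns_opnorm_bounds(3)[OF \<omega> C[OF \<omega>], of b] mult_right_mono[OF le[OF \<omega>] prenorm_nonneg[OF \<omega>, of b]]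
    by linarith
  show "resolvent_seminorm a \<le> D"
    if D: "\<And>\<omega> b. \<omega> \<in> states \<Longrightarrow> gns_prenorm \<omega> (a * b) \<le> D * gns_prenorm \<omega> b"
    unfolding resolvent_seminorm_def
    by (rule cSUP_least[OF states_nonempty]) (rule gns_opnorm_bounds(1)[OF _ D])
qed

lemma resolvent_seminorm_zero [simp]: "resolvent_seminorm 0 = 0"
proof (rule antisym)
  show "resolvent_seminorm (0 :: 'a pre_resolvent_algebra) \<le> 0"
    by (rule resolvent_seminorm_bounds(3)) simp
qed (rule resolvent_seminorm_bounds)

lemma resolvent_seminorm_triangle:
  "resolvent_seminorm (a + b) \<le> resolvent_seminorm a + resolvent_seminorm b"
proof (rule resolvent_seminorm_bounds(3))
  fix \<omega> :: "'a pre_resolvent_algebra \<Rightarrow> complex" and c assume \<omega>: "\<omega> \<in> states"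
  show "gns_prenorm \<omega> ((a + b) * c) \<le> (resolvent_seminorm a + resolvent_seminorm b) * gns_prenorm \<omega> c"
    using prenorm_triangle[OF \<omega>, of "a * c" "b * c"] resolvent_seminorm_bounds(2)[OF \<omega>, of a c]
      resolvent_seminorm_bounds(2)[OF \<omega>, of b c]
    by (simp add: distrib_right)
qed

lemma resolvent_seminorm_mult:
  "resolvent_seminorm (a * b) \<le> resolvent_seminorm a * resolvent_seminorm b"
proof (rule resolvent_seminorm_bounds(3))
  fix \<omega> :: "'a pre_resolvent_algebra \<Rightarrow> complex" and c assume \<omega>: "\<omega> \<in> states"
  show "gns_prenorm \<omega> ((a * b) * c) \<le> (resolvent_seminorm a * resolvent_seminorm b) * gns_prenorm \<omega> c"
    unfolding mult.assoc
    by (rule order_trans[OF resolvent_seminorm_bounds(2)[OF \<omega>]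
          mult_left_mono[OF resolvent_seminorm_bounds(2)[OF \<omega>] resolvent_seminorm_bounds(1)]])
qed

lemma resolvent_seminorm_scaleC_le: "resolvent_seminorm (c *\<^sub>C a) \<le> cmod c * resolvent_seminorm a"
proof (rule resolvent_seminorm_bounds(3))
  fix \<omega> :: "'a pre_resolvent_algebra \<Rightarrow> complex" and b assume \<omega>: "\<omega> \<in> states"
  show "gns_prenorm \<omega> ((c *\<^sub>C a) * b) \<le> cmod c * resolvent_seminorm a * gns_prenorm \<omega> b"
    unfolding mult_scaleC_left prenorm_scaleC[OF \<omega>] mult.assoc[of "cmod c"]
    by (rule mult_left_mono[OF resolvent_seminorm_bounds(2)[OF \<omega>]]) simp
qed

lemma resolvent_seminorm_scaleC: "resolvent_seminorm (c *\<^sub>C a) = cmod c * resolvent_seminorm a"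
proof (cases "c = 0")
  case False
  have "resolvent_seminorm a \<le> cmod (1 / c) * resolvent_seminorm (c *\<^sub>C a)"
    using resolvent_seminorm_scaleC_le[of "1 / c" "c *\<^sub>C a"] False
    by (simp add: scaleC_scaleC scaleC_one)
  then have "cmod c * resolvent_seminorm a \<le> resolvent_seminorm (c *\<^sub>C a)"
    using False by (simp add: norm_divide pos_le_divide_eq mult.commute)
  then show ?thesis using resolvent_seminorm_scaleC_le[of c a] by simp
qed simp

lemma resolvent_seminorm_uminus: "resolvent_seminorm (- a) = resolvent_seminorm a"
  using resolvent_seminorm_scaleC[of "- 1" a] by (simp add: scaleC_one)

lemma resolvent_seminorm_minus_commute: "resolvent_seminorm (a - b) = resolvent_seminorm (b - a)"
  using resolvent_seminorm_uminus[of "a - b"] by simp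

lemma resolvent_seminorm_triangle3: "\<bar>resolvent_seminorm a - resolvent_seminorm b\<bar> \<le> resolvent_seminorm (a - b)"
  using resolvent_seminorm_triangle[of "a - b" b] resolvent_seminorm_triangle[of "b - a" a]
    resolvent_seminorm_minus_commute[of a b]
  by simp

lemma resolvent_seminorm_one: "resolvent_seminorm (1 :: 'x :: symplectic_space pre_resolvent_algebra) = 1"
proof (rule antisym)
  show "resolvent_seminorm (1 :: 'x pre_resolvent_algebra) \<le> 1"
    by (rule resolvent_seminorm_bounds(3)) simp
  obtain \<omega> where \<omega>: "\<omega> \<in> (states :: ('x pre_resolvent_algebra \<Rightarrow> complex) set)"
    using states_nonempty by blast
  show "1 \<le> resolvent_seminorm (1 :: 'x pre_resolvent_algebra)"
    using resolvent_seminorm_bounds(2)[OF \<omega>, of 1 1] by (simp add: prenorm_one[OF \<omega>])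
qed

lemma resolvent_seminorm_le_star_mult:
  "(resolvent_seminorm a)\<^sup>2 \<le> resolvent_seminorm (star a * a)"
proof -
  have "resolvent_seminorm a \<le> sqrt (resolvent_seminorm (star a * a))"
  proof (rule resolvent_seminorm_bounds(3))
    fix \<omega> :: "'a pre_resolvent_algebra \<Rightarrow> complex" and b assume \<omega>: "\<omega> \<in> states"
    let ?p = "gns_prenorm \<omega> b"
    have "(gns_prenorm \<omega> (a * b))\<^sup>2 = Re (\<omega> (star b * ((star a * a) * b)))"
      by (simp add: prenorm_power2[OF \<omega>] star_mult mult.assoc)
    also have "\<dots> \<le> ?p * gns_prenorm \<omega> ((star a * a) * b)"
      using complex_Re_le_cmod state_CS[OF \<omega>] order_trans by blast
    also have "\<dots> \<le> ?p * (resolvent_seminorm (star a * a) * ?p)"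
      by (rule mult_left_mono[OF resolvent_seminorm_bounds(2)[OF \<omega>]]) (simp add: \<omega>)
    also have "\<dots> = (sqrt (resolvent_seminorm (star a * a)) * ?p)\<^sup>2"
      by (simp add: power_mult_distrib resolvent_seminorm_bounds(1) power2_eq_square)
    finally show "gns_prenorm \<omega> (a * b) \<le> sqrt (resolvent_seminorm (star a * a)) * ?p"
      by (rule power2_le_imp_le) (simp add: resolvent_seminorm_bounds(1) \<omega>)
  qed
  then show ?thesis
    by (metis real_sqrt_le_iff real_sqrt_abs abs_of_nonneg resolvent_seminorm_bounds(1))
qed

lemma resolvent_seminorm_star: "resolvent_seminorm (star a) = resolvent_seminorm a"
proof -
  have le: "resolvent_seminorm a \<le> resolvent_seminorm (star a)" for a :: "'a pre_resolvent_algebra"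
  proof (cases "resolvent_seminorm a = 0")
    case True
    then show ?thesis by (simp add: resolvent_seminorm_bounds(1))
  next
    case False
    then have pos: "resolvent_seminorm a > 0"
      using resolvent_seminorm_bounds(1)[of a] by linarith
    have "resolvent_seminorm a * resolvent_seminorm a \<le> resolvent_seminorm (star a) * resolvent_seminorm a"
      using order_trans[OF resolvent_seminorm_le_star_mult resolvent_seminorm_mult, of a]
      by (simp add: power2_eq_square)
    then show ?thesis using pos by simp
  qed
  show ?thesis using le[of a] le[of "star a"] by simp
qed

lemma resolvent_seminorm_star_mult: "resolvent_seminorm (star a * a) = (resolvent_seminorm a)\<^sup>2"
  using resolvent_seminorm_le_star_mult[of a] resolvent_seminorm_mult[of "star a" a]
  by (simp add: resolvent_seminorm_star power2_eq_square)


section \<open>The resolvent algebra\<close>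

text \<open>
  The completion of \<open>\<R>\<^sub>0\<close> modulo the kernel of the seminorm, as Cauchy sequences
  modulo null sequences.
\<close>

definition resolvent_Cauchy :: "(nat \<Rightarrow> 'x :: symplectic_space pre_resolvent_algebra) \<Rightarrow> bool" where
  "resolvent_Cauchy s \<longleftrightarrow>
     (\<forall>e>0. \<exists>N. \<forall>m\<ge>N. \<forall>n\<ge>N. resolvent_seminorm (s m - s n) < e)"

definition resolvent_equiv ::
  "(nat \<Rightarrow> 'x :: symplectic_space pre_resolvent_algebra) \<Rightarrow> (nat \<Rightarrow> 'x pre_resolvent_algebra) \<Rightarrow> bool" where
  "resolvent_equiv s t \<longleftrightarrow> resolvent_Cauchy s \<and> resolvent_Cauchy t \<and>
     (\<lambda>n. resolvent_seminorm (s n - t n)) \<longlonglongrightarrow> 0"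

lemma resolvent_Cauchy_const [simp]: "resolvent_Cauchy (\<lambda>_. a)"
  by (simp add: resolvent_Cauchy_def)

lemma resolvent_equiv_refl [simp]: "resolvent_equiv s s \<longleftrightarrow> resolvent_Cauchy s"
  by (simp add: resolvent_equiv_def)

lemma resolvent_equiv_sym: "resolvent_equiv s t \<Longrightarrow> resolvent_equiv t s"
proof -
  assume "resolvent_equiv s t"
  moreover have "(\<lambda>n. resolvent_seminorm (t n - s n)) = (\<lambda>n. resolvent_seminorm (s n - t n))"
    by (intro ext resolvent_seminorm_minus_commute)
  ultimately show ?thesis by (simp add: resolvent_equiv_def)
qed

lemma resolvent_equivI:
  assumes "resolvent_Cauchy s" "resolvent_Cauchy t" "g \<longlonglongrightarrow> 0"
    and "\<And>n. resolvent_seminorm (s n - t n) \<le> g n"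
  shows "resolvent_equiv s t"
proof -
  have "(\<lambda>n. resolvent_seminorm (s n - t n)) \<longlonglongrightarrow> 0"
    by (rule Lim_null_comparison[OF _ assms(3)])
      (simp add: assms(4) resolvent_seminorm_bounds(1))
  then show ?thesis using assms by (simp add: resolvent_equiv_def)
qed

lemma resolvent_equiv_trans:
  assumes "resolvent_equiv s t" "resolvent_equiv t u"
  shows "resolvent_equiv s u"
proof (rule resolvent_equivI)
  show "(\<lambda>n. resolvent_seminorm (s n - t n) + resolvent_seminorm (t n - u n)) \<longlonglongrightarrow> 0"
    using assms unfolding resolvent_equiv_def by (auto intro: tendsto_add_zero)
  show "resolvent_seminorm (s n - u n) \<le> resolvent_seminorm (s n - t n) + resolvent_seminorm (t n - u n)" for n
    using resolvent_seminorm_triangle[of "s n - t n" "t n - u n"] by simp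
qed (use assms in \<open>simp_all add: resolvent_equiv_def\<close>)

lemma resolvent_seminorm_Cauchy:
  assumes "resolvent_Cauchy s"
  shows "Cauchy (\<lambda>n. resolvent_seminorm (s n))"
proof (rule metric_CauchyI)
  fix e :: real assume "e > 0"
  then obtain N where N: "\<And>m n. m \<ge> N \<Longrightarrow> n \<ge> N \<Longrightarrow> resolvent_seminorm (s m - s n) < e"
    using assms unfolding resolvent_Cauchy_def by blast
  have "dist (resolvent_seminorm (s m)) (resolvent_seminorm (s n)) < e" if "m \<ge> N" "n \<ge> N" for m n
    using N[OF that] resolvent_seminorm_triangle3[of "s m" "s n"] by (simp add: dist_real_def)
  then show "\<exists>M. \<forall>m\<ge>M. \<forall>n\<ge>M. dist (resolvent_seminorm (s m)) (resolvent_seminorm (s n)) < e"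
    by blast
qed

lemma resolvent_seminorm_bounded:
  assumes "resolvent_Cauchy s"
  obtains K where "K > 0" "\<And>n. resolvent_seminorm (s n) \<le> K"
proof -
  obtain K where "K > 0" "\<And>n. norm (resolvent_seminorm (s n)) \<le> K"
    using Cauchy_Bseq[OF resolvent_seminorm_Cauchy[OF assms]] by (auto simp: Bseq_def)
  then show thesis using that[of K] by (smt (verit) real_norm_def)
qed

lemma resolvent_seminorm_lim:
  assumes "resolvent_Cauchy s"
  shows "(\<lambda>n. resolvent_seminorm (s n)) \<longlonglongrightarrow> lim (\<lambda>n. resolvent_seminorm (s n))"
  using Cauchy_convergent[OF resolvent_seminorm_Cauchy[OF assms]] convergent_LIMSEQ_iff by blast

lemma resolvent_Cauchy_le:
  assumes s: "resolvent_Cauchy s" and t: "resolvent_Cauchy t" and K: "0 \<le> K" "0 \<le> L"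
    and le: "\<And>m n. resolvent_seminorm (u m - u n) \<le>
      K * resolvent_seminorm (s m - s n) + L * resolvent_seminorm (t m - t n)"
  shows "resolvent_Cauchy u"
  unfolding resolvent_Cauchy_def
proof (intro allI impI)
  fix e :: real assume e: "e > 0"
  have "e / (2 * (K + 1)) > 0" "e / (2 * (L + 1)) > 0" using e K by simp_all
  with s t obtain N M where
    N: "\<And>m n. m \<ge> N \<Longrightarrow> n \<ge> N \<Longrightarrow> resolvent_seminorm (s m - s n) < e / (2 * (K + 1))" and
    M: "\<And>m n. m \<ge> M \<Longrightarrow> n \<ge> M \<Longrightarrow> resolvent_seminorm (t m - t n) < e / (2 * (L + 1))"
    unfolding resolvent_Cauchy_def by meson
  have "resolvent_seminorm (u m - u n) < e" if mn: "m \<ge> max N M" "n \<ge> max N M" for m n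
  proof -
    have "K * resolvent_seminorm (s m - s n) \<le> (K + 1) * resolvent_seminorm (s m - s n)"
      by (rule mult_right_mono) (simp_all add: resolvent_seminorm_bounds(1))
    also have "\<dots> < e / 2"
      using N[of m n] mn K by (simp add: field_simps)
    finally have 1: "K * resolvent_seminorm (s m - s n) < e / 2" .
    have "L * resolvent_seminorm (t m - t n) \<le> (L + 1) * resolvent_seminorm (t m - t n)"
      by (rule mult_right_mono) (simp_all add: resolvent_seminorm_bounds(1))
    also have "\<dots> < e / 2"
      using M[of m n] mn K by (simp add: field_simps)
    finally show ?thesis using 1 le[of m n] by linarith
  qed
  then show "\<exists>N. \<forall>m\<ge>N. \<forall>n\<ge>N. resolvent_seminorm (u m - u n) < e" by blast
qed

lemma resolvent_seminorm_add_diff: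
  "resolvent_seminorm (a + b - (a' + b')) \<le> resolvent_seminorm (a - a') + resolvent_seminorm (b - b')"
  using resolvent_seminorm_triangle[of "a - a'" "b - b'"] by (simp add: algebra_simps)

lemma resolvent_seminorm_mult_diff:
  "resolvent_seminorm (a * b - a' * b') \<le>
     resolvent_seminorm b * resolvent_seminorm (a - a') + resolvent_seminorm a' * resolvent_seminorm (b - b')"
proof -
  have "a * b - a' * b' = (a - a') * b + a' * (b - b')" by (simp add: algebra_simps)
  then show ?thesis
    using resolvent_seminorm_triangle[of "(a - a') * b" "a' * (b - b')"]
      resolvent_seminorm_mult[of "a - a'" b] resolvent_seminorm_mult[of a' "b - b'"]
    by (simp add: mult.commute)
qed

lemma resolvent_Cauchy_add:
  "resolvent_Cauchy s \<Longrightarrow> resolvent_Cauchy t \<Longrightarrow> resolvent_Cauchy (\<lambda>n. s n + t n)"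
  by (rule resolvent_Cauchy_le[of s t 1 1]) (simp_all add: resolvent_seminorm_add_diff)

lemma resolvent_Cauchy_scaleC: "resolvent_Cauchy s \<Longrightarrow> resolvent_Cauchy (\<lambda>n. c *\<^sub>C s n)"
  by (rule resolvent_Cauchy_le[of s s "cmod c" 0])
    (simp_all add: resolvent_seminorm_scaleC flip: complex_vector.scale_right_diff_distrib)

lemma resolvent_Cauchy_uminus: "resolvent_Cauchy s \<Longrightarrow> resolvent_Cauchy (\<lambda>n. - s n)"
  using resolvent_Cauchy_scaleC[of s "- 1"] by simp

lemma resolvent_Cauchy_diff:
  "resolvent_Cauchy s \<Longrightarrow> resolvent_Cauchy t \<Longrightarrow> resolvent_Cauchy (\<lambda>n. s n - t n)"
  using resolvent_Cauchy_add[of s "\<lambda>n. - t n"] by (simp add: resolvent_Cauchy_uminus)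

lemma resolvent_Cauchy_star: "resolvent_Cauchy s \<Longrightarrow> resolvent_Cauchy (\<lambda>n. star (s n))"
  by (rule resolvent_Cauchy_le[of s s 1 0]) (simp_all add: resolvent_seminorm_star flip: star_diff)

lemma resolvent_Cauchy_mult:
  assumes s: "resolvent_Cauchy s" and t: "resolvent_Cauchy t"
  shows "resolvent_Cauchy (\<lambda>n. s n * t n)"
proof -
  obtain K where K: "K > 0" "\<And>n. resolvent_seminorm (s n) \<le> K"
    using resolvent_seminorm_bounded[OF s] by blast
  obtain L where L: "L > 0" "\<And>n. resolvent_seminorm (t n) \<le> L"
    using resolvent_seminorm_bounded[OF t] by blast
  show ?thesis
  proof (rule resolvent_Cauchy_le[OF s t])
    show "resolvent_seminorm (s m * t m - s n * t n) \<le>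
        L * resolvent_seminorm (s m - s n) + K * resolvent_seminorm (t m - t n)" for m n
      by (rule order_trans[OF resolvent_seminorm_mult_diff add_mono[OF mult_right_mono mult_right_mono]])
        (use K L resolvent_seminorm_bounds(1) in auto)
  qed (use K L in auto)
qed

quotient_type (overloaded) 'x resolvent_algebra =
  "nat \<Rightarrow> 'x :: symplectic_space pre_resolvent_algebra" / partial: resolvent_equiv
proof (rule part_equivpI)
  show "\<exists>s :: nat \<Rightarrow> 'x pre_resolvent_algebra. resolvent_equiv s s"
    by (rule exI[of _ "\<lambda>_. 0"]) simp
  show "symp (resolvent_equiv :: (nat \<Rightarrow> 'x pre_resolvent_algebra) \<Rightarrow> _)"
    by (rule sympI) (rule resolvent_equiv_sym)
  show "transp (resolvent_equiv :: (nat \<Rightarrow> 'x pre_resolvent_algebra) \<Rightarrow> _)"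
    by (rule transpI) (rule resolvent_equiv_trans)
qed

lemmas resolvent_Cauchy_intros =
  resolvent_Cauchy_add resolvent_Cauchy_scaleC resolvent_Cauchy_uminus resolvent_Cauchy_diff
  resolvent_Cauchy_star resolvent_Cauchy_mult resolvent_Cauchy_const

instantiation resolvent_algebra :: (symplectic_space) "{complex_star_algebra_1, real_normed_algebra_1}"
begin

lift_definition zero_resolvent_algebra :: "'a resolvent_algebra" is "\<lambda>_. 0" by simp

lift_definition one_resolvent_algebra :: "'a resolvent_algebra" is "\<lambda>_. 1" by simp

lift_definition plus_resolvent_algebra ::
  "'a resolvent_algebra \<Rightarrow> 'a resolvent_algebra \<Rightarrow> 'a resolvent_algebra" is "\<lambda>s t n. s n + t n"
proof -
  fix s s' t t' :: "nat \<Rightarrow> 'a pre_resolvent_algebra"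
  assume st: "resolvent_equiv s s'" "resolvent_equiv t t'"
  show "resolvent_equiv (\<lambda>n. s n + t n) (\<lambda>n. s' n + t' n)"
    by (rule resolvent_equivI[where g = "\<lambda>n. resolvent_seminorm (s n - s' n) + resolvent_seminorm (t n - t' n)"])
      (use st in \<open>auto simp: resolvent_equiv_def resolvent_seminorm_add_diff
        intro: resolvent_Cauchy_add tendsto_add_zero\<close>)
qed

lift_definition scaleC_resolvent_algebra ::
  "complex \<Rightarrow> 'a resolvent_algebra \<Rightarrow> 'a resolvent_algebra" is "\<lambda>c s n. c *\<^sub>C s n"
proof -
  fix c and s s' :: "nat \<Rightarrow> 'a pre_resolvent_algebra"
  assume s: "resolvent_equiv s s'"
  show "resolvent_equiv (\<lambda>n. c *\<^sub>C s n) (\<lambda>n. c *\<^sub>C s' n)"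
    by (rule resolvent_equivI[where g = "\<lambda>n. cmod c * resolvent_seminorm (s n - s' n)"])
      (use s in \<open>auto simp: resolvent_equiv_def resolvent_seminorm_scaleC
        simp flip: complex_vector.scale_right_diff_distrib
        intro: resolvent_Cauchy_scaleC tendsto_mult_right_zero\<close>)
qed

definition "r *\<^sub>R (a :: 'a resolvent_algebra) = complex_of_real r *\<^sub>C a"

definition "- (a :: 'a resolvent_algebra) = (- 1) *\<^sub>C a"

definition "(a :: 'a resolvent_algebra) - b = a + - b"

lift_definition times_resolvent_algebra ::
  "'a resolvent_algebra \<Rightarrow> 'a resolvent_algebra \<Rightarrow> 'a resolvent_algebra" is "\<lambda>s t n. s n * t n"
proof -
  fix s s' t t' :: "nat \<Rightarrow> 'a pre_resolvent_algebra"
  assume st: "resolvent_equiv s s'" "resolvent_equiv t t'"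
  then have C: "resolvent_Cauchy s'" "resolvent_Cauchy t" by (auto simp: resolvent_equiv_def)
  obtain K where K: "K > 0" "\<And>n. resolvent_seminorm (s' n) \<le> K"
    using resolvent_seminorm_bounded[OF C(1)] by blast
  obtain L where L: "L > 0" "\<And>n. resolvent_seminorm (t n) \<le> L"
    using resolvent_seminorm_bounded[OF C(2)] by blast
  show "resolvent_equiv (\<lambda>n. s n * t n) (\<lambda>n. s' n * t' n)"
  proof (rule resolvent_equivI)
    show "resolvent_seminorm (s n * t n - s' n * t' n) \<le>
        L * resolvent_seminorm (s n - s' n) + K * resolvent_seminorm (t n - t' n)" for n
      by (rule order_trans[OF resolvent_seminorm_mult_diff add_mono[OF mult_right_mono mult_right_mono]])
        (use K L resolvent_seminorm_bounds(1) in auto)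
    show "(\<lambda>n. L * resolvent_seminorm (s n - s' n) + K * resolvent_seminorm (t n - t' n)) \<longlonglongrightarrow> 0"
      using st unfolding resolvent_equiv_def
      by (intro tendsto_add_zero tendsto_mult_right_zero) auto
  qed (use st in \<open>auto simp: resolvent_equiv_def intro: resolvent_Cauchy_mult\<close>)
qed

lift_definition star_resolvent_algebra ::
  "'a resolvent_algebra \<Rightarrow> 'a resolvent_algebra" is "\<lambda>s n. star (s n)"
proof -
  fix s s' :: "nat \<Rightarrow> 'a pre_resolvent_algebra"
  assume s: "resolvent_equiv s s'"
  show "resolvent_equiv (\<lambda>n. star (s n)) (\<lambda>n. star (s' n))"
    using s by (simp add: resolvent_equiv_def resolvent_seminorm_star resolvent_Cauchy_star flip: star_diff)
qed

lift_definition norm_resolvent_algebra :: "'a resolvent_algebra \<Rightarrow> real" is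
  "\<lambda>s. lim (\<lambda>n. resolvent_seminorm (s n))"
proof -
  fix s s' :: "nat \<Rightarrow> 'a pre_resolvent_algebra"
  assume s: "resolvent_equiv s s'"
  then have C: "resolvent_Cauchy s" "resolvent_Cauchy s'" "(\<lambda>n. resolvent_seminorm (s n - s' n)) \<longlonglongrightarrow> 0"
    by (auto simp: resolvent_equiv_def)
  have "(\<lambda>n. resolvent_seminorm (s n) - resolvent_seminorm (s' n)) \<longlonglongrightarrow> 0"
    by (rule Lim_null_comparison[OF _ C(3)]) (simp add: resolvent_seminorm_triangle3)
  from tendsto_diff[OF resolvent_seminorm_lim[OF C(1)] this]
  have "(\<lambda>n. resolvent_seminorm (s' n)) \<longlonglongrightarrow> lim (\<lambda>n. resolvent_seminorm (s n))" by simp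
  then show "lim (\<lambda>n. resolvent_seminorm (s n)) = lim (\<lambda>n. resolvent_seminorm (s' n))"
    by (simp add: limI)
qed

definition "dist (a :: 'a resolvent_algebra) b = norm (a - b)"

definition "sgn (a :: 'a resolvent_algebra) = inverse (norm a) *\<^sub>R a"

definition [code del]:
  "(uniformity :: ('a resolvent_algebra \<times> 'a resolvent_algebra) filter) =
     (INF e\<in>{0 <..}. principal {(x, y). dist x y < e})"

definition [code del]:
  "open (U :: 'a resolvent_algebra set) \<longleftrightarrow>
     (\<forall>x\<in>U. eventually (\<lambda>(x', y). x' = x \<longrightarrow> y \<in> U) uniformity)"

lemma norm_abs_resolvent_algebra:
  assumes "resolvent_Cauchy s"
  shows "(\<lambda>n. resolvent_seminorm (s n)) \<longlonglongrightarrow> norm (abs_resolvent_algebra s)"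
  using resolvent_seminorm_lim[OF assms] assms by (simp add: norm_resolvent_algebra.abs_eq)

lemma norm_resolvent_algebra_unique:
  assumes "resolvent_Cauchy s" "(\<lambda>n. resolvent_seminorm (s n)) \<longlonglongrightarrow> L"
  shows "norm (abs_resolvent_algebra s) = L"
  using norm_abs_resolvent_algebra[OF assms(1)] assms(2) LIMSEQ_unique by blast

lemma abs_resolvent_algebra_cases:
  fixes a :: "'a resolvent_algebra"
  obtains s where "resolvent_Cauchy s" "a = abs_resolvent_algebra s"
  by (metis Quotient3_abs_rep Quotient3_rep_reflp Quotient3_resolvent_algebra resolvent_equiv_refl)

lemma uminus_abs_resolvent_algebra:
  "resolvent_Cauchy s \<Longrightarrow> - abs_resolvent_algebra s = abs_resolvent_algebra (\<lambda>n. - s n)"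
  by (simp add: uminus_resolvent_algebra_def scaleC_resolvent_algebra.abs_eq)

lemma minus_abs_resolvent_algebra:
  "resolvent_Cauchy s \<Longrightarrow> resolvent_Cauchy t \<Longrightarrow>
     abs_resolvent_algebra s - abs_resolvent_algebra t = abs_resolvent_algebra (\<lambda>n. s n - t n)"
  by (simp add: minus_resolvent_algebra_def uminus_abs_resolvent_algebra plus_resolvent_algebra.abs_eq
      resolvent_Cauchy_uminus)

lemma norm_add_resolvent_algebra: "norm (a + b) \<le> norm a + norm (b :: 'a resolvent_algebra)"
proof -
  obtain s where s: "resolvent_Cauchy s" "a = abs_resolvent_algebra s" by (rule abs_resolvent_algebra_cases)
  obtain t where t: "resolvent_Cauchy t" "b = abs_resolvent_algebra t" by (rule abs_resolvent_algebra_cases)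
  have eq: "a + b = abs_resolvent_algebra (\<lambda>n. s n + t n)"
    using s t by (simp add: plus_resolvent_algebra.abs_eq)
  show ?thesis
  proof (rule LIMSEQ_le)
    show "(\<lambda>n. resolvent_seminorm (s n + t n)) \<longlonglongrightarrow> norm (a + b)"
      unfolding eq by (rule norm_abs_resolvent_algebra[OF resolvent_Cauchy_add[OF s(1) t(1)]])
    show "(\<lambda>n. resolvent_seminorm (s n) + resolvent_seminorm (t n)) \<longlonglongrightarrow> norm a + norm b"
      unfolding s(2) t(2) by (intro tendsto_add norm_abs_resolvent_algebra s t)
  qed (simp add: resolvent_seminorm_triangle)
qed

lemma norm_mult_resolvent_algebra: "norm (a * b) \<le> norm a * norm (b :: 'a resolvent_algebra)"
proof -
  obtain s where s: "resolvent_Cauchy s" "a = abs_resolvent_algebra s" by (rule abs_resolvent_algebra_cases)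
  obtain t where t: "resolvent_Cauchy t" "b = abs_resolvent_algebra t" by (rule abs_resolvent_algebra_cases)
  have eq: "a * b = abs_resolvent_algebra (\<lambda>n. s n * t n)"
    using s t by (simp add: times_resolvent_algebra.abs_eq)
  show ?thesis
  proof (rule LIMSEQ_le)
    show "(\<lambda>n. resolvent_seminorm (s n * t n)) \<longlonglongrightarrow> norm (a * b)"
      unfolding eq by (rule norm_abs_resolvent_algebra[OF resolvent_Cauchy_mult[OF s(1) t(1)]])
    show "(\<lambda>n. resolvent_seminorm (s n) * resolvent_seminorm (t n)) \<longlonglongrightarrow> norm a * norm b"
      unfolding s(2) t(2) by (intro tendsto_mult norm_abs_resolvent_algebra s t)
  qed (simp add: resolvent_seminorm_mult)
qed

lemma norm_scaleC_resolvent_algebra: "norm (c *\<^sub>C a) = cmod c * norm (a :: 'a resolvent_algebra)"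
proof -
  obtain s where s: "resolvent_Cauchy s" "a = abs_resolvent_algebra s" by (rule abs_resolvent_algebra_cases)
  have eq: "c *\<^sub>C a = abs_resolvent_algebra (\<lambda>n. c *\<^sub>C s n)"
    using s by (simp add: scaleC_resolvent_algebra.abs_eq)
  show ?thesis
    unfolding eq
  proof (rule norm_resolvent_algebra_unique[OF resolvent_Cauchy_scaleC[OF s(1)]])
    show "(\<lambda>n. resolvent_seminorm (c *\<^sub>C s n)) \<longlonglongrightarrow> cmod c * norm a"
      unfolding resolvent_seminorm_scaleC s(2) by (intro tendsto_mult tendsto_const norm_abs_resolvent_algebra s)
  qed
qed

lemma norm_star_mult_resolvent_algebra: "norm (star a * a) = (norm (a :: 'a resolvent_algebra))\<^sup>2"
proof -
  obtain s where s: "resolvent_Cauchy s" "a = abs_resolvent_algebra s" by (rule abs_resolvent_algebra_cases)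
  have eq: "star a * a = abs_resolvent_algebra (\<lambda>n. star (s n) * s n)"
    using s by (simp add: star_resolvent_algebra.abs_eq times_resolvent_algebra.abs_eq resolvent_Cauchy_star)
  show ?thesis
    unfolding eq
  proof (rule norm_resolvent_algebra_unique[OF resolvent_Cauchy_mult[OF resolvent_Cauchy_star[OF s(1)] s(1)]])
    show "(\<lambda>n. resolvent_seminorm (star (s n) * s n)) \<longlonglongrightarrow> (norm a)\<^sup>2"
      unfolding resolvent_seminorm_star_mult s(2) by (intro tendsto_power norm_abs_resolvent_algebra s)
  qed
qed

lemma norm_eq_zero_resolvent_algebra: "norm a = 0 \<longleftrightarrow> a = (0 :: 'a resolvent_algebra)"
proof -
  obtain s where s: "resolvent_Cauchy s" "a = abs_resolvent_algebra s" by (rule abs_resolvent_algebra_cases)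
  have "norm a = 0 \<longleftrightarrow> (\<lambda>n. resolvent_seminorm (s n)) \<longlonglongrightarrow> 0"
    unfolding s(2)
  proof
    assume "norm (abs_resolvent_algebra s) = 0"
    then show "(\<lambda>n. resolvent_seminorm (s n)) \<longlonglongrightarrow> 0"
      using norm_abs_resolvent_algebra[OF s(1)] by simp
  qed (rule norm_resolvent_algebra_unique[OF s(1)])
  also have "\<dots> \<longleftrightarrow> resolvent_equiv s (\<lambda>_. 0)"
    using s(1) by (simp add: resolvent_equiv_def)
  also have "\<dots> \<longleftrightarrow> a = 0"
    unfolding s(2) zero_resolvent_algebra_def
    using Quotient3_rel[OF Quotient3_resolvent_algebra, of s "\<lambda>_. 0"] s(1) by simp
  finally show ?thesis .
qed

instance
proof
  fix a b c :: "'a resolvent_algebra" and r s :: real and z w :: complex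
  note C = resolvent_Cauchy_intros
  show plus_assoc: "a + b + c = a + (b + c)"
    by transfer (simp add: add.assoc C)
  show "a + b = b + a"
    by transfer (subst add.commute, simp add: C)
  show zero: "0 + a = a"
    by transfer simp
  show neg: "- a + a = 0"
    unfolding uminus_resolvent_algebra_def by transfer simp
  show "a - b = a + - b"
    by (rule minus_resolvent_algebra_def)
  show "a * b * c = a * (b * c)"
    by transfer (simp add: mult.assoc C)
  show "(a + b) * c = a * c + b * c"
    by transfer (simp add: distrib_right C)
  show "a * (b + c) = a * b + a * c"
    by transfer (simp add: distrib_left C)
  show "1 * a = a" "a * 1 = a"
    by (transfer, simp)+
  show sr: "z *\<^sub>C (a + b) = z *\<^sub>C a + z *\<^sub>C b" for z
    by transfer (simp add: scaleC_add_right C)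
  show sl: "(z + w) *\<^sub>C a = z *\<^sub>C a + w *\<^sub>C a" for z w
    by transfer (simp add: scaleC_add_left C)
  show ss: "z *\<^sub>C w *\<^sub>C a = (z * w) *\<^sub>C a" for z w
    by transfer (simp add: scaleC_scaleC C)
  show so: "1 *\<^sub>C a = a"
    by transfer simp
  show ml: "(z *\<^sub>C a) * b = z *\<^sub>C (a * b)" for z
    by transfer (simp add: mult_scaleC_left C)
  show mr: "a * (z *\<^sub>C b) = z *\<^sub>C (a * b)" for z
    by transfer (simp add: mult_scaleC_right C)
  show "r *\<^sub>R a = complex_of_real r *\<^sub>C a"
    by (rule scaleR_resolvent_algebra_def)
  show "r *\<^sub>R (a + b) = r *\<^sub>R a + r *\<^sub>R b" "(r + s) *\<^sub>R a = r *\<^sub>R a + s *\<^sub>R a"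
    "r *\<^sub>R s *\<^sub>R a = (r * s) *\<^sub>R a" "1 *\<^sub>R a = a"
    "(r *\<^sub>R a) * b = r *\<^sub>R (a * b)" "a * (r *\<^sub>R b) = r *\<^sub>R (a * b)"
    unfolding scaleR_resolvent_algebra_def by (simp_all add: sr sl ss so ml mr)
  show "star (a + b) = star a + star b"
    by transfer (simp add: star_add C)
  show "star (z *\<^sub>C a) = cnj z *\<^sub>C star a"
    by transfer (simp add: star_scaleC C)
  show "star (a * b) = star b * star a"
    by transfer (simp add: star_mult C)
  show "star (star a) = a"
    by transfer simp
  show one: "norm (1 :: 'a resolvent_algebra) = 1"
    unfolding one_resolvent_algebra_def
    by (rule norm_resolvent_algebra_unique) (simp_all add: resolvent_seminorm_one)
  show "(0 :: 'a resolvent_algebra) \<noteq> 1"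
    using one norm_eq_zero_resolvent_algebra[of "0 :: 'a resolvent_algebra"] by auto
  show "norm a = 0 \<longleftrightarrow> a = 0"
    by (rule norm_eq_zero_resolvent_algebra)
  show "norm (a + b) \<le> norm a + norm b"
    by (rule norm_add_resolvent_algebra)
  show "norm (a * b) \<le> norm a * norm b"
    by (rule norm_mult_resolvent_algebra)
  show "norm (r *\<^sub>R a) = \<bar>r\<bar> * norm a"
    by (simp add: scaleR_resolvent_algebra_def norm_scaleC_resolvent_algebra)
  show "dist a b = norm (a - b)"
    by (rule dist_resolvent_algebra_def)
  show "sgn a = inverse (norm a) *\<^sub>R a"
    by (rule sgn_resolvent_algebra_def)
  show "(uniformity :: ('a resolvent_algebra \<times> 'a resolvent_algebra) filter) =
      (INF e\<in>{0 <..}. principal {(x, y). dist x y < e})"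
    by (rule uniformity_resolvent_algebra_def)
  show "open U \<longleftrightarrow> (\<forall>x\<in>U. \<forall>\<^sub>F (x', y) in uniformity. x' = x \<longrightarrow> y \<in> U)" for U :: "'a resolvent_algebra set"
    by (rule open_resolvent_algebra_def)
qed

end

instance resolvent_algebra :: (symplectic_space) banach
proof
  fix X :: "nat \<Rightarrow> 'a resolvent_algebra"
  assume X: "Cauchy X"
  let ?c = "\<lambda>a. abs_resolvent_algebra (\<lambda>_. a)"
  have "\<exists>a. norm (X k - ?c a) < 1 / real (Suc k)" for k
  proof -
    obtain s where s: "resolvent_Cauchy s" "X k = abs_resolvent_algebra s"
      by (rule abs_resolvent_algebra_cases)
    have "1 / (2 * real (Suc k)) > 0" by simp
    then obtain N where N: "\<And>m n. m \<ge> N \<Longrightarrow> n \<ge> N \<Longrightarrow> resolvent_seminorm (s m - s n) < 1 / (2 * real (Suc k))"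
      using s(1) unfolding resolvent_Cauchy_def by blast
    have "norm (X k - ?c (s N)) \<le> 1 / (2 * real (Suc k))"
    proof (rule LIMSEQ_le_const2)
      show "(\<lambda>n. resolvent_seminorm (s n - s N)) \<longlonglongrightarrow> norm (X k - ?c (s N))"
        unfolding s(2) minus_abs_resolvent_algebra[OF s(1) resolvent_Cauchy_const]
        by (intro norm_abs_resolvent_algebra resolvent_Cauchy_diff s resolvent_Cauchy_const)
      show "\<exists>N'. \<forall>n\<ge>N'. resolvent_seminorm (s n - s N) \<le> 1 / (2 * real (Suc k))"
        using N by (intro exI[of _ N]) (auto intro: less_imp_le)
    qed
    also have "\<dots> < 1 / real (Suc k)" by (simp add: field_simps)
    finally show ?thesis by blast
  qed
  then obtain a where a: "\<And>k. norm (X k - ?c (a k)) < 1 / real (Suc k)" by metis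
  have norm_c: "norm (?c u - ?c v) = resolvent_seminorm (u - v)" for u v
    unfolding minus_abs_resolvent_algebra[OF resolvent_Cauchy_const resolvent_Cauchy_const]
    by (rule norm_resolvent_algebra_unique) simp_all
  have inv_lim: "(\<lambda>n. 1 / real (Suc n)) \<longlonglongrightarrow> 0"
    using LIMSEQ_inverse_real_of_nat by (simp add: inverse_eq_divide)
  have aC: "resolvent_Cauchy a"
    unfolding resolvent_Cauchy_def
  proof (intro allI impI)
    fix e :: real assume e: "e > 0"
    obtain N where N: "\<And>m n. m \<ge> N \<Longrightarrow> n \<ge> N \<Longrightarrow> norm (X m - X n) < e / 3"
      using CauchyD[OF X, of "e / 3"] e by auto
    obtain M where M: "\<And>n. n \<ge> M \<Longrightarrow> 1 / real (Suc n) < e / 3"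
      using order_tendstoD(2)[OF inv_lim, of "e / 3"] e by (auto simp: eventually_sequentially)
    have "resolvent_seminorm (a m - a n) < e" if "m \<ge> max N M" "n \<ge> max N M" for m n
    proof -
      have "norm (?c (a m) - ?c (a n)) \<le> norm (?c (a m) - X m) + (norm (X m - X n) + norm (X n - ?c (a n)))"
        using norm_triangle_ineq[of "?c (a m) - X m" "X m - ?c (a n)"] norm_triangle_ineq[of "X m - X n" "X n - ?c (a n)"]
        by simp
      moreover have "norm (?c (a m) - X m) < e / 3" "norm (X n - ?c (a n)) < e / 3"
        using a[of m] a[of n] M[of m] M[of n] that norm_minus_commute[of "?c (a m)" "X m"] by simp_all
      moreover have "norm (X m - X n) < e / 3" using N that by simp
      ultimately show ?thesis unfolding norm_c by linarith
    qed
    then show "\<exists>N. \<forall>m\<ge>N. \<forall>n\<ge>N. resolvent_seminorm (a m - a n) < e" by blast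
  qed
  let ?x = "abs_resolvent_algebra a"
  have lim: "(\<lambda>k. norm (?c (a k) - ?x)) \<longlonglongrightarrow> 0"
  proof (rule LIMSEQ_I)
    fix e :: real assume e: "e > 0"
    then obtain N where N: "\<And>m n. m \<ge> N \<Longrightarrow> n \<ge> N \<Longrightarrow> resolvent_seminorm (a m - a n) < e / 2"
      using aC unfolding resolvent_Cauchy_def by (meson half_gt_zero)
    have "norm (norm (?c (a k) - ?x) - 0) < e" if k: "k \<ge> N" for k
    proof -
      have L: "(\<lambda>n. resolvent_seminorm (a k - a n)) \<longlonglongrightarrow> norm (?c (a k) - ?x)"
        unfolding minus_abs_resolvent_algebra[OF resolvent_Cauchy_const aC]
        by (intro norm_abs_resolvent_algebra resolvent_Cauchy_diff aC resolvent_Cauchy_const)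
      have "norm (?c (a k) - ?x) \<le> e / 2"
        by (rule LIMSEQ_le_const2[OF L]) (use N k in \<open>auto intro!: exI[of _ N] less_imp_le\<close>)
      then show ?thesis using e by simp
    qed
    then show "\<exists>N. \<forall>k\<ge>N. norm (norm (?c (a k) - ?x) - 0) < e" by blast
  qed
  have lim2: "(\<lambda>k. 1 / real (Suc k) + norm (?c (a k) - ?x)) \<longlonglongrightarrow> 0"
    by (intro tendsto_add_zero inv_lim lim)
  have le: "norm (X k - ?x) \<le> 1 / real (Suc k) + norm (?c (a k) - ?x)" for k
    using norm_triangle_ineq[of "X k - ?c (a k)" "?c (a k) - ?x"] a[of k] by simp
  have "(\<lambda>k. X k - ?x) \<longlonglongrightarrow> 0"
    by (rule Lim_null_comparison[OF _ lim2]) (intro always_eventually allI le)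
  then have "X \<longlonglongrightarrow> ?x"
    by (rule LIM_zero_cancel)
  then show "convergent X"
    by (rule convergentI)
qed

instance resolvent_algebra :: (symplectic_space) cstar_algebra_1
  by standard (rule norm_scaleC_resolvent_algebra, rule norm_star_mult_resolvent_algebra)

definition resolvent_embed ::
  "'x :: symplectic_space pre_resolvent_algebra \<Rightarrow> 'x resolvent_algebra" where
  "resolvent_embed a = abs_resolvent_algebra (\<lambda>_. a)"

definition Res :: "real \<Rightarrow> 'x :: symplectic_space \<Rightarrow> 'x resolvent_algebra" where
  "Res l f = resolvent_embed (pre_res l f)"

lemma star_hom_resolvent_embed: "star_hom resolvent_embed"
  unfolding star_hom_def
  by (simp add: resolvent_embed_def plus_resolvent_algebra.abs_eq scaleC_resolvent_algebra.abs_eq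
      times_resolvent_algebra.abs_eq star_resolvent_algebra.abs_eq one_resolvent_algebra_def)

lemma norm_resolvent_embed: "norm (resolvent_embed a) = resolvent_seminorm a"
  unfolding resolvent_embed_def by (rule norm_resolvent_algebra_unique) simp_all

lemma dense_resolvent_embed:
  "closure (range (resolvent_embed :: 'x :: symplectic_space pre_resolvent_algebra \<Rightarrow> _)) = UNIV"
proof -
  have "x \<in> closure (range resolvent_embed)" for x :: "'x resolvent_algebra"
    unfolding closure_approachable
  proof (intro allI impI)
    fix e :: real assume e: "e > 0"
    obtain s where s: "resolvent_Cauchy s" "x = abs_resolvent_algebra s"
      by (rule abs_resolvent_algebra_cases)
    obtain N where N: "\<And>m n. m \<ge> N \<Longrightarrow> n \<ge> N \<Longrightarrow> resolvent_seminorm (s m - s n) < e / 2"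
      using s(1) e unfolding resolvent_Cauchy_def by (meson half_gt_zero)
    have "(\<lambda>n. resolvent_seminorm (s N - s n)) \<longlonglongrightarrow> norm (resolvent_embed (s N) - x)"
      unfolding s(2) resolvent_embed_def minus_abs_resolvent_algebra[OF resolvent_Cauchy_const s(1)]
      by (intro norm_abs_resolvent_algebra resolvent_Cauchy_diff s resolvent_Cauchy_const)
    then have "norm (resolvent_embed (s N) - x) \<le> e / 2"
      by (rule LIMSEQ_le_const2) (use N in \<open>auto intro!: exI[of _ N] less_imp_le\<close>)
    then show "\<exists>y\<in>range resolvent_embed. dist y x < e"
      using e by (intro bexI[of _ "resolvent_embed (s N)"]) (auto simp: dist_norm)
  qed
  then show ?thesis by blast
qed

lemma star_hom_diff: "star_hom \<phi> \<Longrightarrow> \<phi> (a - b) = \<phi> a - \<phi> b"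
proof -
  assume h: "star_hom \<phi>"
  have "\<phi> (a + (- 1) *\<^sub>C b) = \<phi> a + (- 1) *\<^sub>C \<phi> b"
    using h unfolding star_hom_def by metis
  then show ?thesis by (simp add: scaleC_one)
qed

lemma resolvent_relations_hom:
  assumes h: "star_hom \<phi>" and R: "resolvent_relations R"
  shows "resolvent_relations (\<lambda>l f. \<phi> (R l f))"
proof -
  have hom: "\<phi> (a + b) = \<phi> a + \<phi> b" "\<phi> (a - b) = \<phi> a - \<phi> b" "\<phi> (c *\<^sub>C a) = c *\<^sub>C \<phi> a"
    "\<phi> (a * b) = \<phi> a * \<phi> b" "\<phi> 1 = 1" "\<phi> (star a) = star (\<phi> a)" for a b c
    using h star_hom_diff[OF h] by (simp_all add: star_hom_def)
  note R' = R[unfolded resolvent_relations_def]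
  show ?thesis
    unfolding resolvent_relations_def
  proof (intro conjI allI impI, goal_cases)
    case (1 l m f)
    then have "R l f - R m f = (\<i> * complex_of_real (m - l)) *\<^sub>C (R l f * R m f)"
      by (rule R'[THEN conjunct1, rule_format])
    from arg_cong[OF this, of \<phi>] show ?case by (simp only: hom power2_eq_square)
  next
    case (2 l f)
    then have "star (R l f) = R (- l) f"
      by (rule R'[THEN conjunct2, THEN conjunct1, rule_format])
    from arg_cong[OF this, of \<phi>] show ?case by (simp only: hom power2_eq_square)
  next
    case (3 l m f g)
    then have "R l f * R m g - R m g * R l f = (\<i> * complex_of_real (\<sigma> f g)) *\<^sub>C (R l f * (R m g)\<^sup>2 * R l f)"
      by (rule R'[THEN conjunct2, THEN conjunct2, THEN conjunct1, rule_format])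
    from arg_cong[OF this, of \<phi>] show ?case by (simp only: hom power2_eq_square)
  next
    case (4 n l f)
    then have "complex_of_real n *\<^sub>C R (n * l) (n *\<^sub>R f) = R l f"
      by (rule R'[THEN conjunct2, THEN conjunct2, THEN conjunct2, THEN conjunct1, rule_format])
    from arg_cong[OF this, of \<phi>] show ?case by (simp only: hom power2_eq_square)
  next
    case (5 l m f g)
    then have "R l f * R m g = R (l + m) (f + g) *
      (R l f + R m g + (\<i> * complex_of_real (\<sigma> f g)) *\<^sub>C ((R l f)\<^sup>2 * R m g))"
      by (rule R'[THEN conjunct2, THEN conjunct2, THEN conjunct2, THEN conjunct2, THEN conjunct1, rule_format])
    from arg_cong[OF this, of \<phi>] show ?case by (simp only: hom power2_eq_square)
  next
    case (6 l)
    then have "R l 0 = (- \<i> / complex_of_real l) *\<^sub>C 1"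
      by (rule R'[THEN conjunct2, THEN conjunct2, THEN conjunct2, THEN conjunct2, THEN conjunct2, rule_format])
    from arg_cong[OF this, of \<phi>] show ?case by (simp only: hom power2_eq_square)
  qed
qed

lemma resolvent_relations_Res:
  "resolvent_relations (Res :: real \<Rightarrow> 'x :: symplectic_space \<Rightarrow> 'x resolvent_algebra)"
proof -
  have eq: "Res = (\<lambda>l (f :: 'x). resolvent_embed (pre_res l f))"
    by (intro ext) (rule Res_def)
  show ?thesis
    unfolding eq
    by (rule resolvent_relations_hom[OF star_hom_resolvent_embed resolvent_relations_pre_res])
qed


section \<open>Spectra and ideals\<close>

definition spectrum :: "'a :: complex_algebra_1 \<Rightarrow> complex set" where
  "spectrum a = {z. \<not> (\<exists>b. b * (a - z *\<^sub>C 1) = 1 \<and> (a - z *\<^sub>C 1) * b = 1)}"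

definition closed_span :: "'a :: cstar_algebra_1 set \<Rightarrow> 'a set" where
  "closed_span S = closure (complex_vector.span S)"

definition closed_ideal :: "'a :: cstar_algebra_1 set \<Rightarrow> bool" where
  "closed_ideal I \<longleftrightarrow> closed I \<and> complex_vector.subspace I \<and> (\<forall>x\<in>I. \<forall>a. a * x \<in> I \<and> x * a \<in> I)"

definition generated_ideal :: "'a :: cstar_algebra_1 \<Rightarrow> 'a set" where
  "generated_ideal a = closed_span {b * a * c | b c. True}"

lemma bounded_linear_scaleC: "bounded_linear (\<lambda>x :: 'a :: cstar_algebra_1. c *\<^sub>C x)"
proof (rule bounded_linear_intro[where K = "cmod c"])
  show "c *\<^sub>C (x + y) = c *\<^sub>C x + c *\<^sub>C y" for x y :: 'a by (rule scaleC_add_right)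
  show "c *\<^sub>C r *\<^sub>R x = r *\<^sub>R c *\<^sub>C x" for r and x :: 'a
    unfolding scaleR_scaleC scaleC_scaleC by (simp only: mult.commute)
  show "norm (c *\<^sub>C x) \<le> norm x * cmod c" for x :: 'a by (simp add: norm_scaleC)
qed

lemma subspace_closed_span: "complex_vector.subspace (closed_span S)"
proof (rule complex_vector.subspaceI)
  show "0 \<in> closed_span S"
    unfolding closed_span_def using complex_vector.span_zero closure_subset by blast
next
  fix x y assume "x \<in> closed_span S" "y \<in> closed_span S"
  then obtain X Y where "\<And>n. X n \<in> complex_vector.span S" "X \<longlonglongrightarrow> x"
    "\<And>n. Y n \<in> complex_vector.span S" "Y \<longlonglongrightarrow> y"
    unfolding closed_span_def closure_sequential by blast
  then have "\<forall>n. X n + Y n \<in> complex_vector.span S" "(\<lambda>n. X n + Y n) \<longlonglongrightarrow> x + y"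
    by (auto intro: complex_vector.span_add tendsto_add)
  then show "x + y \<in> closed_span S"
    unfolding closed_span_def closure_sequential by (intro exI[of _ "\<lambda>n. X n + Y n"] conjI)
next
  fix c x assume "x \<in> closed_span S"
  then obtain X where "\<And>n. X n \<in> complex_vector.span S" "X \<longlonglongrightarrow> x"
    unfolding closed_span_def closure_sequential by blast
  then have "\<forall>n. c *\<^sub>C X n \<in> complex_vector.span S" "(\<lambda>n. c *\<^sub>C X n) \<longlonglongrightarrow> c *\<^sub>C x"
    by (auto intro: complex_vector.span_scale bounded_linear.tendsto[OF bounded_linear_scaleC])
  then show "c *\<^sub>C x \<in> closed_span S"
    unfolding closed_span_def closure_sequential by (intro exI[of _ "\<lambda>n. c *\<^sub>C X n"] conjI)
qed

lemma closed_span_minimal: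
  assumes "closed T" "complex_vector.subspace T" "S \<subseteq> T"
  shows "closed_span S \<subseteq> T"
  unfolding closed_span_def
  by (rule closure_minimal[OF complex_vector.span_minimal]) (use assms in auto)

lemma closed_span_superset: "S \<subseteq> closed_span S"
  unfolding closed_span_def using complex_vector.span_superset closure_subset by blast

lemma closed_span_mult_left:
  assumes "x \<in> closed_span S" "\<And>s. s \<in> S \<Longrightarrow> a * s \<in> closed_span T"
  shows "a * x \<in> closed_span T"
proof -
  have "closed_span S \<subseteq> (\<lambda>x. a * x) -` closed_span T"
  proof (rule closed_span_minimal)
    show "closed ((\<lambda>x. a * x) -` closed_span T)"
      by (rule closed_vimage) (simp add: closed_span_def, intro continuous_intros)
    show "complex_vector.subspace ((\<lambda>x. a * x) -` closed_span T)"
      using subspace_closed_span[of T]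
      by (auto simp: complex_vector.subspace_def distrib_left mult_scaleC_right)
  qed (use assms(2) in auto)
  then show ?thesis using assms(1) by blast
qed

lemma closed_span_mult_right:
  assumes "x \<in> closed_span S" "\<And>s. s \<in> S \<Longrightarrow> s * a \<in> closed_span T"
  shows "x * a \<in> closed_span T"
proof -
  have "closed_span S \<subseteq> (\<lambda>x. x * a) -` closed_span T"
  proof (rule closed_span_minimal)
    show "closed ((\<lambda>x. x * a) -` closed_span T)"
      by (rule closed_vimage) (simp add: closed_span_def, intro continuous_intros)
    show "complex_vector.subspace ((\<lambda>x. x * a) -` closed_span T)"
      using subspace_closed_span[of T]
      by (auto simp: complex_vector.subspace_def distrib_right mult_scaleC_left)
  qed (use assms(2) in auto)
  then show ?thesis using assms(1) by blast
qed

lemma closed_ideal_generated_ideal: "closed_ideal (generated_ideal a)"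
proof -
  let ?S = "{b * a * c | b c. True}"
  have "d * x \<in> generated_ideal a" "x * d \<in> generated_ideal a" if "x \<in> generated_ideal a" for x d
  proof -
    have "d * (b * a * c) \<in> closed_span ?S" "(b * a * c) * d \<in> closed_span ?S" for b c
      using closed_span_superset[of ?S] by (force simp: mult.assoc[symmetric], force simp: mult.assoc)
    then show "d * x \<in> generated_ideal a" "x * d \<in> generated_ideal a"
      using that closed_span_mult_left[of x ?S d ?S] closed_span_mult_right[of x ?S d ?S]
      unfolding generated_ideal_def by blast+
  qed
  moreover have "closed (generated_ideal a)" "complex_vector.subspace (generated_ideal a)"
    using subspace_closed_span by (simp_all add: generated_ideal_def closed_span_def)
  ultimately show ?thesis by (simp add: closed_ideal_def)
qed

lemma generated_ideal_contains: "a \<in> generated_ideal a"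
proof -
  have "a = 1 * a * 1" by simp
  then have "a \<in> {b * a * c | b c. True}" by blast
  then show ?thesis unfolding generated_ideal_def by (rule subsetD[OF closed_span_superset])
qed

lemma generated_ideal_least: "closed_ideal I \<Longrightarrow> a \<in> I \<Longrightarrow> generated_ideal a \<subseteq> I"
proof -
  assume I: "closed_ideal I" "a \<in> I"
  show "generated_ideal a \<subseteq> I"
    unfolding generated_ideal_def
  proof (rule closed_span_minimal)
    show "{b * a * c | b c. True} \<subseteq> I" using I by (auto simp: closed_ideal_def)
  qed (use I in \<open>simp_all add: closed_ideal_def\<close>)
qed

definition resolvent_ideal :: "real \<Rightarrow> 'x :: symplectic_space \<Rightarrow> complex \<Rightarrow> 'x resolvent_algebra set" where
  "resolvent_ideal l f \<rho> = generated_ideal (Res l f - \<rho> *\<^sub>C 1)"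

end

theory Submission
  imports Defs
begin

text \<open>
  Write \<open>A = R(\<lambda>,f) - \<rho>\<close>. The proof avoids states and functional calculus; everything is done
  with averages of a unitary. The Cayley transform \<open>u = 1 - 2i\<lambda>R(\<lambda>,f)\<close> is unitary, so
  \<open>w = 1 - 2i\<lambda>\<rho>\<close>, being in its spectrum, has modulus \<open>1\<close>, and \<open>A\<close> is a multiple of \<open>v - 1\<close> for
  the unitary \<open>v = u/w\<close>. By von Neumann's mean ergodic argument the averages \<open>h\<^sub>n\<close> of
  \<open>1, v, \<dots>, v\<^sup>n\<close> satisfy \<open>\<parallel>h\<^sub>n\<parallel> \<le> 1\<close>, \<open>A h\<^sub>n \<rightarrow> 0\<close> and \<open>1 - h\<^sub>n \<in> \<R>A\<close>, so they act as if they were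
  the projection onto the kernel of \<open>A\<close>; in particular \<open>x h\<^sub>n \<rightarrow> 0\<close> implies \<open>x \<in> [\<R>A]\<close>.

  The heart of the matter is the last claim. Let \<open>M\<close> be the closed subspace of all \<open>x\<close> with
  \<open>h\<^sub>n\<^sup>* x h\<^sub>n \<rightarrow> 0\<close>. It contains \<open>A\<R>\<close> and \<open>\<R>A\<close>, so modulo \<open>M\<close> a factor \<open>R(\<lambda>,f)\<close> on the left or
  on the right may be replaced by \<open>\<rho>\<close>, and the commutation relation becomes
  \<open>0 \<equiv> i\<sigma>(f,g)\<rho>\<^sup>2 R(\<mu>,g)\<^sup>2\<close>. If \<open>\<rho> \<noteq> 0\<close> and \<open>\<sigma>(f,g) \<noteq> 0\<close> then \<open>R(\<mu>,g)\<^sup>2 \<in> M\<close> for all \<open>\<mu>\<close>. Up to a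
  factor this is the derivative of \<open>\<mu> \<mapsto> R(\<mu>,g)\<close>, which vanishes at infinity; hence \<open>R(\<mu>,g) \<in> M\<close>.
  The resolvent equation then puts \<open>R(\<mu>,g)\<^sup>* R(\<mu>,g)\<close> into \<open>M\<close>, that is, \<open>R(\<mu>,g) h\<^sub>n \<rightarrow> 0\<close>,
  and \<open>R(\<mu>,g)\<close> lies in \<open>[\<R>A]\<close>; similarly it lies in \<open>[A\<R>]\<close>.

  Hence \<open>A R(\<mu>,g) \<in> [\<R>A]\<close> for all generators: if \<open>\<sigma>(f,g) = 0\<close> the two factors commute, if
  \<open>\<rho> \<noteq> 0\<close> and \<open>\<sigma>(f,g) \<noteq> 0\<close> this has just been shown, and if \<open>\<rho> = 0\<close> it can be read off from the
  commutation relation, which has a factor \<open>A = R(\<lambda>,f)\<close> at both ends of its right-hand side. So \<open>[\<R>A]\<close> is an ideal, and by symmetry so is \<open>[A\<R>]\<close>. If this ideal were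
  everything, \<open>1\<close> could be approximated by elements of \<open>\<R>A\<close> and by elements of \<open>A\<R>\<close>, and \<open>A\<close>
  would be invertible, contrary to the choice of \<open>\<rho>\<close>.
\<close>


section \<open>Invertibility and unitaries in C*-algebras\<close>

text \<open>Ring-theoretic invertibility; in a noncommutative ring both inverses have to be demanded.\<close>

definition invertible_elem :: "'a :: monoid_mult \<Rightarrow> bool" where
  "invertible_elem a \<longleftrightarrow> (\<exists>b. b * a = 1 \<and> a * b = 1)"

lemma invertible_elemI:
  fixes a :: "'a :: monoid_mult"
  assumes "b * a = 1" "a * c = 1"
  shows "invertible_elem a"
proof -
  have "b = b * (a * c)" using assms(2) by simp
  also have "\<dots> = c" using assms(1) by (simp flip: mult.assoc)
  finally show ?thesis using assms by (auto simp: invertible_elem_def)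
qed

lemma invertible_elem_mult:
  fixes a b :: "'a :: monoid_mult"
  assumes "invertible_elem a" "invertible_elem b"
  shows "invertible_elem (a * b)"
proof -
  obtain c d where c: "c * a = 1" "a * c = 1" and d: "d * b = 1" "b * d = 1"
    using assms by (auto simp: invertible_elem_def)
  have "(d * c) * (a * b) = d * (c * a) * b" "(a * b) * (d * c) = a * (b * d) * c"
    by (simp_all only: mult.assoc)
  then show ?thesis
    using c d by (intro invertible_elemI[of "d * c" _ "d * c"]) simp_all
qed

lemma spectrum_iff: "z \<in> spectrum a \<longleftrightarrow> \<not> invertible_elem (a - z *\<^sub>C 1)"
  by (simp add: spectrum_def invertible_elem_def)

lemma invertible_elem_scaleC_iff:
  fixes a :: "'a :: complex_algebra_1"
  assumes "c \<noteq> 0"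
  shows "invertible_elem (c *\<^sub>C a) \<longleftrightarrow> invertible_elem a"
proof -
  have imp: "invertible_elem (c *\<^sub>C a)" if inv: "invertible_elem a" and "c \<noteq> 0" for c and a :: 'a
  proof -
    obtain b where "b * a = 1" "a * b = 1" using inv by (auto simp: invertible_elem_def)
    then show ?thesis
      using \<open>c \<noteq> 0\<close> by (intro invertible_elemI[of "(1 / c) *\<^sub>C b" _ "(1 / c) *\<^sub>C b"])
        (simp_all add: mult_scaleC_left mult_scaleC_right scaleC_scaleC scaleC_one)
  qed
  show ?thesis
    using imp[of a c] imp[of "c *\<^sub>C a" "1 / c"] assms by (auto simp: scaleC_scaleC scaleC_one)
qed

text \<open>The Neumann series.\<close>

lemma invertible_elem_near_one:
  fixes x :: "'a :: {real_normed_algebra_1, banach}"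
  assumes "norm (1 - x) < 1"
  shows "invertible_elem x"
proof -
  let ?y = "1 - x" and ?s = "\<Sum>n. (1 - x) ^ n"
  have S: "summable (\<lambda>n. ?y ^ n)"
    by (rule complete_algebra_summable_geometric[OF assms])
  have "?s * ?y = ?s - 1" "?y * ?s = ?s - 1"
    using suminf_mult2[OF S, of ?y] suminf_mult[OF S, of ?y] suminf_split_head[OF S]
    by (simp_all add: power_Suc2 flip: power_Suc)
  then show ?thesis
    by (intro invertible_elemI[of ?s _ ?s]) (simp_all add: algebra_simps)
qed

lemma norm_star: "norm (star x) = norm (x :: 'a :: cstar_algebra_1)"
proof -
  have le: "norm x \<le> norm (star x)" for x :: 'a
  proof (cases "x = 0")
    case False
    have "norm x * norm x \<le> norm (star x) * norm x"
      using norm_mult_ineq[of "star x" x] by (simp add: norm_star_mult power2_eq_square)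
    then show ?thesis using False by simp
  qed simp
  show ?thesis using le[of x] le[of "star x"] by simp
qed

text \<open>Both identities are required, since an isometry in a C*-algebra need not be invertible.\<close>

definition unitary_elem :: "'a :: complex_star_algebra_1 \<Rightarrow> bool" where
  "unitary_elem u \<longleftrightarrow> star u * u = 1 \<and> u * star u = 1"

lemma norm_unitary:
  fixes u :: "'a :: cstar_algebra_1"
  assumes "unitary_elem u"
  shows "norm u = 1"
proof -
  have "(norm u)\<^sup>2 = 1"
    using norm_star_mult[of u] assms by (simp add: unitary_elem_def)
  then show ?thesis by (simp add: power2_eq_1_iff) (smt (verit) norm_ge_zero)
qed

lemma unitary_elem_scaleC:
  fixes u :: "'a :: complex_star_algebra_1"
  assumes "unitary_elem u" "cmod c = 1"
  shows "unitary_elem (c *\<^sub>C u)"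
proof -
  have "c * cnj c = 1" using assms(2) by (simp flip: complex_norm_square)
  then show ?thesis
    using assms(1)
    by (simp add: unitary_elem_def star_scaleC mult_scaleC_left mult_scaleC_right scaleC_scaleC
        scaleC_one mult.commute)
qed

lemma spectrum_unitary:
  fixes u :: "'a :: cstar_algebra_1"
  assumes u: "unitary_elem u" and z: "z \<in> spectrum u"
  shows "cmod z = 1"
proof (rule ccontr)
  assume "cmod z \<noteq> 1"
  then consider "cmod z < 1" | "cmod z > 1" by linarith
  then have "invertible_elem (u - z *\<^sub>C 1)"
  proof cases
    case 1
    have "invertible_elem (1 - z *\<^sub>C star u)"
      using 1 norm_unitary[OF u] by (intro invertible_elem_near_one) (simp add: norm_scaleC norm_star)
    moreover have "invertible_elem u"
      using u by (intro invertible_elemI[of "star u" _ "star u"]) (simp_all add: unitary_elem_def)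
    moreover have "u - z *\<^sub>C 1 = u * (1 - z *\<^sub>C star u)"
      using u by (simp add: unitary_elem_def right_diff_distrib mult_scaleC_right)
    ultimately show ?thesis by (simp add: invertible_elem_mult)
  next
    case 2
    then have "z \<noteq> 0" by auto
    have "cmod (1 / z) < 1" using 2 by (simp add: norm_divide divide_less_eq)
    then have "invertible_elem (1 - (1 / z) *\<^sub>C u)"
      using norm_unitary[OF u] by (intro invertible_elem_near_one) (simp add: norm_scaleC)
    moreover have "u - z *\<^sub>C 1 = (- z) *\<^sub>C (1 - (1 / z) *\<^sub>C u)"
      using \<open>z \<noteq> 0\<close> by (simp add: complex_vector.scale_right_diff_distrib scaleC_scaleC scaleC_one
        complex_vector.scale_minus_left)
    ultimately show ?thesis
      using \<open>z \<noteq> 0\<close> invertible_elem_scaleC_iff[of "- z" "1 - (1 / z) *\<^sub>C u"]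
      by (metis neg_equal_0_iff_equal)
  qed
  then show False using z by (simp add: spectrum_iff)
qed


section \<open>Approximate kernel projections\<close>

text \<open>
  The set \<open>{b * a | b. True}\<close> is already a linear subspace, so its closed linear span is just its
  closure; the same holds on the other side.
\<close>

lemma closed_span_left_multiples:
  "closed_span {b * a | b. True} = closure {b * a | b. True}"
proof -
  have "complex_vector.subspace {b * a | b. True}"
  proof (rule complex_vector.subspaceI)
    have "0 = 0 * a" by simp
    then show "0 \<in> {b * a | b. True}" by blast
  next
    fix x y assume "x \<in> {b * a | b. True}" "y \<in> {b * a | b. True}"
    then obtain b c where "x = b * a" "y = c * a" by blast
    then have "x + y = (b + c) * a" by (simp add: distrib_right)
    then show "x + y \<in> {b * a | b. True}" by blast
  next
    fix k x assume "x \<in> {b * a | b. True}"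
    then obtain b where "x = b * a" by blast
    then have "k *\<^sub>C x = (k *\<^sub>C b) * a" by (simp add: mult_scaleC_left)
    then show "k *\<^sub>C x \<in> {b * a | b. True}" by blast
  qed
  then show ?thesis by (simp only: closed_span_def complex_vector.span_eq_iff[THEN iffD2])
qed

lemma closed_span_right_multiples:
  "closed_span {a * b | b. True} = closure {a * b | b. True}"
proof -
  have "complex_vector.subspace {a * b | b. True}"
  proof (rule complex_vector.subspaceI)
    have "0 = a * 0" by simp
    then show "0 \<in> {a * b | b. True}" by blast
  next
    fix x y assume "x \<in> {a * b | b. True}" "y \<in> {a * b | b. True}"
    then obtain b c where "x = a * b" "y = a * c" by blast
    then have "x + y = a * (b + c)" by (simp add: distrib_left)
    then show "x + y \<in> {a * b | b. True}" by blast
  next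
    fix k x assume "x \<in> {a * b | b. True}"
    then obtain b where "x = a * b" by blast
    then have "k *\<^sub>C x = a * (k *\<^sub>C b)" by (simp add: mult_scaleC_right)
    then show "k *\<^sub>C x \<in> {a * b | b. True}" by blast
  qed
  then show ?thesis by (simp only: closed_span_def complex_vector.span_eq_iff[THEN iffD2])
qed

lemma left_multiple_mem: "c * a \<in> closed_span {b * a | b. True}"
  by (rule subsetD[OF closed_span_superset]) blast

lemma right_multiple_mem: "a * c \<in> closed_span {a * b | b. True}"
  by (rule subsetD[OF closed_span_superset]) blast

lemma closed_span_left_multiples_left_ideal:
  assumes "x \<in> closed_span {b * a | b. True}"
  shows "c * x \<in> closed_span {b * a | b. True}"
proof (rule closed_span_mult_left[OF assms])
  fix s assume "s \<in> {b * a | b. True}"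
  then obtain b where "c * s = (c * b) * a" by (auto simp: mult.assoc)
  then show "c * s \<in> closed_span {b * a | b. True}" by (simp only: left_multiple_mem)
qed

lemma closed_span_right_multiples_right_ideal:
  assumes "x \<in> closed_span {a * b | b. True}"
  shows "x * c \<in> closed_span {a * b | b. True}"
proof (rule closed_span_mult_right[OF assms])
  fix s assume "s \<in> {a * b | b. True}"
  then obtain b where "s * c = a * (b * c)" by (auto simp: mult.assoc)
  then show "s * c \<in> closed_span {a * b | b. True}" by (simp only: right_multiple_mem)
qed

text \<open>
  Whether the closed left ideal generated by \<open>a\<close> is also stable under right multiplication by an
  element needs to be tested on \<open>a\<close> only, and symmetrically.
\<close>

lemma closed_span_left_multiples_mult_right:
  assumes "x \<in> closed_span {b * a | b. True}" and "a * c \<in> closed_span {b * a | b. True}"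
  shows "x * c \<in> closed_span {b * a | b. True}"
proof (rule closed_span_mult_right[OF assms(1)])
  fix s assume "s \<in> {b * a | b. True}"
  then obtain b where "s * c = b * (a * c)" by (auto simp: mult.assoc)
  then show "s * c \<in> closed_span {b * a | b. True}"
    by (simp only: closed_span_left_multiples_left_ideal[OF assms(2)])
qed

lemma closed_span_right_multiples_mult_left:
  assumes "x \<in> closed_span {a * b | b. True}" and "c * a \<in> closed_span {a * b | b. True}"
  shows "c * x \<in> closed_span {a * b | b. True}"
proof (rule closed_span_mult_left[OF assms(1)])
  fix s assume "s \<in> {a * b | b. True}"
  then obtain b where "c * s = (c * a) * b" by (auto simp: mult.assoc)
  then show "c * s \<in> closed_span {a * b | b. True}"
    by (simp only: closed_span_right_multiples_right_ideal[OF assms(2)])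
qed

text \<open>
  A sequence of contractions that behaves, in the limit, like the projection onto the common kernel
  of \<open>a\<close> and \<open>star a\<close>. Such a projection need not exist in the algebra, and the \<open>h n\<close> are not
  assumed to be self-adjoint, which is why the conditions come in two versions.
\<close>

definition approx_kernel_proj :: "'a :: cstar_algebra_1 \<Rightarrow> (nat \<Rightarrow> 'a) \<Rightarrow> bool" where
  "approx_kernel_proj a h \<longleftrightarrow>
     (\<forall>n. norm (h n) \<le> 1) \<and> (\<lambda>n. a * h n) \<longlonglongrightarrow> 0 \<and> (\<lambda>n. star (h n) * a) \<longlonglongrightarrow> 0 \<and>
     (\<forall>n. \<exists>b. 1 - h n = b * a) \<and> (\<forall>n. \<exists>b. 1 - star (h n) = a * b)"

lemma approx_kernel_proj_scaleC:
  assumes h: "approx_kernel_proj a h" and c: "c \<noteq> 0"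
  shows "approx_kernel_proj (c *\<^sub>C a) h"
proof -
  have "(\<lambda>n. c *\<^sub>C (a * h n)) \<longlonglongrightarrow> c *\<^sub>C 0" "(\<lambda>n. c *\<^sub>C (star (h n) * a)) \<longlonglongrightarrow> c *\<^sub>C 0"
    using h unfolding approx_kernel_proj_def
    by (simp_all only: bounded_linear.tendsto[OF bounded_linear_scaleC])
  then have lim: "(\<lambda>n. c *\<^sub>C a * h n) \<longlonglongrightarrow> 0" "(\<lambda>n. star (h n) * c *\<^sub>C a) \<longlonglongrightarrow> 0"
    by (simp_all add: mult_scaleC_left mult_scaleC_right)
  have eq: "((1 / c) *\<^sub>C b) * (c *\<^sub>C a) = b * a" "(c *\<^sub>C a) * ((1 / c) *\<^sub>C b) = a * b" for b
    using c by (simp_all add: mult_scaleC_left mult_scaleC_right scaleC_scaleC scaleC_one)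
  have "\<forall>n. \<exists>b. 1 - h n = b * (c *\<^sub>C a)" "\<forall>n. \<exists>b. 1 - star (h n) = (c *\<^sub>C a) * b"
    using h unfolding approx_kernel_proj_def by (metis eq(1), metis eq(2))
  then show ?thesis using h lim by (simp add: approx_kernel_proj_def)
qed

lemma power_diff_one_multiple:
  fixes v :: "'a :: ring_1"
  shows "\<exists>b. v ^ k - 1 = b * (v - 1) \<and> v ^ k - 1 = (v - 1) * b"
proof (induction k)
  case 0
  show ?case by (intro exI[of _ 0]) simp
next
  case (Suc k)
  then obtain b where b: "v ^ k - 1 = b * (v - 1)" "v ^ k - 1 = (v - 1) * b" by blast
  have "v ^ Suc k - 1 = v ^ k * (v - 1) + (v ^ k - 1)"
    by (simp only: power_Suc2) (simp add: algebra_simps)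
  also have "\<dots> = (v ^ k + b) * (v - 1)" by (simp only: b(1) distrib_right)
  finally have 1: "v ^ Suc k - 1 = (v ^ k + b) * (v - 1)" .
  have "v ^ Suc k - 1 = (v - 1) * v ^ k + (v ^ k - 1)" by (simp add: algebra_simps)
  also have "\<dots> = (v - 1) * (v ^ k + b)" by (simp only: b(2) distrib_left)
  finally show ?case using 1 by blast
qed

text \<open>
  The part of the mean ergodic theorem that holds in norm. The average \<open>h\<close> of \<open>1, v, \<dots>, v\<^sup>n\<close> satisfies
  \<open>(v - 1) h = (v\<^sup>n\<^sup>+\<^sup>1 - 1) / (n + 1)\<close>, and \<open>1 - h\<close> is divisible by \<open>v - 1\<close> because every \<open>1 - v\<^sup>k\<close> is.
\<close>

lemma approx_kernel_proj_unitary: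
  fixes v :: "'a :: cstar_algebra_1"
  assumes v: "unitary_elem v"
  shows "approx_kernel_proj (v - 1) (\<lambda>n. (1 / real (Suc n)) *\<^sub>R (\<Sum>k<Suc n. v ^ k))"
    (is "approx_kernel_proj _ ?h")
proof -
  have pow: "norm (v ^ k) \<le> 1" for k
    using norm_power_ineq[of v k] norm_unitary[OF v] by simp
  have bound: "norm (?h n) \<le> 1" for n
  proof -
    have "norm (\<Sum>k<Suc n. v ^ k) \<le> (\<Sum>k<Suc n. 1)"
      using pow by (intro sum_norm_le) simp
    then show ?thesis by (simp add: divide_le_eq del: sum.lessThan_Suc)
  qed
  have tele: "(v - 1) * (\<Sum>k<n. v ^ k) = v ^ n - 1" for n
    by (induction n) (simp_all add: algebra_simps)
  have small: "norm ((v - 1) * ?h n) \<le> 2 * (1 / real (Suc n))" for n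
  proof -
    have "norm ((v - 1) * ?h n) = (1 / real (Suc n)) * norm (v ^ Suc n - 1)"
      by (simp only: mult_scaleR_right tele norm_scaleR) simp
    also have "\<dots> \<le> (1 / real (Suc n)) * 2"
      using norm_triangle_ineq4[of "v ^ Suc n" 1] pow[of "Suc n"] by (intro mult_left_mono) auto
    finally show ?thesis by simp
  qed
  have null: "(\<lambda>n. 2 * (1 / real (Suc n))) \<longlonglongrightarrow> 0"
    using tendsto_mult_left[OF LIMSEQ_inverse_real_of_nat, of 2] by (simp add: inverse_eq_divide)
  have star_v: "star (v - 1) = - star v * (v - 1)"
    using v by (simp add: unitary_elem_def star_diff algebra_simps)
  have small': "norm (star (?h n) * (v - 1)) \<le> 2 * (1 / real (Suc n))" for n
  proof -
    have "norm (star (?h n) * (v - 1)) = norm (star (v - 1) * ?h n)"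
      by (metis norm_star star_mult star_star)
    also have "\<dots> = norm (star v * ((v - 1) * ?h n))"
      by (simp only: star_v mult.assoc mult_minus_left norm_minus_cancel)
    also have "\<dots> \<le> norm ((v - 1) * ?h n)"
      using norm_mult_ineq[of "star v" "(v - 1) * ?h n"] norm_unitary[OF v] by (simp add: norm_star)
    finally show ?thesis using small[of n] by linarith
  qed
  have mult: "\<exists>b. 1 - ?h n = b * (v - 1) \<and> 1 - ?h n = (v - 1) * b" for n
  proof -
    obtain q where q: "\<And>k. v ^ k - 1 = q k * (v - 1)" "\<And>k. v ^ k - 1 = (v - 1) * q k"
      using power_diff_one_multiple[of v] by metis
    let ?b = "(- 1 / real (Suc n)) *\<^sub>R (\<Sum>k<Suc n. q k)"
    have one: "1 - ?h n = (- 1 / real (Suc n)) *\<^sub>R (\<Sum>k<Suc n. v ^ k - 1)"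
    proof -
      have "(\<Sum>k<Suc n. v ^ k - 1) = (\<Sum>k<Suc n. v ^ k) - real (Suc n) *\<^sub>R 1"
        by (simp only: sum_subtractf) (simp add: scaleR_conv_of_real)
      then show ?thesis by (simp add: scaleR_right_diff_distrib del: sum.lessThan_Suc)
    qed
    have "(\<Sum>k<Suc n. v ^ k - 1) = (\<Sum>k<Suc n. q k) * (v - 1)"
      unfolding sum_distrib_right by (intro sum.cong refl q(1))
    moreover have "(\<Sum>k<Suc n. v ^ k - 1) = (v - 1) * (\<Sum>k<Suc n. q k)"
      unfolding sum_distrib_left by (intro sum.cong refl q(2))
    ultimately have "1 - ?h n = ?b * (v - 1)" "1 - ?h n = (v - 1) * ?b"
      unfolding one by (simp_all only: mult_scaleR_left mult_scaleR_right)
    then show ?thesis by blast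
  qed
  have mult': "\<exists>b. 1 - star (?h n) = (v - 1) * b" for n
  proof -
    obtain b where "1 - ?h n = b * (v - 1)" using mult by blast
    then have "1 - star (?h n) = star (v - 1) * star b"
      by (metis star_diff star_mult star_one)
    also have "star (v - 1) = (v - 1) * (- star v)"
      using v by (simp add: unitary_elem_def star_diff algebra_simps)
    finally show ?thesis by (auto simp only: mult.assoc)
  qed
  show ?thesis
    unfolding approx_kernel_proj_def
  proof (intro conjI allI)
    show "(\<lambda>n. (v - 1) * ?h n) \<longlonglongrightarrow> 0"
      by (rule Lim_null_comparison[OF _ null]) (intro always_eventually allI small)
    show "(\<lambda>n. star (?h n) * (v - 1)) \<longlonglongrightarrow> 0"
      by (rule Lim_null_comparison[OF _ null]) (intro always_eventually allI small')
  qed (use bound mult mult' in blast)+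
qed

lemma left_multiples_closureI:
  assumes h: "approx_kernel_proj a h" and x: "(\<lambda>n. x * h n) \<longlonglongrightarrow> 0"
  shows "x \<in> closed_span {b * a | b. True}"
proof -
  obtain q where q: "\<And>n. 1 - h n = q n * a"
    using h unfolding approx_kernel_proj_def by metis
  have "x - x * h n = x * q n * a" for n
    using q[of n] by (metis mult.assoc mult.right_neutral right_diff_distrib)
  moreover have "(\<lambda>n. x - x * h n) \<longlonglongrightarrow> x - 0" by (intro tendsto_intros x)
  ultimately have "(\<lambda>n. x * q n * a) \<longlonglongrightarrow> x" by simp
  then show ?thesis
    unfolding closed_span_left_multiples closure_sequential by (intro exI[of _ "\<lambda>n. x * q n * a"]) auto
qed

lemma right_multiples_closureI:
  assumes h: "approx_kernel_proj a h" and x: "(\<lambda>n. star (h n) * x) \<longlonglongrightarrow> 0"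
  shows "x \<in> closed_span {a * b | b. True}"
proof -
  obtain q where q: "\<And>n. 1 - star (h n) = a * q n"
    using h unfolding approx_kernel_proj_def by metis
  have "x - star (h n) * x = a * (q n * x)" for n
    using q[of n] by (metis mult.assoc mult.left_neutral left_diff_distrib)
  moreover have "(\<lambda>n. x - star (h n) * x) \<longlonglongrightarrow> x - 0" by (intro tendsto_intros x)
  ultimately have "(\<lambda>n. a * (q n * x)) \<longlonglongrightarrow> x" by simp
  then show ?thesis
    unfolding closed_span_right_multiples closure_sequential by (intro exI[of _ "\<lambda>n. a * (q n * x)"]) auto
qed

text \<open>
  The elements with vanishing expectation in the limit. If \<open>h\<close> approximates the kernel projection
  of \<open>a\<close>, these are the elements annihilated by every state \<open>\<omega>\<close> with \<open>\<omega>(a\<^sup>* a) = 0\<close>.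
\<close>

definition null_expectation :: "(nat \<Rightarrow> 'a :: cstar_algebra_1) \<Rightarrow> 'a set" where
  "null_expectation h = {x. (\<lambda>n. star (h n) * x * h n) \<longlonglongrightarrow> 0}"

lemma subspace_null_expectation: "complex_vector.subspace (null_expectation h)"
proof (rule complex_vector.subspaceI)
  fix x y assume "x \<in> null_expectation h" "y \<in> null_expectation h"
  then have "(\<lambda>n. star (h n) * x * h n + star (h n) * y * h n) \<longlonglongrightarrow> 0 + 0"
    unfolding null_expectation_def by (intro tendsto_add) auto
  then show "x + y \<in> null_expectation h"
    by (simp add: null_expectation_def distrib_left distrib_right)
next
  fix c x assume "x \<in> null_expectation h"
  then have "(\<lambda>n. c *\<^sub>C (star (h n) * x * h n)) \<longlonglongrightarrow> c *\<^sub>C 0"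
    unfolding null_expectation_def by (intro bounded_linear.tendsto[OF bounded_linear_scaleC]) auto
  then show "c *\<^sub>C x \<in> null_expectation h"
    by (simp add: null_expectation_def mult_scaleC_left mult_scaleC_right)
qed (simp add: null_expectation_def)

lemma closed_null_expectation:
  fixes h :: "nat \<Rightarrow> 'a :: cstar_algebra_1"
  assumes h: "\<And>n. norm (h n) \<le> 1"
  shows "closed (null_expectation h)"
proof -
  have contr: "norm (star (h n) * x * h n) \<le> norm x" for x n
  proof -
    have "norm (star (h n) * x * h n) \<le> norm (star (h n)) * norm x * norm (h n)"
      by (rule order_trans[OF norm_mult_ineq mult_right_mono[OF norm_mult_ineq]]) simp
    also have "\<dots> \<le> 1 * norm x * 1"
      by (intro mult_mono) (auto simp: norm_star h)
    finally show ?thesis by simp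
  qed
  have "x \<in> null_expectation h" if x: "x \<in> closure (null_expectation h)" for x
  proof -
    have "\<exists>N. \<forall>n\<ge>N. norm (star (h n) * x * h n - 0) < e" if e: "e > 0" for e
    proof -
      obtain y where y: "y \<in> null_expectation h" "dist y x < e / 2"
        using x e unfolding closure_approachable by (meson half_gt_zero)
      have "(\<lambda>n. star (h n) * y * h n) \<longlonglongrightarrow> 0" "e / 2 > 0"
        using y(1) e by (simp_all add: null_expectation_def)
      then obtain N where N: "\<And>n. n \<ge> N \<Longrightarrow> norm (star (h n) * y * h n - 0) < e / 2"
        by (meson LIMSEQ_D)
      have "norm (star (h n) * x * h n) < e" if "n \<ge> N" for n
      proof -
        have "star (h n) * x * h n = star (h n) * (x - y) * h n + star (h n) * y * h n"
          by (simp add: algebra_simps)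
        then have "norm (star (h n) * x * h n) \<le> norm (x - y) + norm (star (h n) * y * h n)"
          using norm_triangle_ineq contr[of n "x - y"] by (smt (verit))
        then show ?thesis using N[OF that, unfolded diff_zero] y(2) by (simp add: dist_norm norm_minus_commute)
      qed
      then show ?thesis by auto
    qed
    then show ?thesis unfolding null_expectation_def LIMSEQ_iff by blast
  qed
  then show ?thesis by (meson closure_subset_eq subsetI)
qed

lemma null_expectation_multiples:
  assumes h: "approx_kernel_proj a h"
  shows "b * a \<in> null_expectation h" "a * b \<in> null_expectation h"
proof -
  have le: "norm (h n) \<le> 1" for n using h by (simp add: approx_kernel_proj_def)
  have lim: "(\<lambda>n. norm b * norm (a * h n)) \<longlonglongrightarrow> 0" "(\<lambda>n. norm b * norm (star (h n) * a)) \<longlonglongrightarrow> 0"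
    using h unfolding approx_kernel_proj_def
    by (simp_all only: tendsto_mult_right_zero[OF tendsto_norm_zero])
  have "norm (star (h n) * (b * a) * h n) \<le> norm b * norm (a * h n)" for n
  proof -
    have "norm (star (h n) * (b * (a * h n))) \<le> norm (star (h n)) * (norm b * norm (a * h n))"
      by (rule order_trans[OF norm_mult_ineq mult_left_mono[OF norm_mult_ineq]]) simp
    also have "\<dots> \<le> 1 * (norm b * norm (a * h n))"
      by (intro mult_right_mono) (auto simp: norm_star le)
    finally show ?thesis by (simp add: mult.assoc)
  qed
  then show "b * a \<in> null_expectation h"
    unfolding null_expectation_def mem_Collect_eq
    by (intro Lim_null_comparison[OF _ lim(1)] always_eventually allI)
  have "norm (star (h n) * (a * b) * h n) \<le> norm b * norm (star (h n) * a)" for n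
  proof -
    have "norm (star (h n) * a * b * h n) \<le> norm (star (h n) * a) * norm b * norm (h n)"
      by (rule order_trans[OF norm_mult_ineq mult_right_mono[OF norm_mult_ineq]]) simp
    also have "\<dots> \<le> norm (star (h n) * a) * norm b * 1"
      by (intro mult_left_mono) (auto simp: le)
    finally show ?thesis by (simp add: mult_ac)
  qed
  then show "a * b \<in> null_expectation h"
    unfolding null_expectation_def mem_Collect_eq
    by (intro Lim_null_comparison[OF _ lim(2)] always_eventually allI)
qed

text \<open>This is where the C*-identity enters: \<open>\<parallel>star h * (star x * x) * h\<parallel> = \<parallel>x * h\<parallel>\<^sup>2\<close>.\<close>

lemma null_expectation_star_mult:
  fixes h :: "nat \<Rightarrow> 'a :: cstar_algebra_1"
  assumes "star x * x \<in> null_expectation h"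
  shows "(\<lambda>n. x * h n) \<longlonglongrightarrow> 0"
proof -
  have "norm (star (h n) * (star x * x) * h n) = (norm (x * h n))\<^sup>2" for n
    using norm_star_mult[of "x * h n"] by (simp add: star_mult mult.assoc)
  then have "(\<lambda>n. (norm (x * h n))\<^sup>2) \<longlonglongrightarrow> 0"
    using tendsto_norm_zero[OF assms[unfolded null_expectation_def mem_Collect_eq]] by simp
  then have "(\<lambda>n. sqrt ((norm (x * h n))\<^sup>2)) \<longlonglongrightarrow> sqrt 0" by (rule tendsto_real_sqrt)
  then show ?thesis by (simp add: tendsto_norm_zero_iff)
qed

lemma null_expectation_closed_span:
  assumes h: "approx_kernel_proj a h"
    and x: "star x * x \<in> null_expectation h" "x * star x \<in> null_expectation h"
  shows "x \<in> closed_span {b * a | b. True}" "x \<in> closed_span {a * b | b. True}"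
proof -
  show "x \<in> closed_span {b * a | b. True}"
    by (rule left_multiples_closureI[OF h null_expectation_star_mult[OF x(1)]])
  have "(\<lambda>n. star x * h n) \<longlonglongrightarrow> 0"
    by (rule null_expectation_star_mult) (simp add: x(2))
  then have "(\<lambda>n. norm (star (star x * h n))) \<longlonglongrightarrow> 0"
    unfolding norm_star by (rule tendsto_norm_zero)
  then have "(\<lambda>n. star (h n) * x) \<longlonglongrightarrow> 0"
    by (simp add: star_mult tendsto_norm_zero_iff)
  then show "x \<in> closed_span {a * b | b. True}" by (rule right_multiples_closureI[OF h])
qed


section \<open>Resolvents modulo a closed subspace\<close>

lemma quadratic_variation_constant:
  fixes g :: "real \<Rightarrow> real"
  assumes S: "convex S" and K: "K \<ge> 0"
    and le: "\<And>x y. x \<in> S \<Longrightarrow> y \<in> S \<Longrightarrow> \<bar>g y - g x\<bar> \<le> K * (y - x)\<^sup>2"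
  obtains c where "\<And>x. x \<in> S \<Longrightarrow> g x = c"
proof -
  have "(g has_field_derivative 0) (at x within S)" if x: "x \<in> S" for x
    unfolding has_field_derivative_def has_derivative_within_alt
  proof (intro conjI allI impI)
    show "bounded_linear ((*) (0 :: real))" by (rule bounded_linear_mult_right)
    fix e :: real assume e: "e > 0"
    have "norm (g y - g x - 0 * (y - x)) \<le> e * norm (y - x)"
      if y: "y \<in> S" "norm (y - x) < e / (K + 1)" for y
    proof -
      have "K * \<bar>y - x\<bar> \<le> (K + 1) * \<bar>y - x\<bar>" by (intro mult_right_mono) auto
      also have "\<dots> \<le> e" using y(2) K by (simp add: pos_less_divide_eq mult.commute)
      finally have "K * \<bar>y - x\<bar> * \<bar>y - x\<bar> \<le> e * \<bar>y - x\<bar>" by (rule mult_right_mono) simp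
      then show ?thesis using le[OF x y(1)] by (simp add: power2_eq_square mult.assoc flip: abs_mult)
    qed
    then show "\<exists>d>0. \<forall>y\<in>S. norm (y - x) < d \<longrightarrow> norm (g y - g x - 0 * (y - x)) \<le> e * norm (y - x)"
      using e K by (intro exI[of _ "e / (K + 1)"]) auto
  qed
  then have "\<exists>c. \<forall>x\<in>S. g x = c" by (intro has_field_derivative_zero_constant S)
  then show thesis using that by blast
qed

lemma infdist_add_subspace:
  fixes M :: "'a :: cstar_algebra_1 set"
  assumes M: "complex_vector.subspace M" and m: "m \<in> M"
  shows "infdist x M \<le> infdist y M + norm (x - y - m)"
proof -
  have "infdist (y + m) M \<le> dist y z" if z: "z \<in> M" for z
  proof -
    have "z + m \<in> M" using complex_vector.subspace_add[OF M z m] .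
    then show ?thesis by (rule infdist_le2) simp
  qed
  moreover have "M \<noteq> {}" using m by blast
  ultimately have "infdist (y + m) M \<le> infdist y M"
    by (simp add: infdist_notempty[of M y]) (rule cINF_greatest)
  then show ?thesis
    using infdist_triangle[of x M "y + m"] by (simp add: dist_norm diff_diff_eq)
qed

text \<open>
  In the quotient by \<open>M\<close> the function \<open>Y\<close> has derivative \<open>-i Y\<^sup>2 = 0\<close>, so the distance of \<open>Y l\<close>
  to \<open>M\<close> is constant, and it tends to \<open>0\<close>.
\<close>

lemma resolvent_mem_subspace:
  fixes Y :: "real \<Rightarrow> 'a :: cstar_algebra_1"
  assumes M: "closed M" "complex_vector.subspace M"
    and res: "\<And>l m. l > 0 \<Longrightarrow> m > 0 \<Longrightarrow> Y l - Y m = (\<i> * complex_of_real (m - l)) *\<^sub>C (Y l * Y m)"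
    and norm: "\<And>l. l > 0 \<Longrightarrow> norm (Y l) \<le> 1 / l"
    and sq: "\<And>l. l > 0 \<Longrightarrow> (Y l)\<^sup>2 \<in> M"
    and l: "l > 0"
  shows "Y l \<in> M"
proof -
  let ?g = "\<lambda>m. infdist (Y m) M"
  have norm_le: "norm (Y m) \<le> 1 / l" if "m \<ge> l" for m
    using norm[of m] frac_le[of 1 1 l m] l that by simp
  \<comment> \<open>By the resolvent equation, \<open>Y a - Y b\<close> differs from the element \<open>i (b - a) (Y a)\<^sup>2\<close> of \<open>M\<close>
    by a term of second order in \<open>b - a\<close>.\<close>
  have half: "?g a \<le> ?g b + (1 / l ^ 3) * (b - a)\<^sup>2" if ab: "a \<in> {l..}" "b \<in> {l..}" for a b
  proof -
    let ?c = "\<i> * complex_of_real (b - a)"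
    have a: "a > 0" and b: "b > 0" using ab l by auto
    have "Y a - Y b - ?c *\<^sub>C (Y a)\<^sup>2 = ?c *\<^sub>C (Y a * (Y b - Y a))"
      by (simp add: res[OF a b] right_diff_distrib power2_eq_square complex_vector.scale_right_diff_distrib)
    also have "\<dots> = (- ?c * ?c) *\<^sub>C (Y a * (Y a * Y b))"
    proof -
      have "Y b - Y a = (- ?c) *\<^sub>C (Y a * Y b)"
        using res[OF a b] by (simp add: complex_vector.scale_minus_left algebra_simps)
      then show ?thesis by (simp add: mult_scaleC_right scaleC_scaleC)
    qed
    finally have eq: "Y a - Y b - ?c *\<^sub>C (Y a)\<^sup>2 = (- ?c * ?c) *\<^sub>C (Y a * (Y a * Y b))" .
    have cmod: "cmod (- ?c * ?c) = (b - a)\<^sup>2"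
      by (simp add: norm_mult power2_eq_square flip: of_real_diff abs_mult)
    have "norm (Y a * (Y a * Y b)) \<le> norm (Y a) * (norm (Y a) * norm (Y b))"
      by (rule order_trans[OF norm_mult_ineq mult_left_mono[OF norm_mult_ineq]]) simp
    also have "\<dots> \<le> (1 / l) * ((1 / l) * (1 / l))"
      using ab l by (intro mult_mono norm_le) auto
    also have "\<dots> = 1 / l ^ 3" by (simp add: power3_eq_cube)
    finally have "norm (Y a - Y b - ?c *\<^sub>C (Y a)\<^sup>2) \<le> (b - a)\<^sup>2 * (1 / l ^ 3)"
      unfolding eq norm_scaleC cmod by (rule mult_left_mono) simp
    moreover have "?g a \<le> ?g b + norm (Y a - Y b - ?c *\<^sub>C (Y a)\<^sup>2)"
      by (intro infdist_add_subspace complex_vector.subspace_scale M(2) sq a)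
    ultimately show ?thesis unfolding mult.commute[of "1 / l ^ 3"] by linarith
  qed
  obtain c where c: "\<And>m. m \<in> {l..} \<Longrightarrow> ?g m = c"
  proof (rule quadratic_variation_constant[of "{l..}" "1 / l ^ 3" ?g])
    show "\<bar>?g b - ?g a\<bar> \<le> (1 / l ^ 3) * (b - a)\<^sup>2" if "a \<in> {l..}" "b \<in> {l..}" for a b
      using half[OF that] half[OF that(2,1), unfolded power2_commute[of a b]] by (simp only: abs_le_iff) argo
  qed (use l in auto)
  have zero: "0 \<in> M" by (rule complex_vector.subspace_0[OF M(2)])
  have "c \<le> 1 / m" if m: "m \<ge> l" for m
    using c[of m] infdist_le[OF zero, of "Y m"] norm[of m] m l by simp
  then have "\<forall>\<^sub>F n in sequentially. c \<le> 1 / real n"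
    unfolding eventually_sequentially
    by (intro exI[of _ "nat \<lceil>l\<rceil>"]) (simp add: nat_le_iff ceiling_le_iff)
  then have "c \<le> 0"
    by (rule tendsto_le[OF trivial_limit_sequentially lim_1_over_n tendsto_const])
  then have "?g l = 0" using c[of l] infdist_nonneg[of "Y l" M] by simp
  then show ?thesis using in_closed_iff_infdist_zero[OF M(1)] zero by blast
qed


section \<open>Resolvents in C*-algebras\<close>

lemma symp_form_self: "\<sigma> f f = 0"
  using symp_antisym[of f f] by simp

context
  fixes R :: "real \<Rightarrow> 'x :: symplectic_space \<Rightarrow> 'a :: cstar_algebra_1"
  assumes R: "resolvent_relations R"
begin

lemma resolvent_eq:
    "l \<noteq> 0 \<Longrightarrow> m \<noteq> 0 \<Longrightarrow> R l f - R m f = (\<i> * complex_of_real (m - l)) *\<^sub>C (R l f * R m f)"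
  and resolvent_star: "l \<noteq> 0 \<Longrightarrow> star (R l f) = R (- l) f"
  and resolvent_commutator: "l \<noteq> 0 \<Longrightarrow> m \<noteq> 0 \<Longrightarrow>
    R l f * R m g - R m g * R l f = (\<i> * complex_of_real (\<sigma> f g)) *\<^sub>C (R l f * (R m g)\<^sup>2 * R l f)"
  and resolvent_scale: "n \<noteq> 0 \<Longrightarrow> l \<noteq> 0 \<Longrightarrow> complex_of_real n *\<^sub>C R (n * l) (n *\<^sub>R f) = R l f"
  by (use R[unfolded resolvent_relations_def, THEN conjunct1] in simp,
      use R[unfolded resolvent_relations_def, THEN conjunct2, THEN conjunct1] in simp,
      use R[unfolded resolvent_relations_def, THEN conjunct2, THEN conjunct2, THEN conjunct1] in simp,
      use R[unfolded resolvent_relations_def, THEN conjunct2, THEN conjunct2, THEN conjunct2,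
        THEN conjunct1] in simp)

lemma resolvent_uminus:
  assumes "l \<noteq> 0"
  shows "R (- l) f = - R l (- f)"
  using resolvent_scale[of "- 1" l "- f"] assms
  by (simp add: complex_vector.scale_minus_left scaleC_one minus_equation_iff)

lemma resolvent_commute:
  assumes "l \<noteq> 0" "m \<noteq> 0" "\<sigma> f g = 0"
  shows "R l f * R m g = R m g * R l f"
  using resolvent_commutator[OF assms(1,2), of f g] assms(3) by simp

lemma unitary_cayley:
  assumes l: "l \<noteq> 0"
  shows "unitary_elem (1 - (2 * \<i> * complex_of_real l) *\<^sub>C R l f)"
proof -
  define c where "c = 2 * \<i> * complex_of_real l"
  define P Q where "P = R l f" and "Q = R (- l) f"
  have "Q - P = c *\<^sub>C (Q * P)"
    using resolvent_eq[of "- l" l f] l by (simp add: c_def P_def Q_def mult_ac)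
  then have "c *\<^sub>C (Q - P) = (c * c) *\<^sub>C (Q * P)"
    by (simp add: scaleC_scaleC)
  then have *: "c *\<^sub>C Q - c *\<^sub>C P - (c * c) *\<^sub>C (Q * P) = 0"
    by (simp add: complex_vector.scale_right_diff_distrib)
  have st: "star (1 - c *\<^sub>C P) = 1 + c *\<^sub>C Q"
    using l by (simp add: c_def P_def Q_def star_diff star_scaleC resolvent_star complex_vector.scale_minus_left)
  have expand: "(1 + c *\<^sub>C Q) * (1 - c *\<^sub>C P) = 1 + (c *\<^sub>C Q - c *\<^sub>C P - (c * c) *\<^sub>C (Q * P))"
    by (simp add: distrib_right right_diff_distrib mult_scaleC_left mult_scaleC_right scaleC_scaleC
        scaleC_add_right)
  have 1: "(1 + c *\<^sub>C Q) * (1 - c *\<^sub>C P) = 1"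
    unfolding expand * by simp
  have "Q * P = P * Q"
    using l unfolding P_def Q_def by (intro resolvent_commute) (simp_all add: symp_form_self)
  then have "(1 - c *\<^sub>C P) * (1 + c *\<^sub>C Q) = (1 + c *\<^sub>C Q) * (1 - c *\<^sub>C P)"
    by (simp add: distrib_right distrib_left right_diff_distrib left_diff_distrib
        mult_scaleC_left mult_scaleC_right scaleC_scaleC scaleC_add_right
        complex_vector.scale_right_diff_distrib)
  then have "unitary_elem (1 - c *\<^sub>C P)" using 1 unfolding unitary_elem_def st by simp
  then show ?thesis by (simp add: c_def P_def)
qed

lemma norm_resolvent_le:
  assumes l: "l \<noteq> 0"
  shows "norm (R l f) \<le> 1 / \<bar>l\<bar>"
proof -
  let ?c = "2 * \<i> * complex_of_real l"
  have "2 * \<bar>l\<bar> * norm (R l f) = norm (1 - (1 - ?c *\<^sub>C R l f))"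
    by (simp add: norm_scaleC norm_mult)
  also have "\<dots> \<le> norm (1 :: 'a) + norm (1 - ?c *\<^sub>C R l f)" by (rule norm_triangle_ineq4)
  also have "\<dots> = 2" using norm_unitary[OF unitary_cayley[OF l, of f]] by simp
  finally show ?thesis using l by (simp add: field_simps)
qed

lemma resolvent_approx_kernel_proj:
  assumes l: "l \<noteq> 0" and \<rho>: "\<rho> \<in> spectrum (R l f)"
  obtains h where "approx_kernel_proj (R l f - \<rho> *\<^sub>C 1) h"
proof -
  let ?c = "2 * \<i> * complex_of_real l" and ?A = "R l f - \<rho> *\<^sub>C 1"
  define u where "u = 1 - ?c *\<^sub>C R l f"
  define w where "w = 1 - ?c * \<rho>"
  have c: "?c \<noteq> 0" using l by simp
  have u: "unitary_elem u" unfolding u_def by (rule unitary_cayley[OF l])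
  have uw: "u - w *\<^sub>C 1 = (- ?c) *\<^sub>C ?A"
    by (simp add: u_def w_def complex_vector.scale_left_diff_distrib complex_vector.scale_right_diff_distrib
        scaleC_one scaleC_scaleC complex_vector.scale_minus_left)
  have "w \<in> spectrum u"
    using \<rho> c unfolding spectrum_iff uw by (subst invertible_elem_scaleC_iff) simp_all
  then have w: "cmod w = 1" by (rule spectrum_unitary[OF u])
  then have w0: "w \<noteq> 0" by auto
  have v: "unitary_elem ((1 / w) *\<^sub>C u)"
    using w by (intro unitary_elem_scaleC u) (simp add: norm_divide)
  have "(w / (- ?c)) *\<^sub>C ((1 / w) *\<^sub>C u - 1) = (1 / (- ?c)) *\<^sub>C (u - w *\<^sub>C 1)"
    using w0 by (simp add: complex_vector.scale_right_diff_distrib scaleC_scaleC)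
  also have "\<dots> = ?A"
    unfolding uw scaleC_scaleC using c by (simp add: scaleC_one)
  finally have "(w / (- ?c)) *\<^sub>C ((1 / w) *\<^sub>C u - 1) = ?A" .
  moreover have "w / (- ?c) \<noteq> 0" using w0 c by simp
  ultimately show thesis
    using approx_kernel_proj_scaleC[OF approx_kernel_proj_unitary[OF v]] that by metis
qed

lemma resolvent_shift:
  fixes f :: 'x
  assumes l: "l \<noteq> 0" and m: "m \<noteq> 0"
  defines "B \<equiv> 1 - (\<i> * complex_of_real (m - l)) *\<^sub>C R m f"
  shows "(1 + \<i> * complex_of_real (m - l) * \<rho>) *\<^sub>C R m f - \<rho> *\<^sub>C 1 = B * (R l f - \<rho> *\<^sub>C 1)"
    and "(1 + \<i> * complex_of_real (m - l) * \<rho>) *\<^sub>C R m f - \<rho> *\<^sub>C 1 = (R l f - \<rho> *\<^sub>C 1) * B"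
proof -
  let ?c = "\<i> * complex_of_real (m - l)"
  have comm: "R l f * R m f = R m f * R l f"
    by (intro resolvent_commute l m symp_form_self)
  have eq: "R l f - R m f = ?c *\<^sub>C (R m f * R l f)"
    using resolvent_eq[OF l m, of f] comm by simp
  have "B * (R l f - \<rho> *\<^sub>C 1) = R l f - ?c *\<^sub>C (R m f * R l f) - \<rho> *\<^sub>C 1 + (?c * \<rho>) *\<^sub>C R m f"
    unfolding B_def
    by (simp add: left_diff_distrib right_diff_distrib mult_scaleC_left mult_scaleC_right scaleC_scaleC
        complex_vector.scale_right_diff_distrib)
  also have "\<dots> = (1 + ?c * \<rho>) *\<^sub>C R m f - \<rho> *\<^sub>C 1"
    unfolding eq[symmetric] scaleC_add_left scaleC_one by simp
  finally show 1: "(1 + ?c * \<rho>) *\<^sub>C R m f - \<rho> *\<^sub>C 1 = B * (R l f - \<rho> *\<^sub>C 1)" by simp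
  have "(R l f - \<rho> *\<^sub>C 1) * B = B * (R l f - \<rho> *\<^sub>C 1)"
    unfolding B_def
    by (simp add: left_diff_distrib right_diff_distrib mult_scaleC_left mult_scaleC_right comm
        scaleC_scaleC complex_vector.scale_right_diff_distrib mult.commute)
  then show "(1 + ?c * \<rho>) *\<^sub>C R m f - \<rho> *\<^sub>C 1 = (R l f - \<rho> *\<^sub>C 1) * B" using 1 by simp
qed

text \<open>If the factor were zero, the two factorizations above would exhibit \<open>-\<rho> \<noteq> 0\<close> as a left and a right
  multiple of \<open>R l f - \<rho>\<close>.\<close>

lemma resolvent_shift_nonzero:
  assumes l: "l \<noteq> 0" and m: "m \<noteq> 0" and \<rho>: "\<rho> \<in> spectrum (R l f)"
  shows "1 + \<i> * complex_of_real (m - l) * \<rho> \<noteq> 0"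
proof
  let ?B = "1 - (\<i> * complex_of_real (m - l)) *\<^sub>C R m f"
  assume z: "1 + \<i> * complex_of_real (m - l) * \<rho> = 0"
  then have "\<rho> \<noteq> 0" by auto
  have "?B * (R l f - \<rho> *\<^sub>C 1) = (- \<rho>) *\<^sub>C 1" "(R l f - \<rho> *\<^sub>C 1) * ?B = (- \<rho>) *\<^sub>C 1"
    using resolvent_shift[OF l m, where f = f and \<rho> = \<rho>] z by (simp_all add: complex_vector.scale_minus_left)
  then have "((- 1 / \<rho>) *\<^sub>C ?B) * (R l f - \<rho> *\<^sub>C 1) = 1" "(R l f - \<rho> *\<^sub>C 1) * ((- 1 / \<rho>) *\<^sub>C ?B) = 1"
    using \<open>\<rho> \<noteq> 0\<close> by (simp_all only: mult_scaleC_left mult_scaleC_right) (simp_all add: scaleC_scaleC scaleC_one)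
  then have "invertible_elem (R l f - \<rho> *\<^sub>C 1)" by (rule invertible_elemI)
  then show False using \<rho> by (simp add: spectrum_iff)
qed

text \<open>
  Modulo the null space of the approximate projection, \<open>R l f\<close> acts on both sides as \<open>\<rho>\<close>, so the
  left-hand side of the commutation relation vanishes and the right-hand side is a nonzero multiple
  of \<open>(R m g)\<^sup>2\<close>.
\<close>

lemma resolvent_square_null_expectation:
  assumes l: "l \<noteq> 0" and m: "m \<noteq> 0" and \<rho>: "\<rho> \<noteq> 0" and \<sigma>: "\<sigma> f g \<noteq> 0"
    and h: "approx_kernel_proj (R l f - \<rho> *\<^sub>C 1) h"
  shows "(R m g)\<^sup>2 \<in> null_expectation h"
proof -
  define A where "A = R l f - \<rho> *\<^sub>C 1"
  define Y where "Y = R m g"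
  let ?M = "null_expectation h" and ?s = "\<i> * complex_of_real (\<sigma> f g)"
  note sub = complex_vector.subspace_add[OF subspace_null_expectation]
    complex_vector.subspace_diff[OF subspace_null_expectation]
    complex_vector.subspace_scale[OF subspace_null_expectation]
  have mult: "b * A \<in> ?M" "A * b \<in> ?M" for b
    using null_expectation_multiples[OF h] by (simp_all add: A_def)
  have Rl: "R l f = A + \<rho> *\<^sub>C 1" by (simp add: A_def)
  have "A * Y - Y * A = R l f * Y - Y * R l f"
    unfolding Rl by (simp add: distrib_left distrib_right mult_scaleC_left mult_scaleC_right)
  then have "A * Y - Y * A = ?s *\<^sub>C (R l f * Y\<^sup>2 * R l f)"
    using resolvent_commutator[OF l m, of f g] by (simp only: Y_def)
  moreover have "R l f * Y\<^sup>2 * R l f = A * (Y\<^sup>2 * R l f) + (\<rho> *\<^sub>C Y\<^sup>2) * A + (\<rho> * \<rho>) *\<^sub>C Y\<^sup>2"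
    unfolding Rl
    by (simp add: distrib_left distrib_right mult_scaleC_left mult_scaleC_right scaleC_scaleC
        scaleC_add_right mult.assoc)
  ultimately have "(?s * (\<rho> * \<rho>)) *\<^sub>C Y\<^sup>2 =
      A * Y - Y * A - ?s *\<^sub>C (A * (Y\<^sup>2 * R l f) + (\<rho> *\<^sub>C Y\<^sup>2) * A)"
    by (simp add: scaleC_add_right scaleC_scaleC)
  also have "\<dots> \<in> ?M" by (rule sub sub(2) mult)+
  finally have "(1 / (?s * (\<rho> * \<rho>))) *\<^sub>C (?s * (\<rho> * \<rho>)) *\<^sub>C Y\<^sup>2 \<in> ?M" by (rule sub(3))
  then show ?thesis using \<rho> \<sigma> by (simp add: scaleC_scaleC scaleC_one Y_def)
qed

text \<open>Negative parameters are reduced to positive ones by \<open>R (- m) (- g) = - R m g\<close>.\<close>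

lemma resolvent_null_expectation:
  assumes l: "l \<noteq> 0" and m: "m \<noteq> 0" and \<rho>: "\<rho> \<noteq> 0" and \<sigma>: "\<sigma> f g \<noteq> 0"
    and h: "approx_kernel_proj (R l f - \<rho> *\<^sub>C 1) h"
  shows "R m g \<in> null_expectation h"
proof -
  have pos: "R m g \<in> null_expectation h" if m: "m > 0" and \<sigma>: "\<sigma> f g \<noteq> 0" for m g
  proof (rule resolvent_mem_subspace[where Y = "\<lambda>m. R m g"])
    show "closed (null_expectation h)"
      using h by (intro closed_null_expectation) (simp add: approx_kernel_proj_def)
    show "norm (R k g) \<le> 1 / k" if "k > 0" for k
      using norm_resolvent_le[of k g] that by simp
    show "(R k g)\<^sup>2 \<in> null_expectation h" if "k > 0" for k
      using that \<sigma> by (intro resolvent_square_null_expectation[OF l _ \<rho> _ h]) auto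
  qed (use m subspace_null_expectation resolvent_eq in auto)
  show ?thesis
  proof (cases "m > 0")
    case True
    then show ?thesis using \<sigma> by (rule pos)
  next
    case False
    have "\<sigma> f (- g) = - \<sigma> f g"
      using symp_scaleR_left[of "- 1" g f] symp_antisym[of f "- g"] symp_antisym[of f g] by simp
    then have "R (- m) (- g) \<in> null_expectation h"
      using False m \<sigma> by (intro pos) auto
    then have "- R (- m) (- g) \<in> null_expectation h"
      by (rule complex_vector.subspace_neg[OF subspace_null_expectation])
    then show ?thesis using resolvent_uminus[of "- m" g] m by simp
  qed
qed

text \<open>
  Since \<open>star (R m g) = R (- m) g\<close>, the resolvent equation writes \<open>star (R m g) * R m g\<close> as a
  multiple of \<open>R (- m) g - R m g\<close>.
\<close>

lemma resolvent_mem_closed_span: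
  assumes l: "l \<noteq> 0" and m: "m \<noteq> 0" and \<rho>: "\<rho> \<in> spectrum (R l f)" "\<rho> \<noteq> 0" and \<sigma>: "\<sigma> f g \<noteq> 0"
  shows "R m g \<in> closed_span {b * (R l f - \<rho> *\<^sub>C 1) | b. True}"
    and "R m g \<in> closed_span {(R l f - \<rho> *\<^sub>C 1) * b | b. True}"
proof -
  obtain h where h: "approx_kernel_proj (R l f - \<rho> *\<^sub>C 1) h"
    by (rule resolvent_approx_kernel_proj[OF l \<rho>(1)])
  note sub = complex_vector.subspace_diff[OF subspace_null_expectation]
    complex_vector.subspace_scale[OF subspace_null_expectation]
  have prod: "R k g * R (- k) g \<in> null_expectation h" if k: "k \<noteq> 0" for k
  proof -
    let ?c = "\<i> * complex_of_real (- k - k)"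
    have "(1 / ?c) *\<^sub>C (R k g - R (- k) g) = (1 / ?c) *\<^sub>C ?c *\<^sub>C (R k g * R (- k) g)"
      using resolvent_eq[of k "- k" g] k by simp
    also have "\<dots> = R k g * R (- k) g"
      using k by (simp only: scaleC_scaleC) (simp add: scaleC_one)
    finally have "R k g * R (- k) g = (1 / ?c) *\<^sub>C (R k g - R (- k) g)" ..
    moreover have "\<dots> \<in> null_expectation h"
      using k by (intro sub resolvent_null_expectation[OF l _ \<rho>(2) \<sigma> h]) auto
    ultimately show ?thesis by simp
  qed
  have "star (R m g) * R m g \<in> null_expectation h" "R m g * star (R m g) \<in> null_expectation h"
    using prod[of m] prod[of "- m"] m by (simp_all add: resolvent_star)
  from null_expectation_closed_span[OF h this]
  show "R m g \<in> closed_span {b * (R l f - \<rho> *\<^sub>C 1) | b. True}"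
    and "R m g \<in> closed_span {(R l f - \<rho> *\<^sub>C 1) * b | b. True}" .
qed

text \<open>
  One-sided commutation with a generator. For \<open>\<rho> = 0\<close> the right-hand side of the commutation
  relation has a factor \<open>R l f\<close> at each end; for \<open>\<rho> \<noteq> 0\<close> either \<open>R m g\<close> commutes with \<open>R l f\<close> or it
  lies in the spans itself.
\<close>

lemma resolvent_one_sided:
  assumes l: "l \<noteq> 0" and m: "m \<noteq> 0" and \<rho>: "\<rho> \<in> spectrum (R l f)"
  shows "(R l f - \<rho> *\<^sub>C 1) * R m g \<in> closed_span {b * (R l f - \<rho> *\<^sub>C 1) | b. True}"
    and "R m g * (R l f - \<rho> *\<^sub>C 1) \<in> closed_span {(R l f - \<rho> *\<^sub>C 1) * b | b. True}"
proof -
  let ?A = "R l f - \<rho> *\<^sub>C 1"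
  let ?L = "{b * ?A | b. True}" and ?R = "{?A * b | b. True}"
  consider "\<sigma> f g = 0" | "\<sigma> f g \<noteq> 0" "\<rho> \<noteq> 0" | "\<rho> = 0" by blast
  then have "?A * R m g \<in> closed_span ?L \<and> R m g * ?A \<in> closed_span ?R"
  proof cases
    case 1
    then have "?A * R m g = R m g * ?A"
      using resolvent_commute[OF l m, of f g]
      by (simp add: left_diff_distrib right_diff_distrib mult_scaleC_left mult_scaleC_right)
    then show ?thesis
      using left_multiple_mem[of "R m g" ?A] right_multiple_mem[of ?A "R m g"] by simp
  next
    case 2
    then show ?thesis
      using resolvent_mem_closed_span[OF l m \<rho> 2(2,1)]
      by (simp only: closed_span_left_multiples_left_ideal closed_span_right_multiples_right_ideal)
  next
    case 3
    let ?s = "\<i> * complex_of_real (\<sigma> f g)"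
    have A: "?A = R l f" using 3 by simp
    have "(R m g + ?s *\<^sub>C (R l f * (R m g)\<^sup>2)) * R l f = R m g * R l f + ?s *\<^sub>C (R l f * (R m g)\<^sup>2 * R l f)"
      "R l f * (R m g - ?s *\<^sub>C ((R m g)\<^sup>2 * R l f)) = R l f * R m g - ?s *\<^sub>C (R l f * (R m g)\<^sup>2 * R l f)"
      by (simp_all only: distrib_right right_diff_distrib mult_scaleC_left mult_scaleC_right mult.assoc)
    then have "R l f * R m g = (R m g + ?s *\<^sub>C (R l f * (R m g)\<^sup>2)) * R l f"
      "R m g * R l f = R l f * (R m g - ?s *\<^sub>C ((R m g)\<^sup>2 * R l f))"
      unfolding resolvent_commutator[OF l m, of f g, symmetric] by simp_all
    then show ?thesis unfolding A by (simp only: left_multiple_mem right_multiple_mem)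
  qed
  then show "?A * R m g \<in> closed_span ?L" "R m g * ?A \<in> closed_span ?R" by auto
qed

end


section \<open>The ideals of the resolvent algebra\<close>

lemma resolvent_algebra_closed_induct:
  fixes S :: "'x :: symplectic_space resolvent_algebra set"
  assumes S: "closed S" and one: "1 \<in> S"
    and gen: "\<And>l f. l \<noteq> 0 \<Longrightarrow> Res l f \<in> S"
    and add: "\<And>a b. a \<in> S \<Longrightarrow> b \<in> S \<Longrightarrow> a + b \<in> S"
    and mult: "\<And>a b. a \<in> S \<Longrightarrow> b \<in> S \<Longrightarrow> a * b \<in> S"
    and scale: "\<And>c a. a \<in> S \<Longrightarrow> c *\<^sub>C a \<in> S"
  shows "x \<in> S"
proof -
  let ?e = "resolvent_embed :: 'x pre_resolvent_algebra \<Rightarrow> 'x resolvent_algebra"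
  have hom: "?e (a + b) = ?e a + ?e b" "?e (c *\<^sub>C a) = c *\<^sub>C ?e a" "?e (a * b) = ?e a * ?e b"
    "?e 1 = 1" "?e (star a) = star (?e a)" for a b c
    using star_hom_resolvent_embed[where 'a = 'x] by (simp_all add: star_hom_def)
  have zero: "0 \<in> S" using scale[OF one, of 0] by simp
  have e0: "?e 0 = 0" using hom(2)[of 0 0] by simp
  \<comment> \<open>\<open>S\<close> is not assumed to be closed under the star, but the set of generators is.\<close>
  have "?e a \<in> S \<and> ?e (star a) \<in> S" for a
  proof (induction a rule: pre_resolvent_algebra_induct)
    case (res l f)
    show ?case
    proof (cases "l = 0")
      case True
      then show ?thesis by (simp add: pre_res_zero e0 zero)
    next
      case False
      then have "?e (star (pre_res l f)) = Res (- l) f"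
        by (simp add: hom resolvent_star[OF resolvent_relations_Res] flip: Res_def)
      then show ?thesis using False gen by (simp flip: Res_def)
    qed
  qed (use zero one add mult scale in \<open>simp_all add: hom e0 star_add star_mult star_scaleC\<close>)
  then have "closure (range ?e) \<subseteq> S" by (intro closure_minimal S) auto
  then show ?thesis using dense_resolvent_embed by blast
qed

lemma generated_ideal_eq_left_multiples:
  fixes a :: "'a :: cstar_algebra_1"
  assumes a: "\<And>c. a * c \<in> closed_span {b * a | b. True}"
  shows "generated_ideal a = closed_span {b * a | b. True}" (is "_ = ?L")
proof
  have "closed_ideal ?L"
    using subspace_closed_span[of "{b * a | b. True}"] closed_span_left_multiples_left_ideal[of _ a]
      closed_span_left_multiples_mult_right[OF _ a]
    by (simp add: closed_ideal_def) (simp add: closed_span_def)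
  moreover have "a \<in> ?L" using a[of 1] by simp
  ultimately show "generated_ideal a \<subseteq> ?L" by (rule generated_ideal_least)
  show "?L \<subseteq> generated_ideal a"
    using closed_ideal_generated_ideal[of a] generated_ideal_contains[of a]
    by (intro closed_span_minimal) (auto simp: closed_ideal_def)
qed

lemma generated_ideal_eq_right_multiples:
  fixes a :: "'a :: cstar_algebra_1"
  assumes a: "\<And>c. c * a \<in> closed_span {a * b | b. True}"
  shows "generated_ideal a = closed_span {a * b | b. True}" (is "_ = ?R")
proof
  have "closed_ideal ?R"
    using subspace_closed_span[of "{a * b | b. True}"] closed_span_right_multiples_right_ideal[of _ a]
      closed_span_right_multiples_mult_left[OF _ a]
    by (simp add: closed_ideal_def) (simp add: closed_span_def)
  moreover have "a \<in> ?R" using a[of 1] by simp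
  ultimately show "generated_ideal a \<subseteq> ?R" by (rule generated_ideal_least)
  show "?R \<subseteq> generated_ideal a"
    using closed_ideal_generated_ideal[of a] generated_ideal_contains[of a]
    by (intro closed_span_minimal) (auto simp: closed_ideal_def)
qed

text \<open>An element close to \<open>1\<close> is invertible, so a one-sided approximation of \<open>1\<close> gives a one-sided
  inverse.\<close>

lemma invertible_elem_if_one_in_closed_spans:
  fixes a :: "'a :: cstar_algebra_1"
  assumes "1 \<in> closed_span {b * a | b. True}" "1 \<in> closed_span {a * b | b. True}"
  shows "invertible_elem a"
proof -
  obtain b where b: "dist (b * a) 1 < 1"
    using assms(1) unfolding closed_span_left_multiples closure_approachable
    by (force dest: spec[of _ 1])
  obtain c where c: "dist (a * c) 1 < 1"
    using assms(2) unfolding closed_span_right_multiples closure_approachable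
    by (force dest: spec[of _ 1])
  have "invertible_elem (b * a)" "invertible_elem (a * c)"
    using b c by (auto intro!: invertible_elem_near_one simp: dist_norm norm_minus_commute)
  then obtain d e where "d * (b * a) = 1" "(a * c) * e = 1"
    by (auto simp: invertible_elem_def)
  then show ?thesis
    by (intro invertible_elemI[of "d * b" _ "c * e"]) (simp_all add: mult.assoc)
qed

lemma Res_one_sided:
  fixes f :: "'x :: symplectic_space" and c :: "'x resolvent_algebra"
  assumes l: "l \<noteq> 0" and \<rho>: "\<rho> \<in> spectrum (Res l f)"
  defines "A \<equiv> Res l f - \<rho> *\<^sub>C 1"
  shows "A * c \<in> closed_span {b * A | b. True}" "c * A \<in> closed_span {A * b | b. True}"
proof -
  let ?L = "{b * A | b. True}" and ?R = "{A * b | b. True}"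
  note L = subspace_closed_span[of ?L] and R = subspace_closed_span[of ?R]
  have A: "A \<in> closed_span ?L" "A \<in> closed_span ?R"
    using left_multiple_mem[of 1 A] right_multiple_mem[of A 1] by simp_all
  have "c \<in> {c. A * c \<in> closed_span ?L}"
  proof (rule resolvent_algebra_closed_induct)
    have "closed ((\<lambda>c. A * c) -` closed_span ?L)"
      by (rule closed_vimage) (simp add: closed_span_def, intro continuous_intros)
    then show "closed {c. A * c \<in> closed_span ?L}" by (simp add: vimage_def)
  next
    fix d e assume "d \<in> {c. A * c \<in> closed_span ?L}" "e \<in> {c. A * c \<in> closed_span ?L}"
    then have d: "A * d \<in> closed_span ?L" and e: "A * e \<in> closed_span ?L" by auto
    show "d + e \<in> {c. A * c \<in> closed_span ?L}"
      using complex_vector.subspace_add[OF L d e] by (simp add: distrib_left)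
    have "A * d * e \<in> closed_span ?L" by (rule closed_span_left_multiples_mult_right[OF d e])
    then show "d * e \<in> {c. A * c \<in> closed_span ?L}" by (simp add: mult.assoc)
  qed (use A resolvent_one_sided(1)[OF resolvent_relations_Res l _ \<rho>] complex_vector.subspace_scale[OF L]
      in \<open>auto simp: A_def mult_scaleC_right\<close>)
  then show "A * c \<in> closed_span ?L" by simp
  have "c \<in> {c. c * A \<in> closed_span ?R}"
  proof (rule resolvent_algebra_closed_induct)
    have "closed ((\<lambda>c. c * A) -` closed_span ?R)"
      by (rule closed_vimage) (simp add: closed_span_def, intro continuous_intros)
    then show "closed {c. c * A \<in> closed_span ?R}" by (simp add: vimage_def)
  next
    fix d e assume "d \<in> {c. c * A \<in> closed_span ?R}" "e \<in> {c. c * A \<in> closed_span ?R}"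
    then have d: "d * A \<in> closed_span ?R" and e: "e * A \<in> closed_span ?R" by auto
    show "d + e \<in> {c. c * A \<in> closed_span ?R}"
      using complex_vector.subspace_add[OF R d e] by (simp add: distrib_right)
    have "d * (e * A) \<in> closed_span ?R" by (rule closed_span_right_multiples_mult_left[OF e d])
    then show "d * e \<in> {c. c * A \<in> closed_span ?R}" by (simp add: mult.assoc)
  qed (use A resolvent_one_sided(2)[OF resolvent_relations_Res l _ \<rho>] complex_vector.subspace_scale[OF R]
      in \<open>auto simp: A_def mult_scaleC_left\<close>)
  then show "c * A \<in> closed_span ?R" by simp
qed

theorem proposition4p2:
  fixes l :: real and f :: "'x :: symplectic_space" and \<rho> :: complex
  assumes "l \<noteq> 0" and "f \<noteq> 0" and "\<rho> \<in> spectrum (Res l f)"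
  shows "(closed_ideal (resolvent_ideal l f \<rho>) \<and> resolvent_ideal l f \<rho> \<noteq> UNIV) \<and>
    (resolvent_ideal l f \<rho> = closed_span {a * (Res l f - \<rho> *\<^sub>C 1) | a. True} \<and>
     resolvent_ideal l f \<rho> = closed_span {(Res l f - \<rho> *\<^sub>C 1) * a | a. True}) \<and>
    (\<forall>m :: real. m \<noteq> 0 \<longrightarrow>
       1 + \<i> * complex_of_real (m - l) * \<rho> \<noteq> 0 \<and>
       Res m f - (\<rho> / (1 + \<i> * complex_of_real (m - l) * \<rho>)) *\<^sub>C 1 \<in> resolvent_ideal l f \<rho>) \<and>
    (\<rho> \<noteq> 0 \<longrightarrow>
       (\<forall>(m :: real) g. m \<noteq> 0 \<longrightarrow> \<sigma> g f \<noteq> 0 \<longrightarrow> Res m g \<in> resolvent_ideal l f \<rho>))"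
proof -
  let ?A = "Res l f - \<rho> *\<^sub>C 1"
  note \<rho> = assms(3) and l = assms(1) and rel = resolvent_relations_Res
  have left: "resolvent_ideal l f \<rho> = closed_span {a * ?A | a. True}"
    unfolding resolvent_ideal_def
    by (rule generated_ideal_eq_left_multiples) (rule Res_one_sided(1)[OF l \<rho>])
  have right: "resolvent_ideal l f \<rho> = closed_span {?A * a | a. True}"
    unfolding resolvent_ideal_def
    by (rule generated_ideal_eq_right_multiples) (rule Res_one_sided(2)[OF l \<rho>])
  have ideal: "closed_ideal (resolvent_ideal l f \<rho>)"
    unfolding resolvent_ideal_def by (rule closed_ideal_generated_ideal)
  have A: "?A \<in> resolvent_ideal l f \<rho>"
    unfolding resolvent_ideal_def by (rule generated_ideal_contains)
  have "resolvent_ideal l f \<rho> \<noteq> UNIV"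
  proof
    assume "resolvent_ideal l f \<rho> = UNIV"
    then have "invertible_elem ?A"
      using left right by (intro invertible_elem_if_one_in_closed_spans) simp_all
    then show False using \<rho> by (simp add: spectrum_iff)
  qed
  moreover have "Res m f - (\<rho> / (1 + \<i> * complex_of_real (m - l) * \<rho>)) *\<^sub>C 1 \<in> resolvent_ideal l f \<rho>"
    if m: "m \<noteq> 0" for m
  proof -
    let ?d = "1 + \<i> * complex_of_real (m - l) * \<rho>"
    have d: "?d \<noteq> 0" by (rule resolvent_shift_nonzero[OF rel l m \<rho>])
    have "?d *\<^sub>C Res m f - \<rho> *\<^sub>C 1 \<in> resolvent_ideal l f \<rho>"
      unfolding resolvent_shift(1)[OF rel l m] using ideal A by (simp add: closed_ideal_def)
    then have "(1 / ?d) *\<^sub>C (?d *\<^sub>C Res m f - \<rho> *\<^sub>C 1) \<in> resolvent_ideal l f \<rho>"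
      using ideal by (intro complex_vector.subspace_scale) (simp_all add: closed_ideal_def)
    moreover have "(1 / ?d) *\<^sub>C (?d *\<^sub>C Res m f - \<rho> *\<^sub>C 1) = Res m f - (\<rho> / ?d) *\<^sub>C 1"
      using d by (simp only: complex_vector.scale_right_diff_distrib scaleC_scaleC) (simp add: scaleC_one)
    ultimately show ?thesis by simp
  qed
  moreover have "Res m g \<in> resolvent_ideal l f \<rho>" if "\<rho> \<noteq> 0" "m \<noteq> 0" "\<sigma> g f \<noteq> 0" for m g
  proof -
    have "\<sigma> f g \<noteq> 0" using that(3) symp_antisym[of g f] by simp
    then show ?thesis
      unfolding left by (rule resolvent_mem_closed_span(1)[OF rel l that(2) \<rho> that(1)])
  qed
  ultimately show ?thesis
    using ideal left right resolvent_shift_nonzero[OF rel l _ \<rho>] by blast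
qed

end
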